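(* Let $(X_t,Y_t)_{t\ge 0}$ be a continuous time hidden Markov model as described in the context, with signal state space $E$ (a Polish space), laws $\{\mathbf{P}^\mu:\mu\in P(E)\}$ and nonlinear filters $\pi_t^\mu$. Let $G\subset C_b(E)$ be uniformly bounded and equicontinuous, and suppose that the filtering model is $G$-uniformly observable, i.e., that for all sequences $\{\mu_n\},\{\nu_n\}\subset P(E)$, $$\|\mathbf{P}^{\mu_n}|_{\mathcal{F}^Y}-\mathbf{P}^{\nu_n}|_{\mathcal{F}^Y}\|_{\mathrm{TV}}\xrightarrow{n\to\infty}0\quad\text{implies}\quad\|\mu_n-\nu_n\|_G\xrightarrow{n\to\infty}0.$$ Then for all $\mu,\nu\in P(E)$ such that $\mathbf{P}^\mu|_{\mathcal{F}^Y}\ll\mathbf{P}^\nu|_{\mathcal{F}^Y}$, $$\|\pi_t^\mu-\pi_t^\nu\|_G\xrightarrow{t\to\infty}0,\qquad \mathbf{P}^\mu\text{-a.s.}$$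
   Context: Notation. For a Polish space $S$ with complete metric, $B(S)$ and $C_b(S)$ are the spaces of bounded measurable and bounded continuous real functions, and $P(S)$ is the space of Borel probability measures with the topology of weak convergence. For uniformly bounded $G\subset C_b(S)$ and $\mu,\nu\in P(S)$, $\|\mu-\nu\|_G:=\sup_{g\in G}|\int g\,d\mu-\int g\,d\nu|$. $\|\cdot\|_{\mathrm{TV}}$ is total variation distance, normalized as the supremum of differences of integrals of measurable functions with absolute value at most $1$. Hidden Markov model. $E$ is a Polish space with a fixed complete metric and $q\in\mathbb{N}$. $\Omega=D([0,\infty[;E)\times D([0,\infty[;\mathbb{R}^q)$ (càdlàg paths, Skorokhod topologies) with its Borel $\sigma$-field $\tilde{\mathcal F}$; $X_t(x,y)=x(t)$ and $Y_t(x,y)=y(t)$ are the coordinate projections. $\tilde{\mathcal F}_t^X=\sigma\{X_s:s\le t\}$, $\tilde{\mathcal F}_t^Y=\sigma\{Y_s:s\le t\}$, $\tilde{\mathcal F}_t=\tilde{\mathcal F}_t^X\vee\tilde{\mathcal F}_t^Y$, $\tilde{\mathcal F}^Y=\bigvee_{t\ge0}\tilde{\mathcal F}_t^Y$. A family $\{\mathbf{P}^\mu:\mu\in P(E)\}\subset P(\Omega)$ and a Markov semigroup $T_t:B(E\times\mathbb{R}^q)\to B(E\times\mathbb{R}^q)$ are given. $\mathcal F$, $\mathcal F^Y$ denote the completions of $\tilde{\mathcal F},\tilde{\mathcal F}^Y$, and $\mathcal F_t$, $\mathcal F_t^Y$ the usual augmentations of $\tilde{\mathcal F}_t,\tilde{\mathcal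 F}_t^Y$, with respect to the family $\{\mathbf{P}^\mu:\mu\in P(E)\}$. It is assumed that for every $\mu\in P(E)$, $f\in B(E\times\mathbb{R}^q)$ and $t\ge s\ge0$, $$\mathbf{E}^\mu(f(X_t,Y_t)|\mathcal F_s)=(T_{t-s}f)(X_s,Y_s),\qquad \mathbf{E}^\mu(f(X_t,Y_t))=\int (T_tf)(x,0)\,\mu(dx),$$ so $(X_t,Y_t)$ is Markov with initial law $\mu\otimes\delta_{\{0\}}$ under $\mathbf{P}^\mu$ ($\mathbf{E}^\mu$ is expectation under $\mathbf{P}^\mu$). It is also assumed that the model is Markov additive: for any $f\in B(E\times\mathbb{R}^q)$ and $t\ge 0$, $(T_tS_yf)(x,y)$ does not depend on $y$, where $(S_yf)(x,z)=f(x,z-y)$. Nonlinear filter. For every $\mu\in P(E)$, $\pi^\mu:[0,\infty[\times\Omega\times\mathcal B(E)\to[0,1]$ denotes a probability kernel such that (1) for every $A\in\mathcal B(E)$, the process $(t,\omega)\mapsto\pi^\mu(t,\omega,A)$ is the $\mathcal F_t^Y$-optional projection under $\mathbf{P}^\mu$ of $(t,\omega)\mapsto I_A(X_t(\omega))$; (2) for every $\omega\in\Omega$, $t\mapsto\pi^\mu(t,\omega,\cdot)$ is càdlàg in the topology of $P(E)$. Such a kernel is known to exist and is unique up to $\mathbf{P}^\mu|_{\mathcal F^Y}$-indistinguishability. Write $\pi_t^\mu$ for the random measure $\omega\mapsto\pi^\mu(t,\omega,\cdot)$. *)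

theory Defs
  imports "HOL-Probability.Probability"
begin

section \<open>Function classes and probability measures\<close>

definition bounded_measurable :: "('a::topological_space \<Rightarrow> real) set" where
  "bounded_measurable = {f \<in> borel_measurable borel. bounded (range f)}"

abbreviation prob_measures :: "'a::topological_space measure set" where
  "prob_measures \<equiv> space (prob_algebra borel)"

definition weak_topology :: "'a::topological_space measure topology" where
  "weak_topology = topology_generated_by
     {{\<mu> \<in> prob_measures. (\<integral>x. f x \<partial>\<mu>) \<in> U} | f U. f \<in> bcontfun \<and> open (U :: real set)}"

definition uniformly_bounded :: "('a \<Rightarrow> real) set \<Rightarrow> bool" where
  "uniformly_bounded G \<longleftrightarrow> (\<exists>C. \<forall>g\<in>G. \<forall>x. \<bar>g x\<bar> \<le> C)"

text \<open>Equicontinuity at every point, not uniformly over the points.\<close>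

definition equicontinuous :: "('a::metric_space \<Rightarrow> real) set \<Rightarrow> bool" where
  "equicontinuous G \<longleftrightarrow>
     (\<forall>x. \<forall>e>0. \<exists>d>0. \<forall>g\<in>G. \<forall>y. dist y x < d \<longrightarrow> \<bar>g y - g x\<bar> < e)"

text \<open>Inserting 0 makes the supremum over the empty family equal to 0 and is otherwise irrelevant.\<close>

definition dist_on :: "('a \<Rightarrow> real) set \<Rightarrow> 'a measure \<Rightarrow> 'a measure \<Rightarrow> real" where
  "dist_on G \<mu> \<nu> = Sup (insert 0 ((\<lambda>g. \<bar>(\<integral>x. g x \<partial>\<mu>) - (\<integral>x. g x \<partial>\<nu>)\<bar>) ` G))"

definition tv_dist :: "'a measure \<Rightarrow> 'a measure \<Rightarrow> real" where
  "tv_dist M N = (SUP f\<in>{f \<in> borel_measurable M. \<forall>x\<in>space M. \<bar>f x\<bar> \<le> 1}.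
     \<bar>(\<integral>x. f x \<partial>M) - (\<integral>x. f x \<partial>N)\<bar>)"


section \<open>Cadlag paths and the Skorokhod topology\<close>

definition cadlag_in :: "'a topology \<Rightarrow> (real \<Rightarrow> 'a) \<Rightarrow> bool" where
  "cadlag_in X x \<longleftrightarrow> (\<forall>t\<ge>0. limitin X x (x t) (at_right t)) \<and>
                     (\<forall>t>0. \<exists>l. limitin X x l (at_left t))"

text \<open>
  Paths are indexed by \<open>[0, \<infinity>)\<close>; the value \<open>undefined\<close> at negative times makes
  equality of paths the equality of their restrictions to \<open>[0, \<infinity>)\<close>.
\<close>

typedef (overloaded) 'a cadlag =
  "{x :: real \<Rightarrow> 'a::topological_space. cadlag_in euclidean x \<and> (\<forall>t<0. x t = undefined)}"
  morphisms path_at Abs_cadlag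
  by (rule exI[of _ "\<lambda>t. undefined"]) (auto simp: cadlag_in_def)

text \<open>Increasing bijections of \<open>[0, \<infinity>)\<close>; these are automatically continuous.\<close>

definition time_changes :: "(real \<Rightarrow> real) set" where
  "time_changes = {\<tau>. strict_mono_on {0..} \<tau> \<and> \<tau> ` {0..} = {0..}}"

definition skorokhod_nbhd :: "real \<Rightarrow> real \<Rightarrow> 'a::metric_space cadlag \<Rightarrow> 'a cadlag set" where
  "skorokhod_nbhd N e x = {y. \<exists>\<tau>\<in>time_changes.
     (\<forall>s\<ge>0. \<bar>\<tau> s - s\<bar> < e) \<and> (\<forall>s\<in>{0..N}. dist (path_at y (\<tau> s)) (path_at x s) < e)}"

lemma skorokhod_nbhd_mono:
  "N' \<le> N \<Longrightarrow> e \<le> e' \<Longrightarrow> skorokhod_nbhd N e x \<subseteq> skorokhod_nbhd N' e' x"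
proof
  assume "N' \<le> N" and e: "e \<le> e'"
  then have N: "{0..N'} \<subseteq> {0..N}" by simp
  fix y assume "y \<in> skorokhod_nbhd N e x"
  then obtain \<tau> where "\<tau> \<in> time_changes" "\<forall>s\<ge>0. \<bar>\<tau> s - s\<bar> < e"
    "\<forall>s\<in>{0..N}. dist (path_at y (\<tau> s)) (path_at x s) < e"
    unfolding skorokhod_nbhd_def by blast
  then have "\<tau> \<in> time_changes" "\<forall>s\<ge>0. \<bar>\<tau> s - s\<bar> < e'"
    "\<forall>s\<in>{0..N'}. dist (path_at y (\<tau> s)) (path_at x s) < e'"
    using N e by (blast intro: less_le_trans)+
  then show "y \<in> skorokhod_nbhd N' e' x"
    unfolding skorokhod_nbhd_def by blast
qed

text \<open>
  The Skorokhod J1 topology. It is the metrizable topology in which \<open>x\<^sub>n\<close> converges to \<open>x\<close> iff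
  there are time changes \<open>\<tau>\<^sub>n\<close> with \<open>sup\<^sub>s \<bar>\<tau>\<^sub>n s - s\<bar> \<rightarrow> 0\<close> and
  \<open>sup\<^sub>s\<^sub>\<le>\<^sub>N dist (x\<^sub>n (\<tau>\<^sub>n s)) (x s) \<rightarrow> 0\<close> for every \<open>N\<close>
  (Ethier and Kurtz, Markov Processes, Proposition 3.5.3; Jacod and Shiryaev, Limit Theorems for
  Stochastic Processes, Theorem VI.1.14), that is, iff
  \<open>x\<^sub>n\<close> is eventually in \<open>skorokhod_nbhd N e x\<close> for all \<open>N\<close> and \<open>e > 0\<close>.
\<close>

instantiation cadlag :: (metric_space) topological_space
begin

definition open_cadlag :: "'a cadlag set \<Rightarrow> bool" where
  "open_cadlag U \<longleftrightarrow> (\<forall>x\<in>U. \<exists>N. \<exists>e>0. skorokhod_nbhd N e x \<subseteq> U)"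

instance
proof
  show "open (UNIV :: 'a cadlag set)"
    by (auto simp: open_cadlag_def intro: exI[of _ 1])
next
  fix S T :: "'a cadlag set"
  assume S: "open S" and T: "open T"
  show "open (S \<inter> T)"
    unfolding open_cadlag_def
  proof
    fix x assume "x \<in> S \<inter> T"
    then obtain N1 e1 N2 e2 where *: "e1 > 0" "skorokhod_nbhd N1 e1 x \<subseteq> S"
      "e2 > 0" "skorokhod_nbhd N2 e2 x \<subseteq> T"
      using S T unfolding open_cadlag_def by blast
    have "min e1 e2 > 0" using * by simp
    moreover have "skorokhod_nbhd (max N1 N2) (min e1 e2) x \<subseteq> S \<inter> T"
      using * skorokhod_nbhd_mono[of N1 "max N1 N2" "min e1 e2" e1 x]
        skorokhod_nbhd_mono[of N2 "max N1 N2" "min e1 e2" e2 x] by auto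
    ultimately show "\<exists>N. \<exists>e>0. skorokhod_nbhd N e x \<subseteq> S \<inter> T"
      by blast
  qed
next
  fix K :: "'a cadlag set set"
  assume K: "\<forall>S\<in>K. open S"
  show "open (\<Union>K)"
    unfolding open_cadlag_def
  proof
    fix x assume "x \<in> \<Union>K"
    then obtain S where S: "S \<in> K" "x \<in> S" by blast
    then obtain N e where "e > 0" "skorokhod_nbhd N e x \<subseteq> S"
      using K unfolding open_cadlag_def by blast
    then show "\<exists>N. \<exists>e>0. skorokhod_nbhd N e x \<subseteq> \<Union>K"
      using S by blast
  qed
qed

end


section \<open>The path space and its filtrations\<close>

type_synonym ('e, 'q) paths = "'e cadlag \<times> (real ^ 'q) cadlag"

definition signal :: "real \<Rightarrow> ('e::topological_space, 'q::finite) paths \<Rightarrow> 'e" where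
  "signal t \<omega> = path_at (fst \<omega>) t"

definition observation :: "real \<Rightarrow> ('e::topological_space, 'q::finite) paths \<Rightarrow> real ^ 'q" where
  "observation t \<omega> = path_at (snd \<omega>) t"

text \<open>
  Filtrations are indexed by \<open>[0, \<infinity>]\<close>, represented by \<^typ>\<open>ennreal\<close>; the index \<open>\<infinity>\<close> is the
  \<open>\<sigma>\<close>-field generated by all times.
\<close>

definition raw_signal_filtration ::
  "ennreal \<Rightarrow> ('e::topological_space, 'q::finite) paths measure" where
  "raw_signal_filtration t =
     sigma UNIV {signal s -` A | s A. 0 \<le> s \<and> ennreal s \<le> t \<and> A \<in> sets borel}"

definition raw_obs_filtration ::
  "ennreal \<Rightarrow> ('e::topological_space, 'q::finite) paths measure" where
  "raw_obs_filtration t =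
     sigma UNIV {observation s -` A | s A. 0 \<le> s \<and> ennreal s \<le> t \<and> A \<in> sets borel}"

definition raw_filtration ::
  "ennreal \<Rightarrow> ('e::topological_space, 'q::finite) paths measure" where
  "raw_filtration t =
     sigma UNIV (sets (raw_signal_filtration t) \<union> sets (raw_obs_filtration t))"

text \<open>
  Completion and usual augmentation with respect to the whole family
  \<open>(P \<mu>)\<^sub>\<mu>\<close> are the intersections over \<open>\<mu>\<close> of the completions and usual augmentations with respect
  to the single laws \<open>P \<mu>\<close>. The null sets adjoined are those of the \<open>P \<mu>\<close>-completion
  of the \<open>\<sigma>\<close>-field \<open>M\<close>. In \<open>augmentation\<close> the alternative \<open>s = \<infinity>\<close> matters only
  for \<open>t = \<infinity>\<close>, where no \<open>s > t\<close> exists.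
\<close>

definition family_completion ::
  "('e::topological_space measure \<Rightarrow> 'w measure) \<Rightarrow> 'w measure \<Rightarrow> 'w measure" where
  "family_completion P M =
     sigma UNIV (\<Inter>\<mu>\<in>prob_measures. sets (completion (restr_to_subalg (P \<mu>) M)))"

definition augmentation ::
  "('e::topological_space measure \<Rightarrow> 'w measure) \<Rightarrow> 'w measure \<Rightarrow>
     (ennreal \<Rightarrow> 'w measure) \<Rightarrow> ennreal \<Rightarrow> 'w measure" where
  "augmentation P M F t = sigma UNIV
     (\<Inter>\<mu>\<in>prob_measures. \<Inter>s\<in>{s. t < s \<or> s = \<infinity>}.
        sigma_sets UNIV (sets (F s) \<union> null_sets (completion (restr_to_subalg (P \<mu>) M))))"

context
  fixes P :: "'e::metric_space measure \<Rightarrow> ('e, 'q::finite) paths measure"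
begin

definition full_field :: "('e, 'q) paths measure" where
  "full_field = family_completion P borel"

definition full_filtration :: "ennreal \<Rightarrow> ('e, 'q) paths measure" where
  "full_filtration = augmentation P borel raw_filtration"

definition obs_field :: "('e, 'q) paths measure" where
  "obs_field = family_completion P (raw_obs_filtration \<infinity>)"

definition obs_filtration :: "ennreal \<Rightarrow> ('e, 'q) paths measure" where
  "obs_filtration = augmentation P (raw_obs_filtration \<infinity>) raw_obs_filtration"

definition obs_law :: "'e measure \<Rightarrow> ('e, 'q) paths measure" where
  "obs_law \<mu> = restr_to_subalg (completion (P \<mu>)) obs_field"

end


section \<open>The hidden Markov model\<close>

text \<open>Monotone continuity says that \<open>T t\<close> is given by a Markov kernel.\<close>

locale markov_semigroup =
  fixes T :: "real \<Rightarrow> ('s::topological_space \<Rightarrow> real) \<Rightarrow> 's \<Rightarrow> real"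
  assumes bounded_measurable:
      "t \<ge> 0 \<Longrightarrow> f \<in> bounded_measurable \<Longrightarrow> T t f \<in> bounded_measurable"
    and linear:
      "t \<ge> 0 \<Longrightarrow> f \<in> bounded_measurable \<Longrightarrow> g \<in> bounded_measurable \<Longrightarrow>
         T t (\<lambda>z. a * f z + b * g z) = (\<lambda>z. a * T t f z + b * T t g z)"
    and positive:
      "t \<ge> 0 \<Longrightarrow> f \<in> bounded_measurable \<Longrightarrow> (\<And>z. 0 \<le> f z) \<Longrightarrow> 0 \<le> T t f z"
    and unit: "t \<ge> 0 \<Longrightarrow> T t (\<lambda>_. 1) = (\<lambda>_. 1)"
    and monotone_continuous:
      "t \<ge> 0 \<Longrightarrow> (\<And>n. h n \<in> bounded_measurable) \<Longrightarrow> f \<in> bounded_measurable \<Longrightarrow>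
         (\<And>z. incseq (\<lambda>n. h n z)) \<Longrightarrow> (\<And>z. (\<lambda>n. h n z) \<longlonglongrightarrow> f z) \<Longrightarrow>
         (\<lambda>n. T t (h n) z) \<longlonglongrightarrow> T t f z"
    and zero: "f \<in> bounded_measurable \<Longrightarrow> T 0 f = f"
    and add:
      "s \<ge> 0 \<Longrightarrow> t \<ge> 0 \<Longrightarrow> f \<in> bounded_measurable \<Longrightarrow> T (s + t) f = T s (T t f)"

definition obs_shift :: "real ^ 'q \<Rightarrow> ('e \<times> (real ^ 'q) \<Rightarrow> real) \<Rightarrow> 'e \<times> (real ^ 'q) \<Rightarrow> real" where
  "obs_shift y f = (\<lambda>(x, z). f (x, z - y))"

locale hidden_markov_model = markov_semigroup T
  for T :: "real \<Rightarrow> ('e::polish_space \<times> (real ^ 'q::finite) \<Rightarrow> real) \<Rightarrow> 'e \<times> (real ^ 'q) \<Rightarrow> real" +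
  fixes P :: "'e measure \<Rightarrow> ('e, 'q) paths measure"
  assumes law: "\<mu> \<in> prob_measures \<Longrightarrow> P \<mu> \<in> prob_measures"
    and markov:
      "\<mu> \<in> prob_measures \<Longrightarrow> f \<in> bounded_measurable \<Longrightarrow> 0 \<le> s \<Longrightarrow> s \<le> t \<Longrightarrow>
         AE \<omega> in completion (P \<mu>).
           real_cond_exp (completion (P \<mu>)) (full_filtration P (ennreal s))
             (\<lambda>\<omega>. f (signal t \<omega>, observation t \<omega>)) \<omega>
           = T (t - s) f (signal s \<omega>, observation s \<omega>)"
    and initial:
      "\<mu> \<in> prob_measures \<Longrightarrow> f \<in> bounded_measurable \<Longrightarrow> 0 \<le> t \<Longrightarrow>
         (\<integral>\<omega>. f (signal t \<omega>, observation t \<omega>) \<partial>P \<mu>) = (\<integral>x. T t f (x, 0) \<partial>\<mu>)"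
    and additive:
      "f \<in> bounded_measurable \<Longrightarrow> 0 \<le> t \<Longrightarrow>
         T t (obs_shift y f) (x, y) = T t (obs_shift y' f) (x, y')"


section \<open>The nonlinear filter\<close>

definition optional_field :: "(ennreal \<Rightarrow> 'w measure) \<Rightarrow> (real \<times> 'w) measure" where
  "optional_field F = sigma ({0..} \<times> UNIV)
     {{(t, \<omega>). 0 \<le> t \<and> Z t \<omega> \<in> B} | Z B.
        (\<forall>t\<ge>0. Z t \<in> borel_measurable (F (ennreal t))) \<and>
        (\<forall>\<omega>. cadlag_in euclidean (\<lambda>t. Z t \<omega>)) \<and>
        B \<in> sets (borel :: real measure)}"

definition stopped :: "(real \<Rightarrow> 'w \<Rightarrow> real) \<Rightarrow> ('w \<Rightarrow> ennreal) \<Rightarrow> 'w \<Rightarrow> real" where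
  "stopped H \<sigma> \<omega> = (if \<sigma> \<omega> < \<infinity> then H (enn2real (\<sigma> \<omega>)) \<omega> else 0)"

definition optional_projection ::
  "'w measure \<Rightarrow> (ennreal \<Rightarrow> 'w measure) \<Rightarrow> (real \<Rightarrow> 'w \<Rightarrow> real) \<Rightarrow> (real \<Rightarrow> 'w \<Rightarrow> real) \<Rightarrow> bool"
where
  "optional_projection M F H Z \<longleftrightarrow>
     (\<lambda>(t, \<omega>). Z t \<omega>) \<in> borel_measurable (optional_field F) \<and>
     (\<forall>\<sigma>. stopping_time F \<sigma> \<longrightarrow>
        (AE \<omega> in M. real_cond_exp M (filtration.pre_sigma UNIV F \<sigma>) (stopped H \<sigma>) \<omega>
                    = stopped Z \<sigma> \<omega>))"

definition nonlinear_filter ::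
  "('e::metric_space measure \<Rightarrow> ('e, 'q::finite) paths measure) \<Rightarrow> 'e measure \<Rightarrow>
     (real \<Rightarrow> ('e, 'q) paths \<Rightarrow> 'e measure) \<Rightarrow> bool"
where
  "nonlinear_filter P \<mu> \<pi> \<longleftrightarrow>
     (\<lambda>(t, \<omega>). \<pi> t \<omega>) \<in> restrict_space borel {0..} \<Otimes>\<^sub>M full_field P \<rightarrow>\<^sub>M prob_algebra borel \<and>
     (\<forall>A\<in>sets borel. optional_projection (completion (P \<mu>)) (obs_filtration P)
        (\<lambda>t \<omega>. indicator A (signal t \<omega>)) (\<lambda>t \<omega>. measure (\<pi> t \<omega>) A)) \<and>
     (\<forall>\<omega>. cadlag_in weak_topology (\<lambda>t. \<pi> t \<omega>))"


section \<open>Uniform observability\<close>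

definition uniformly_observable ::
  "('e::metric_space \<Rightarrow> real) set \<Rightarrow> ('e measure \<Rightarrow> ('e, 'q::finite) paths measure) \<Rightarrow> bool"
where
  "uniformly_observable G P \<longleftrightarrow>
     (\<forall>\<mu> \<nu> :: nat \<Rightarrow> 'e measure.
        (\<forall>n. \<mu> n \<in> prob_measures) \<longrightarrow> (\<forall>n. \<nu> n \<in> prob_measures) \<longrightarrow>
        (\<lambda>n. tv_dist (obs_law P (\<mu> n)) (obs_law P (\<nu> n))) \<longlonglongrightarrow> 0 \<longrightarrow>
        (\<lambda>n. dist_on G (\<mu> n) (\<nu> n)) \<longlonglongrightarrow> 0)"

end

theory Submission
  imports Defs
begin

text \<open>
  Let \<open>N\<close> and \<open>M = \<Lambda> N\<close> be the observation laws under \<open>\<nu>\<close> and \<open>\<mu>\<close>. By the Markov property and Markov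
  additivity, the increments of the observation after time \<open>t\<close> have, conditionally on the
  observations up to \<open>t\<close>, the law \<open>P (\<pi> \<mu> t \<omega>)\<close> under \<open>M\<close> and \<open>P (\<pi> \<nu> t \<omega>)\<close> under \<open>N\<close>. If \<open>X\<close> is
  known at some time \<open>s\<close> and close to \<open>\<Lambda>\<close> in \<open>L\<^sup>1(N)\<close>, then for \<open>t \<ge> s\<close> and every event \<open>A\<close> the
  difference of the two conditional probabilities of \<open>A\<close>, multiplied by \<open>X\<close>, is at most the conditional
  expectation of \<open>\<bar>\<Lambda> - X\<bar>\<close>. A maximal inequality over rational \<open>t\<close> and over \<open>A\<close> in a countable algebra
  shows that the total variation distance of the two conditional laws tends to \<open>0\<close> along rational
  times. Uniform observability, applied for fixed \<open>\<omega>\<close>, gives convergence of the filters along rational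
  times, and right continuity extends it to all times.
\<close>

section \<open>Bounded measurable functions and approximation\<close>

text \<open>Martingale convergence handles one fixed event with its own null set; here the event
  moves with \<open>t\<close> and the bound has to be uniform over events. The variable
  \<open>X\<close> overcomes this: the bound by the conditional expectation of
  \<open>\<bar>\<Lambda> - X\<bar>\<close> does not depend on the event, so one finite measure
  controls all pairs of a time and an event, and a first-passage argument runs over pairs as it
  would over times. No regular conditional law has to be constructed:
  \<open>P (\<pi> \<mu> t \<omega>)\<close> exists for every \<omega>, which is why uniform
  observability can be used pointwise. That it is a conditional law rests on two facts to be derived
  from the model: observation events have measurable probabilities in the starting point, and
  \<open>P \<mu>\<close> is the mixture of the laws started from points. The estimate comes weighted
  by the density \<Lambda>, which is positive almost surely under \<open>M\<close>; this is where
  the direction of absolute continuity enters. Completion attaches to each law its own exceptional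
  sets. Two laws are compared through the law with the averaged initial distribution, again a member
  of the family.\<close>

definition bounded_measurable_on :: "'a measure \<Rightarrow> ('a \<Rightarrow> real) set" where
  "bounded_measurable_on K = {f \<in> borel_measurable K. bounded (range f)}"

lemma bounded_measurable_on_borel: "bounded_measurable_on borel = bounded_measurable"
  by (simp add: bounded_measurable_on_def bounded_measurable_def)

lemma bounded_measurable_onI:
  "f \<in> borel_measurable K \<Longrightarrow> (\<And>x. \<bar>f x\<bar> \<le> C) \<Longrightarrow> f \<in> bounded_measurable_on K"
  unfolding bounded_measurable_on_def bounded_iff by auto

lemma bounded_measurable_onD:
  assumes "f \<in> bounded_measurable_on K"
  shows "f \<in> borel_measurable K" "\<exists>C. \<forall>x. \<bar>f x\<bar> \<le> C"
  using assms unfolding bounded_measurable_on_def bounded_iff by auto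

lemma bounded_measurable_on_indicator: "A \<in> sets K \<Longrightarrow> indicator A \<in> bounded_measurable_on K"
  by (rule bounded_measurable_onI[where C=1]) (auto split: split_indicator)

lemma bounded_measurable_on_const: "(\<lambda>_. c) \<in> bounded_measurable_on K"
  by (rule bounded_measurable_onI[where C="\<bar>c\<bar>"]) auto

lemma bounded_measurable_on_lin:
  assumes "f \<in> bounded_measurable_on K" "g \<in> bounded_measurable_on K"
  shows "(\<lambda>x. a * f x + b * g x) \<in> bounded_measurable_on K"
proof -
  note [measurable] = bounded_measurable_onD(1)[OF assms(1)] bounded_measurable_onD(1)[OF assms(2)]
  obtain C D where CD: "\<And>x. \<bar>f x\<bar> \<le> C" "\<And>x. \<bar>g x\<bar> \<le> D"
    using bounded_measurable_onD(2)[OF assms(1)] bounded_measurable_onD(2)[OF assms(2)] by blast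
  have "\<bar>a * f x + b * g x\<bar> \<le> \<bar>a\<bar> * C + \<bar>b\<bar> * D" for x
    using CD[of x] by (intro order_trans[OF abs_triangle_ineq] add_mono)
      (auto simp: abs_mult intro: mult_left_mono)
  then show ?thesis by (intro bounded_measurable_onI) auto
qed

lemmas bounded_measurableI = bounded_measurable_onI[where K=borel, unfolded bounded_measurable_on_borel]
lemmas bounded_measurableD = bounded_measurable_onD[where K=borel, unfolded bounded_measurable_on_borel]
lemmas bounded_measurable_indicator =
  bounded_measurable_on_indicator[where K=borel, unfolded bounded_measurable_on_borel]
lemmas bounded_measurable_const =
  bounded_measurable_on_const[where K=borel, unfolded bounded_measurable_on_borel]
lemmas bounded_measurable_lin =
  bounded_measurable_on_lin[where K=borel, unfolded bounded_measurable_on_borel]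

lemma bounded_measurable_mult:
  assumes "f \<in> bounded_measurable" "g \<in> bounded_measurable"
  shows "(\<lambda>x. f x * g x) \<in> bounded_measurable"
proof -
  note [measurable] = bounded_measurableD(1)[OF assms(1)] bounded_measurableD(1)[OF assms(2)]
  obtain C D where CD: "\<And>x. \<bar>f x\<bar> \<le> C" "\<And>x. \<bar>g x\<bar> \<le> D"
    using bounded_measurableD(2)[OF assms(1)] bounded_measurableD(2)[OF assms(2)] by blast
  have "\<bar>f x * g x\<bar> \<le> C * D" for x
    unfolding abs_mult using CD[of x] by (intro mult_mono) (auto intro: order_trans[OF abs_ge_zero])
  then show ?thesis by (intro bounded_measurableI) auto
qed

lemma bounded_measurable_compose:
  assumes "f \<in> bounded_measurable" and [measurable]: "g \<in> borel \<rightarrow>\<^sub>M borel"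
  shows "(\<lambda>x. f (g x)) \<in> bounded_measurable"
proof -
  note [measurable] = bounded_measurableD(1)[OF assms(1)]
  obtain C where "\<And>x. \<bar>f x\<bar> \<le> C"
    using bounded_measurableD(2)[OF assms(1)] by blast
  then show ?thesis by (intro bounded_measurableI[where C=C]) auto
qed

text \<open>Every \<open>h n\<close> lies between \<open>h 0\<close> and the limit \<open>f\<close>,
  both bounded. The constant serves as majorant in dominated convergence.\<close>

lemma bounded_measurable_on_monotone_bound:
  assumes h: "\<And>n::nat. h n \<in> bounded_measurable_on K" and f: "f \<in> bounded_measurable_on K"
    and inc: "\<And>z. incseq (\<lambda>n. h n z)" and lim: "\<And>z. (\<lambda>n. h n z) \<longlonglongrightarrow> f z"
  obtains C where "\<And>n z. \<bar>h n z\<bar> \<le> C"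
proof -
  obtain C D where CD: "\<And>z. \<bar>f z\<bar> \<le> C" "\<And>z. \<bar>h 0 z\<bar> \<le> D"
    using bounded_measurable_onD(2)[OF f] bounded_measurable_onD(2)[OF h] by metis
  have "\<bar>h n z\<bar> \<le> C + D" for n z
  proof -
    have "h 0 z \<le> h n z" using inc[of z] by (simp add: incseq_def)
    moreover have "h n z \<le> f z" using incseq_le[OF inc[of z] lim[of z]] .
    ultimately show ?thesis using CD[of z] by linarith
  qed
  then show ?thesis by (rule that)
qed

text \<open>A functional monotone class argument: Dynkin's theorem goes from \<open>G\<close> to all
  sets of \<open>K\<close>, simple functions and increasing limits lead to nonnegative functions,
  and adding a constant leads to signed ones. The limit case is confined to increasing sequences
  because that is the continuity a Markov semigroup provides.\<close>

lemma bounded_measurable_on_induct [consumes 4, case_names generator lin mono]: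
  fixes f :: "'a \<Rightarrow> real"
  assumes gen: "sets K = sigma_sets UNIV G" and stable: "Int_stable G" and UNIV_G: "UNIV \<in> G"
    and f: "f \<in> bounded_measurable_on K"
    and base: "\<And>A. A \<in> G \<Longrightarrow> Q (indicator A)"
    and lin: "\<And>f g a b. f \<in> bounded_measurable_on K \<Longrightarrow> g \<in> bounded_measurable_on K \<Longrightarrow> Q f \<Longrightarrow> Q g \<Longrightarrow>
        Q (\<lambda>x. a * f x + b * g x)"
    and mono: "\<And>f h. (\<And>n. h n \<in> bounded_measurable_on K) \<Longrightarrow> (\<And>n::nat. Q (h n)) \<Longrightarrow>
        f \<in> bounded_measurable_on K \<Longrightarrow> (\<And>z. incseq (\<lambda>n. h n z)) \<Longrightarrow>
        (\<And>z. (\<lambda>n. h n z) \<longlonglongrightarrow> f z) \<Longrightarrow> Q f"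
  shows "Q f"
proof -
  let ?B = "bounded_measurable_on K"
  have sK: "A \<in> sets K \<longleftrightarrow> A \<in> sigma_sets UNIV G" for A using gen by simp
  have UNIV_K: "UNIV \<in> sets K" using UNIV_G sK by auto
  have sp: "space K = UNIV" using sets.sets_into_space[OF UNIV_K] by auto
  note indB = bounded_measurable_on_indicator[where K=K]
  have diff: "Q (indicator (UNIV - A))" if "A \<in> sets K" "Q (indicator A)" for A
  proof -
    have "(\<lambda>x. 1 * indicator UNIV x + (-1) * indicator A x) = (indicator (UNIV - A) :: _ \<Rightarrow> real)"
      by (auto split: split_indicator)
    then show ?thesis
      using lin[OF indB[OF UNIV_K] indB[OF that(1)] base[OF UNIV_G] that(2), of 1 "-1"] by simp
  qed
  have empty: "Q (indicator {})" using diff[OF UNIV_K base[OF UNIV_G]] by (simp only: Diff_cancel)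
  have ind: "Q (indicator A)" if A: "A \<in> sets K" for A
  proof -
    from stable _ A[unfolded gen] show ?thesis
    proof (rule sigma_sets_induct_disjoint)
      show "Q (indicator A)" if "A \<in> G" for A by (rule base[OF that])
      show "Q (indicator {})" by (rule empty)
      show "Q (indicator (UNIV - A))" if "A \<in> sigma_sets UNIV G" "Q (indicator A)" for A
        using diff that sK by blast
      fix A :: "nat \<Rightarrow> 'a set"
      assume dis: "disjoint_family A" and A: "range A \<subseteq> sigma_sets UNIV G" and QA: "\<And>i. Q (indicator (A i))"
      have AK: "A i \<in> sets K" for i using A sK by auto
      have "Q (indicator (\<Union>i<n. A i))" for n
      proof (induction n)
        case 0
        then show ?case using empty by (simp only: lessThan_0 image_empty Union_empty)
      next
        case (Suc n)
        have "A n \<inter> (\<Union>i<n. A i) = {}"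
          using disjoint_family_onD[OF dis, of n] by (auto simp: set_eq_iff)
        then have "(\<lambda>p. 1 * indicator (\<Union>i<n. A i) p + 1 * indicator (A n) p) = (indicator (\<Union>i<Suc n. A i) :: _ \<Rightarrow> real)"
          by (auto simp: fun_eq_iff lessThan_Suc split: split_indicator)
        with lin[OF indB indB Suc QA[of n], of 1 1] AK show ?case by auto
      qed
      then show "Q (indicator (\<Union>i. A i))"
      proof (rule mono[rotated 1])
        show "indicator (\<Union>i<n. A i) \<in> ?B" "indicator (\<Union>i. A i) \<in> ?B" for n using AK by (auto intro!: indB)
        show "incseq (\<lambda>n. indicator (\<Union>i<n. A i) p :: real)" for p
          by (auto simp: incseq_def split: split_indicator intro: less_le_trans)
        show "(\<lambda>n. indicator (\<Union>i<n. A i) p :: real) \<longlonglongrightarrow> indicator (\<Union>i. A i) p" for p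
          by (rule LIMSEQ_indicator_UN)
      qed
    qed simp
  qed
  obtain C where C: "\<And>x. \<bar>f x\<bar> \<le> C" using bounded_measurable_onD(2)[OF f] by blast
  have nn: "0 \<le> f x + C" for x using C[of x] by linarith
  have bmI: "u \<in> ?B" if "u \<in> borel_measurable K" "\<And>x. 0 \<le> u x" "\<And>x. u x \<le> D" for u :: "'a \<Rightarrow> real" and D
    using that by (intro bounded_measurable_onI[where C=D]) auto
  \<comment> \<open>Boundedness is a premise inside the induction formula because the induction rule
    ranges over unbounded functions as well.\<close>
  have main: "(\<exists>D. \<forall>x. u x \<le> D) \<longrightarrow> Q u"
    if "u \<in> borel_measurable K" "\<And>x. 0 \<le> u x" for u :: "'a \<Rightarrow> real"
    using that
  proof (induction rule: borel_measurable_induct_real)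
    case (set A)
    then show ?case using ind by auto
  next
    case (mult u c)
    show ?case
    proof (cases "c = 0")
      case True
      show ?thesis using lin[OF indB indB empty empty, of 0 0] True by simp
    next
      case False
      then have c: "c > 0" using mult by simp
      show ?thesis
      proof
        assume "\<exists>D. \<forall>x. c * u x \<le> D"
        then obtain D where "\<And>x. c * u x \<le> D" by blast
        then have D: "u x \<le> D / c" for x using c by (simp add: field_simps)
        then have "Q u" using mult by blast
        moreover have "u \<in> bounded_measurable_on K" using bmI[OF mult(2,3) D] .
        ultimately show "Q (\<lambda>x. c * u x)"
          using lin[of u u c 0] by simp
      qed
    qed
  next
    case (add u v)
    show ?case
    proof
      assume "\<exists>D. \<forall>x. v x + u x \<le> D"
      then obtain D where D: "\<And>x. v x + u x \<le> D" by blast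
      have le: "u x \<le> D" "v x \<le> D" for x using D[of x] add(2)[of x] add(4)[of x] by linarith+
      then have "Q u" "Q v" using add.IH by blast+
      then show "Q (\<lambda>x. v x + u x)"
        using lin[of v u 1 1] bmI[OF add(1,2) le(1)] bmI[OF add(3,4) le(2)] by simp
    qed
  next
    case (seq U)
    have le: "U i x \<le> u x" for i x
      using incseq_le[OF _ seq(4)[unfolded sp, OF UNIV_I, of x], of i] seq(3) by (simp add: incseq_def le_fun_def)
    show ?case
    proof
      assume "\<exists>D. \<forall>x. u x \<le> D"
      then obtain D where D: "\<And>x. u x \<le> D" by blast
      have U: "U i x \<le> D" for i x using le[of i x] D[of x] by linarith
      show "Q u"
      proof (rule mono[of U])
        show "U n \<in> bounded_measurable_on K" for n using bmI[OF seq(1,2) U] .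
        show "Q (U n)" for n using seq.IH U by blast
        show "u \<in> bounded_measurable_on K" using bmI[OF that D] .
        show "incseq (\<lambda>n. U n z)" for z using seq(3) by (simp add: incseq_def le_fun_def)
        show "(\<lambda>n. U n z) \<longlonglongrightarrow> u z" for z using seq(4) by (simp add: sp)
      qed
    qed
  qed
  have "Q (\<lambda>x. f x + C)"
    using main[of "\<lambda>x. f x + C"] nn C bounded_measurable_onD(1)[OF f]
    by (force intro: exI[of _ "2 * C"] simp: abs_le_iff)
  moreover have "(\<lambda>x. f x + C) \<in> ?B"
    using bounded_measurable_on_lin[OF f bounded_measurable_on_const, of 1 1 C] by simp
  ultimately show ?thesis
    using lin[OF _ indB[OF UNIV_K] _ base[OF UNIV_G], of "\<lambda>x. f x + C" 1 "- C"] by simp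
qed

text \<open>Point evaluations, integrals and the operators of a Markov semigroup share the properties of a
  Daniell integral of total mass at most one. For measurable families of such functionals, identities
  need only be verified on the indicators of a generating system.\<close>

definition daniell :: "'a measure \<Rightarrow> (('a \<Rightarrow> real) \<Rightarrow> real) \<Rightarrow> bool" where
  "daniell K L \<longleftrightarrow>
     (\<forall>f\<in>bounded_measurable_on K. \<forall>g\<in>bounded_measurable_on K. \<forall>a b.
        L (\<lambda>x. a * f x + b * g x) = a * L f + b * L g) \<and>
     (\<forall>f\<in>bounded_measurable_on K. \<forall>C. (\<forall>x. \<bar>f x\<bar> \<le> C) \<longrightarrow> \<bar>L f\<bar> \<le> C) \<and>
     (\<forall>h. \<forall>f\<in>bounded_measurable_on K. (\<forall>n::nat. h n \<in> bounded_measurable_on K) \<longrightarrow>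
        (\<forall>z. incseq (\<lambda>n. h n z)) \<longrightarrow> (\<forall>z. (\<lambda>n. h n z) \<longlonglongrightarrow> f z) \<longrightarrow> (\<lambda>n. L (h n)) \<longlonglongrightarrow> L f)"

lemma daniell_lin:
  "daniell K L \<Longrightarrow> f \<in> bounded_measurable_on K \<Longrightarrow> g \<in> bounded_measurable_on K \<Longrightarrow>
    L (\<lambda>x. a * f x + b * g x) = a * L f + b * L g"
  by (simp add: daniell_def)

lemma daniell_bound:
  "daniell K L \<Longrightarrow> f \<in> bounded_measurable_on K \<Longrightarrow> (\<And>x. \<bar>f x\<bar> \<le> C) \<Longrightarrow> \<bar>L f\<bar> \<le> C"
  by (simp add: daniell_def)

lemma daniell_mono:
  "daniell K L \<Longrightarrow> (\<And>n::nat. h n \<in> bounded_measurable_on K) \<Longrightarrow> f \<in> bounded_measurable_on K \<Longrightarrow>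
    (\<And>z. incseq (\<lambda>n. h n z)) \<Longrightarrow> (\<And>z. (\<lambda>n. h n z) \<longlonglongrightarrow> f z) \<Longrightarrow> (\<lambda>n. L (h n)) \<longlonglongrightarrow> L f"
  by (simp add: daniell_def)

lemma daniell_eval: "daniell K (\<lambda>f. f z)"
  by (simp add: daniell_def)

lemma integrable_bounded_measurable_on:
  assumes "prob_space M" "space M = space K" "sets K \<subseteq> sets M" "f \<in> bounded_measurable_on K"
  shows "integrable M f"
proof -
  interpret prob_space M by fact
  obtain C where "\<And>x. \<bar>f x\<bar> \<le> C" using bounded_measurable_onD(2)[OF assms(4)] by blast
  moreover have "subalgebra M K" using assms(2,3) by (simp add: subalgebra_def)
  ultimately show ?thesis
    using measurable_from_subalg[OF _ bounded_measurable_onD(1)[OF assms(4)]]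
    by (intro integrable_const_bound[where B=C]) auto
qed

lemma daniell_integral:
  assumes M: "prob_space M" "space M = space K" "sets K \<subseteq> sets M"
  shows "daniell K (\<lambda>f. \<integral>x. f x \<partial>M)"
  unfolding daniell_def
proof (intro conjI ballI allI impI)
  interpret prob_space M by fact
  note int = integrable_bounded_measurable_on[OF M]
  fix f assume f: "f \<in> bounded_measurable_on K"
  show "(\<integral>x. a * f x + b * g x \<partial>M) = a * (\<integral>x. f x \<partial>M) + b * (\<integral>x. g x \<partial>M)"
    if "g \<in> bounded_measurable_on K" for g a b
    using int[OF f] int[OF that] by simp
  show "\<bar>\<integral>x. f x \<partial>M\<bar> \<le> C" if "\<forall>x. \<bar>f x\<bar> \<le> C" for C
    using int[OF f] that by (intro order_trans[OF integral_abs_bound integral_le_const]) auto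
  fix h assume h: "\<forall>n::nat. h n \<in> bounded_measurable_on K"
    and inc: "\<forall>z. incseq (\<lambda>n. h n z)" and lim: "\<forall>z. (\<lambda>n. h n z) \<longlonglongrightarrow> f z"
  obtain C where C: "\<And>n z. \<bar>h n z\<bar> \<le> C"
    by (rule bounded_measurable_on_monotone_bound[of h K f]) (use h f inc lim in auto)
  show "(\<lambda>n. \<integral>x. h n x \<partial>M) \<longlonglongrightarrow> (\<integral>x. f x \<partial>M)"
  proof (rule integral_dominated_convergence[where w="\<lambda>_. C"])
    show "f \<in> borel_measurable M" "h n \<in> borel_measurable M" for n
      using int f h by (auto intro: borel_measurable_integrable)
  qed (use C lim in auto)
qed

lemma daniell_measurable:
  assumes gen: "sets K = sigma_sets UNIV G" "Int_stable G" "UNIV \<in> G"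
    and L: "\<And>w. daniell K (L w)"
    and base: "\<And>A. A \<in> G \<Longrightarrow> (\<lambda>w. L w (indicator A)) \<in> borel_measurable F"
    and f: "f \<in> bounded_measurable_on K"
  shows "(\<lambda>w. L w f) \<in> borel_measurable F"
  using gen f
proof (induction rule: bounded_measurable_on_induct)
  case (lin f g a b)
  then show ?case by (simp add: daniell_lin[OF L])
next
  case (mono f h)
  show ?case
    by (rule borel_measurable_LIMSEQ_real[OF daniell_mono[OF L mono.hyps(1-4)] mono.IH])
qed (rule base)

text \<open>With \<open>B\<close> running through a sigma-field this is an identity of conditional
  expectations. It serves three times: for the Markov property with a parameter, for the restarted
  observation and for the filter.\<close>

lemma integral_daniell_eq:
  assumes M: "prob_space M"
    and gen: "sets K = sigma_sets UNIV G" "Int_stable G" "UNIV \<in> G"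
    and L: "\<And>w. daniell K (L w)" and L': "\<And>w. daniell K (L' w)"
    and m: "\<And>A. A \<in> G \<Longrightarrow> (\<lambda>w. L w (indicator A)) \<in> borel_measurable M"
    and m': "\<And>A. A \<in> G \<Longrightarrow> (\<lambda>w. L' w (indicator A)) \<in> borel_measurable M"
    and B: "B \<in> sets M"
    and base: "\<And>A. A \<in> G \<Longrightarrow> (\<integral>w. indicator B w * L w (indicator A) \<partial>M) = (\<integral>w. indicator B w * L' w (indicator A) \<partial>M)"
    and f: "f \<in> bounded_measurable_on K"
  shows "(\<integral>w. indicator B w * L w f \<partial>M) = (\<integral>w. indicator B w * L' w f \<partial>M)"
proof -
  interpret prob_space M by fact
  have meas: "(\<lambda>w. indicator B w * R w f) \<in> borel_measurable M"
    if "\<And>w. daniell K (R w)" "\<And>A. A \<in> G \<Longrightarrow> (\<lambda>w. R w (indicator A)) \<in> borel_measurable M"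
      "f \<in> bounded_measurable_on K" for R f
    using daniell_measurable[OF gen that] B by auto
  have bnd: "norm (indicator B w * R f) \<le> \<bar>C\<bar>"
    if "daniell K R" "f \<in> bounded_measurable_on K" "\<And>x. \<bar>f x\<bar> \<le> C" for R f C w
    using daniell_bound[OF that] by (auto split: split_indicator)
  have int: "integrable M (\<lambda>w. indicator B w * R w f)"
    if R: "\<And>w. daniell K (R w)" "\<And>A. A \<in> G \<Longrightarrow> (\<lambda>w. R w (indicator A)) \<in> borel_measurable M"
      and f: "f \<in> bounded_measurable_on K" for R f
  proof -
    obtain C where "\<And>x. \<bar>f x\<bar> \<le> C" using bounded_measurable_onD(2)[OF f] by blast
    then show ?thesis
      using meas[OF R f] bnd[OF R(1) f] by (intro integrable_const_bound[where B="\<bar>C\<bar>"]) auto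
  qed
  have comb: "(\<integral>w. indicator B w * R w (\<lambda>x. a * f x + b * g x) \<partial>M) =
      a * (\<integral>w. indicator B w * R w f \<partial>M) + b * (\<integral>w. indicator B w * R w g \<partial>M)"
    if R: "\<And>w. daniell K (R w)" "\<And>A. A \<in> G \<Longrightarrow> (\<lambda>w. R w (indicator A)) \<in> borel_measurable M"
      and fg: "f \<in> bounded_measurable_on K" "g \<in> bounded_measurable_on K" for R f g a b
  proof -
    have "(\<integral>w. indicator B w * R w (\<lambda>x. a * f x + b * g x) \<partial>M) =
        (\<integral>w. a * (indicator B w * R w f) + b * (indicator B w * R w g) \<partial>M)"
      by (simp add: daniell_lin[OF R(1) fg] algebra_simps)
    then show ?thesis using int[OF R fg(1)] int[OF R fg(2)] by simp
  qed
  show ?thesis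
    using gen f
  proof (induction rule: bounded_measurable_on_induct)
    case (lin f g a b)
    then show ?case using comb[OF L m lin.hyps] comb[OF L' m' lin.hyps] by simp
  next
    case (mono f h)
    obtain C where C: "\<And>n z. \<bar>h n z\<bar> \<le> C"
      using bounded_measurable_on_monotone_bound[OF mono.hyps] by blast
    have conv: "(\<lambda>n. \<integral>w. indicator B w * R w (h n) \<partial>M) \<longlonglongrightarrow> (\<integral>w. indicator B w * R w f \<partial>M)"
      if R: "\<And>w. daniell K (R w)" "\<And>A. A \<in> G \<Longrightarrow> (\<lambda>w. R w (indicator A)) \<in> borel_measurable M" for R
    proof (rule integral_dominated_convergence[where w="\<lambda>_. \<bar>C\<bar>"])
      show "AE w in M. (\<lambda>n. indicator B w * R w (h n)) \<longlonglongrightarrow> indicator B w * R w f"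
        by (intro AE_I2 tendsto_mult_left daniell_mono[OF R(1) mono.hyps])
      show "AE w in M. norm (indicator B w * R w (h n)) \<le> \<bar>C\<bar>" for n
        by (intro AE_I2 bnd[OF R(1) mono.hyps(1) C])
    qed (use meas[OF R] mono.hyps in auto)
    from conv[OF L m, unfolded mono.IH] conv[OF L' m'] show ?case by (rule LIMSEQ_unique)
  qed (rule base)
qed

text \<open>The approximable sets form a sigma-algebra. For a countable union, continuity from below
  reduces to finitely many sets at a cost of \<open>e / 2\<close>, and the other
  \<open>e / 2\<close> is shared among these.\<close>

lemma algebra_approximation:
  fixes M :: "'a measure"
  assumes fin: "finite_measure M" and alg: "algebra (space M) \<A>" and sub: "\<A> \<subseteq> sets M"
    and A: "A \<in> sigma_sets (space M) \<A>" and e: "e > 0"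
  shows "\<exists>A0\<in>\<A>. measure M (sym_diff A A0) < e"
proof -
  interpret finite_measure M by fact
  interpret alg: algebra "space M" \<A> by fact
  have sets: "A \<in> sets M" if "A \<in> sigma_sets (space M) \<A>" for A
    using sets.sigma_sets_subset[OF sub] that by auto
  from A have "\<forall>e>0. \<exists>A0\<in>\<A>. measure M (sym_diff A A0) < e"
  proof (induction rule: sigma_sets.induct)
    case (Basic a)
    then show ?case by (intro allI impI bexI[of _ a]) auto
  next
    case Empty
    then show ?case by (intro allI impI bexI[of _ "{}"]) auto
  next
    case (Compl a)
    show ?case
    proof (intro allI impI)
      fix e :: real assume "e > 0"
      then obtain A0 where A0: "A0 \<in> \<A>" "measure M (sym_diff a A0) < e" using Compl by blast
      have "sym_diff (space M - a) (space M - A0) = sym_diff a A0"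
        using sets.sets_into_space[OF sets[OF Compl.hyps]] alg.sets_into_space[OF A0(1)] by auto
      then show "\<exists>A0\<in>\<A>. measure M (sym_diff (space M - a) A0) < e"
        using A0 by (intro bexI[of _ "space M - A0"]) auto
    qed
  next
    case (Union a)
    have a[measurable]: "a i \<in> sets M" for i using Union.hyps sets by blast
    show ?case
    proof (intro allI impI)
      fix e :: real assume e: "e > 0"
      have "(\<lambda>n. measure M (\<Union>i<n. a i)) \<longlonglongrightarrow> measure M (\<Union>n. \<Union>i<n. a i)"
        by (intro finite_Lim_measure_incseq) (auto simp: incseq_def intro: less_le_trans)
      moreover have "(\<Union>n. \<Union>i<n. a i) = (\<Union>i. a i)" by blast
      ultimately have "\<forall>\<^sub>F n in sequentially. measure M (\<Union>i. a i) - e / 2 < measure M (\<Union>i<n. a i)"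
        using e by (intro order_tendstoD(1)[where a="measure M (\<Union>i. a i) - e / 2"]) auto
      then obtain n where n: "measure M (\<Union>i. a i) - e / 2 < measure M (\<Union>i<n. a i)"
        by (auto simp: eventually_sequentially)
      \<comment> \<open>The share uses \<open>real n + 1\<close> instead of \<open>real n\<close>
        because \<open>n\<close> may be 0.\<close>
      have "\<exists>A0\<in>\<A>. measure M (sym_diff (a i) A0) < e / (2 * (real n + 1))" for i
        using Union.IH e by simp
      then obtain B where B: "\<And>i. B i \<in> \<A>" "\<And>i. measure M (sym_diff (a i) (B i)) < e / (2 * (real n + 1))"
        by metis
      have [measurable]: "B i \<in> sets M" for i using B(1) sub by auto
      have "measure M (sym_diff (\<Union>i. a i) (\<Union>i<n. B i))
          \<le> measure M (((\<Union>i. a i) - (\<Union>i<n. a i)) \<union> (\<Union>i<n. sym_diff (a i) (B i)))"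
        by (intro finite_measure_mono) (auto, measurable)
      also have "\<dots> \<le> measure M ((\<Union>i. a i) - (\<Union>i<n. a i)) + measure M (\<Union>i<n. sym_diff (a i) (B i))"
        by (intro measure_Un_le) auto
      also have "measure M ((\<Union>i. a i) - (\<Union>i<n. a i)) = measure M (\<Union>i. a i) - measure M (\<Union>i<n. a i)"
        by (intro finite_measure_Diff) auto
      also have "measure M (\<Union>i<n. sym_diff (a i) (B i)) \<le> (\<Sum>i<n. measure M (sym_diff (a i) (B i)))"
        by (intro measure_UNION_le) auto
      also have "\<dots> \<le> (\<Sum>i<n. e / (2 * (real n + 1)))"
        using B(2) by (intro sum_mono less_imp_le) auto
      also have "\<dots> \<le> e / 2" using e by (simp add: field_simps)
      finally have "measure M (sym_diff (\<Union>i. a i) (\<Union>i<n. B i)) < e" using n by linarith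
      moreover have "(\<Union>i<n. B i) \<in> \<A>" using B(1) by (intro alg.finite_UN) auto
      ultimately show "\<exists>A0\<in>\<A>. measure M (sym_diff (\<Union> (range a)) A0) < e" by blast
    qed
  qed
  with e show ?thesis by blast
qed

text \<open>A function with values in the unit interval is approximated by the average of the
  indicators of its superlevel sets at \<open>k / n\<close>, \<open>k = 1, \<dots>, n\<close>.\<close>

lemma integral_diff_le_of_sets:
  fixes f :: "'a \<Rightarrow> real"
  assumes M: "prob_space M" and N: "prob_space N" and sets: "sets M = sets N"
    and c: "\<And>A. A \<in> sets M \<Longrightarrow> \<bar>measure M A - measure N A\<bar> \<le> c"
    and f[measurable]: "f \<in> borel_measurable M" and f01: "\<And>x. x \<in> space M \<Longrightarrow> 0 \<le> f x \<and> f x \<le> 1"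
  shows "\<bar>(\<integral>x. f x \<partial>M) - (\<integral>x. f x \<partial>N)\<bar> \<le> c"
proof (rule field_le_epsilon)
  fix e :: real assume e: "e > 0"
  interpret M: prob_space M by fact
  interpret N: prob_space N by fact
  note [measurable_cong] = sets[symmetric]
  have sp: "space N = space M" using sets by (metis sets_eq_imp_space_eq)
  \<comment> \<open>The rounding error \<open>1 / real n\<close> is paid once under each of the two
    laws, hence \<open>2 / e\<close>.\<close>
  obtain n :: nat where n: "2 / e < real n" using reals_Archimedean2 by blast
  then have n0: "0 < real n" using e by (meson divide_pos_pos less_trans zero_less_numeral)
  define A where "A k = {x \<in> space M. real k \<le> real n * f x}" for k :: nat
  define g where "g x = (\<Sum>k=1..n. indicator (A k) x :: real) / real n" for x
  have A[measurable]: "A k \<in> sets M" "A k \<in> sets N" for k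
    unfolding A_def by (auto simp: sets[symmetric])
  have fg: "\<bar>f x - g x\<bar> \<le> 1 / real n" if x: "x \<in> space M" for x
  proof -
    \<comment> \<open>\<open>x\<close> lies in exactly the first \<open>m\<close> superlevel sets,
      so \<open>g x\<close> is \<open>f x\<close> rounded down to a multiple of
      \<open>1 / real n\<close>.\<close>
    define m where "m = nat \<lfloor>real n * f x\<rfloor>"
    have nf: "0 \<le> real n * f x" "real n * f x \<le> real n" using f01[OF x] n0
      by (auto intro: mult_left_le)
    then have m: "real m \<le> real n * f x" "real n * f x < real m + 1"
      unfolding m_def by linarith+
    have "m \<le> n" using m(1) nf(2) by linarith
    have "{k \<in> {1..n}. x \<in> A k} = {1..m}"
    proof -
      have "real k \<le> real n * f x \<longleftrightarrow> k \<le> m" for k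
        using m by (metis le_nat_floor m_def nf(1) of_nat_mono order_trans)
      then have A_iff: "x \<in> A k \<longleftrightarrow> k \<le> m" for k
        using x by (simp only: A_def mem_Collect_eq simp_thms)
      then have "k \<in> {k \<in> {1..n}. x \<in> A k} \<longleftrightarrow> k \<in> {1..m}" for k
        using \<open>m \<le> n\<close> A_iff[of k] unfolding mem_Collect_eq atLeastAtMost_iff by linarith
      then show ?thesis by blast
    qed
    then have "(\<Sum>k=1..n. indicator (A k) x :: real) = real m"
      by (simp add: indicator_def sum.If_cases Int_def del: atLeastAtMost_iff)
    then have "f x - g x = (real n * f x - real m) / real n"
      using n0 by (simp add: g_def diff_divide_distrib)
    moreover have "\<bar>real n * f x - real m\<bar> \<le> 1" using m by linarith
    ultimately show ?thesis by (simp add: divide_right_mono)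
  qed
  have g_meas[measurable]: "g \<in> borel_measurable M" unfolding g_def by measurable
  have bnd: "\<bar>(\<integral>x. f x \<partial>K) - (\<integral>x. g x \<partial>K)\<bar> \<le> 1 / real n \<and>
      (\<integral>x. g x \<partial>K) = (\<Sum>k=1..n. measure K (A k)) / real n"
    if K: "prob_space K" "sets K = sets M" for K
  proof -
    interpret K: prob_space K by fact
    note [measurable_cong] = K(2)
    have spK: "space K = space M" using K(2) by (metis sets_eq_imp_space_eq)
    have A'[simp]: "A k \<in> sets K" for k using A K(2) by simp
    have if_: "integrable K f"
      using f01 by (intro K.integrable_const_bound[where B=1]) (auto simp: spK intro!: AE_I2)
    have ig: "integrable K g" unfolding g_def
      by (auto simp: less_top[symmetric])
    have "\<bar>\<integral>x. f x - g x \<partial>K\<bar> \<le> (\<integral>x. \<bar>f x - g x\<bar> \<partial>K)"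
      using integral_norm_bound[of K "\<lambda>x. f x - g x"] by simp
    also have "\<dots> \<le> (\<integral>x. 1 / real n \<partial>K)"
      using fg if_ ig by (intro integral_mono) (auto simp: spK)
    also have "\<dots> = 1 / real n" by (simp add: K.prob_space)
    finally show ?thesis
      using if_ ig by (auto simp: g_def less_top[symmetric])
  qed
  have "\<bar>(\<Sum>k=1..n. measure M (A k)) / real n - (\<Sum>k=1..n. measure N (A k)) / real n\<bar>
      = \<bar>\<Sum>k=1..n. measure M (A k) - measure N (A k)\<bar> / real n"
    by (simp add: sum_subtractf diff_divide_distrib[symmetric])
  also have "\<dots> \<le> (\<Sum>k=1..n. c) / real n"
    by (intro divide_right_mono order_trans[OF sum_abs] sum_mono c) auto
  also have "\<dots> = c" using n0 by simp
  finally have "\<bar>(\<integral>x. g x \<partial>M) - (\<integral>x. g x \<partial>N)\<bar> \<le> c"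
    using bnd[OF M] bnd[OF N] sets by simp
  moreover have "2 / real n < e" using n e n0 by (simp add: field_simps)
  ultimately show "\<bar>(\<integral>x. f x \<partial>M) - (\<integral>x. f x \<partial>N)\<bar> \<le> c + e"
    using bnd[OF M] bnd[OF N] sets by (simp add: abs_le_iff)
qed

section \<open>Maximal inequality and merging\<close>

text \<open>First-passage decomposition: when indices are added in the order of \<tau>, the part of
  the newest \<open>Bad x\<close> not yet covered belongs to \<open>F (\<tau> x)\<close>, so
  \<open>le\<close> applies to it, and these disjoint parts add up. Several indices may share a
  time, which lets the events of an algebra enter alongside the times.\<close>

lemma maximal_inequality_finite:
  fixes N L :: "'w measure" and F :: "'t::linorder \<Rightarrow> 'w measure" and \<tau> :: "'i \<Rightarrow> 't"
  assumes N: "finite_measure N" and L: "finite_measure L" and NL: "sets L = sets N"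
    and I: "finite I"
    and sub: "\<And>i. i \<in> I \<Longrightarrow> sets (F (\<tau> i)) \<subseteq> sets N"
    and mono: "\<And>i j. i \<in> I \<Longrightarrow> j \<in> I \<Longrightarrow> \<tau> i \<le> \<tau> j \<Longrightarrow> sets (F (\<tau> i)) \<subseteq> sets (F (\<tau> j))"
    and bad: "\<And>i. i \<in> I \<Longrightarrow> Bad i \<in> sets (F (\<tau> i))"
    and le: "\<And>i B. i \<in> I \<Longrightarrow> B \<in> sets (F (\<tau> i)) \<Longrightarrow> B \<subseteq> Bad i \<Longrightarrow> c * measure N B \<le> measure L B"
  shows "c * measure N (\<Union>i\<in>I. Bad i) \<le> measure L (\<Union>i\<in>I. Bad i)"
proof -
  interpret N: finite_measure N by fact
  interpret L: finite_measure L by fact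
  have "J \<subseteq> I \<longrightarrow> c * measure N (\<Union>i\<in>J. Bad i) \<le> measure L (\<Union>i\<in>J. Bad i)" if "finite J" for J
    using that
  proof (induction rule: finite_ranking_induct[where f=\<tau>])
    case empty
    then show ?case by simp
  next
    case (insert x J)
    show ?case
    proof
      assume sub_I: "insert x J \<subseteq> I"
      let ?U = "\<Union>i\<in>J. Bad i"
      have "Bad j \<in> sets (F (\<tau> x))" if "j \<in> J" for j
        using that sub_I insert.hyps(2)[OF that] bad[of j] mono[of j x] by auto
      then have U: "?U \<in> sets (F (\<tau> x))" using insert.hyps(1) by auto
      have x: "x \<in> I" using sub_I by auto
      have B: "Bad x - ?U \<in> sets (F (\<tau> x))" using U bad[OF x] by auto
      have sets: "?U \<in> sets N" "Bad x - ?U \<in> sets N" using U B sub[OF x] by auto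
      have eq: "(\<Union>i\<in>insert x J. Bad i) = ?U \<union> (Bad x - ?U)" by auto
      have "measure N (\<Union>i\<in>insert x J. Bad i) = measure N ?U + measure N (Bad x - ?U)"
        unfolding eq using sets by (intro N.finite_measure_Union) auto
      moreover have "measure L (\<Union>i\<in>insert x J. Bad i) = measure L ?U + measure L (Bad x - ?U)"
        unfolding eq using sets NL by (intro L.finite_measure_Union) auto
      moreover have "c * measure N ?U \<le> measure L ?U" using insert.IH sub_I by auto
      moreover have "c * measure N (Bad x - ?U) \<le> measure L (Bad x - ?U)"
        using le[OF x B] by auto
      ultimately show "c * measure N (\<Union>i\<in>insert x J. Bad i) \<le> measure L (\<Union>i\<in>insert x J. Bad i)"
        by (simp add: distrib_left)
    qed
  qed
  with I show ?thesis by auto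
qed

text \<open>The total mass of \<open>L\<close> bounds every finite subfamily alike, so the estimate
  survives the limit along an enumeration of \<open>I\<close>.\<close>

lemma maximal_inequality:
  fixes N L :: "'w measure" and F :: "'t::linorder \<Rightarrow> 'w measure" and \<tau> :: "'i \<Rightarrow> 't"
  assumes N: "finite_measure N" and L: "finite_measure L" and NL: "sets L = sets N"
    and I: "countable I"
    and sub: "\<And>i. i \<in> I \<Longrightarrow> sets (F (\<tau> i)) \<subseteq> sets N"
    and mono: "\<And>i j. i \<in> I \<Longrightarrow> j \<in> I \<Longrightarrow> \<tau> i \<le> \<tau> j \<Longrightarrow> sets (F (\<tau> i)) \<subseteq> sets (F (\<tau> j))"
    and bad: "\<And>i. i \<in> I \<Longrightarrow> Bad i \<in> sets (F (\<tau> i))"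
    and le: "\<And>i B. i \<in> I \<Longrightarrow> B \<in> sets (F (\<tau> i)) \<Longrightarrow> B \<subseteq> Bad i \<Longrightarrow> c * measure N B \<le> measure L B"
  shows "c * measure N (\<Union>i\<in>I. Bad i) \<le> measure L (space L)"
proof (cases "I = {}")
  case True
  then show ?thesis by simp
next
  case False
  interpret N: finite_measure N by fact
  interpret L: finite_measure L by fact
  let ?f = "from_nat_into I"
  have f: "?f n \<in> I" for n using from_nat_into[OF False] .
  have sets: "Bad i \<in> sets N" if "i \<in> I" for i using bad[OF that] sub[OF that] by auto
  have le_n: "c * measure N (\<Union>i\<in>?f ` {..n}. Bad i) \<le> measure L (space L)" for n
  proof -
    have sub_I: "i \<in> I" if "i \<in> ?f ` {..n}" for i using that f by auto
    have "c * measure N (\<Union>i\<in>?f ` {..n}. Bad i) \<le> measure L (\<Union>i\<in>?f ` {..n}. Bad i)"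
    proof (rule maximal_inequality_finite[OF N L NL, where F=F and \<tau>=\<tau>])
      fix i assume "i \<in> ?f ` {..n}"
      note i = sub_I[OF this]
      show "sets (F (\<tau> i)) \<subseteq> sets N" by (rule sub[OF i])
      show "Bad i \<in> sets (F (\<tau> i))" by (rule bad[OF i])
      show "c * measure N B \<le> measure L B" if "B \<in> sets (F (\<tau> i))" "B \<subseteq> Bad i" for B
        by (rule le[OF i that])
      show "sets (F (\<tau> i)) \<subseteq> sets (F (\<tau> j))" if "j \<in> ?f ` {..n}" "\<tau> i \<le> \<tau> j" for j
        by (rule mono[OF i sub_I[OF that(1)] that(2)])
    qed simp
    also have "\<dots> \<le> measure L (space L)" by (rule L.bounded_measure)
    finally show ?thesis .
  qed
  have "(\<lambda>n. measure N (\<Union>i\<in>?f ` {..n}. Bad i)) \<longlonglongrightarrow> measure N (\<Union>n. \<Union>i\<in>?f ` {..n}. Bad i)"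
    by (intro N.finite_Lim_measure_incseq) (auto simp: incseq_def f sets intro: order_trans)
  moreover have "(\<Union>n. \<Union>i\<in>?f ` {..n}. Bad i) = (\<Union>i\<in>range ?f. Bad i)" by blast
  then have "(\<Union>n. \<Union>i\<in>?f ` {..n}. Bad i) = (\<Union>i\<in>I. Bad i)"
    unfolding range_from_nat_into[OF False I] .
  ultimately have "(\<lambda>n. c * measure N (\<Union>i\<in>?f ` {..n}. Bad i)) \<longlonglongrightarrow> c * measure N (\<Union>i\<in>I. Bad i)"
    by (intro tendsto_mult_left) simp
  then show ?thesis by (rule LIMSEQ_le_const2) (use le_n in blast)
qed

text \<open>The Blackwell--Dubins merging argument. If \<open>N\<close> is one law, \<open>\<Lambda>\<close> the density of a second law,
  and \<open>r\<close> and \<open>q\<close> are the conditional probabilities of the same event under the two laws, then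
  for every \<open>X\<close> measurable at an earlier time the conditional expectation of \<open>\<bar>\<Lambda> - X\<bar>\<close> bounds
  \<open>\<bar>X * (q - r)\<bar>\<close>. The maximal inequality makes this uniform over late times, and \<open>X\<close> may be chosen
  arbitrarily close to \<open>\<Lambda>\<close>.\<close>

lemma merging_bound:
  fixes N :: "'w measure"
  assumes N: "prob_space N" and sub: "subalgebra N F"
    and \<Lambda>: "integrable N \<Lambda>"
    and X: "X \<in> borel_measurable F" "integrable N X"
    and q: "q \<in> borel_measurable F" "\<And>w. 0 \<le> q w \<and> q w \<le> (1::real)"
    and r: "r \<in> borel_measurable F" "\<And>w. 0 \<le> r w \<and> r w \<le> (1::real)"
    and S: "S \<in> sets N"
    and qS: "\<And>B. B \<in> sets F \<Longrightarrow>
        (\<integral>w. indicator B w * (q w * \<Lambda> w) \<partial>N) = (\<integral>w. indicator (B \<inter> S) w * \<Lambda> w \<partial>N)"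
    and rS: "\<And>B. B \<in> sets F \<Longrightarrow> (\<integral>w. indicator B w * r w \<partial>N) = measure N (B \<inter> S)"
    and B: "B \<in> sets F"
  shows "\<bar>\<integral>w. indicator B w * (X w * (q w - r w)) \<partial>N\<bar> \<le> (\<integral>w. indicator B w * \<bar>\<Lambda> w - X w\<bar> \<partial>N)"
proof -
  interpret prob_space N by fact
  interpret finite_measure_subalgebra N F by unfold_locales fact
  have FN: "sets F \<subseteq> sets N" using sub by (auto simp: subalgebra_def)
  note [measurable] = S measurable_from_subalg[OF sub X(1)] measurable_from_subalg[OF sub q(1)]
    measurable_from_subalg[OF sub r(1)]
  have BN[measurable]: "B \<in> sets N" using B FN by auto
  have [measurable]: "\<Lambda> \<in> borel_measurable N" using \<Lambda> by auto
  have bi: "integrable N (\<lambda>w. u w * v w)"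
    if u: "u \<in> borel_measurable N" "\<And>w. \<bar>u w\<bar> \<le> 1" and v: "integrable N v" for u v :: "'w \<Rightarrow> real"
  proof (rule Bochner_Integration.integrable_bound[OF v])
    show "(\<lambda>w. u w * v w) \<in> borel_measurable N" using u(1) v by auto
    show "AE w in N. norm (u w * v w) \<le> norm (v w)"
      using u(2) by (auto simp: abs_mult intro!: AE_I2 mult_left_le_one_le)
  qed
  have ri: "integrable N r" using r(2) by (intro integrable_const_bound[where B=1]) auto
  \<comment> \<open>By \<open>rS\<close>, \<open>r\<close> is a version of the conditional
    probability of \<open>S\<close> given \<open>F\<close>; hence \<open>rS\<close> extends from
    indicators to the unbounded weight \<open>X\<close>.\<close>
  have ce: "AE w in N. real_cond_exp N F (indicator S) w = r w"
  proof (rule real_cond_exp_charact)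
    show "integrable N (indicat_real S)" by (simp add: less_top[symmetric])
    show "integrable N r" by fact
    show "r \<in> borel_measurable F" by fact
    fix A assume A: "A \<in> sets F"
    have "(\<integral>x\<in>A. indicator S x \<partial>N) = (\<integral>x. indicator (A \<inter> S) x \<partial>N)"
      unfolding set_lebesgue_integral_def
      by (intro Bochner_Integration.integral_cong) (auto split: split_indicator)
    also have "\<dots> = measure N (A \<inter> S)" using A FN S by auto
    also have "\<dots> = (\<integral>x\<in>A. r x \<partial>N)" using rS[OF A] by (simp add: set_lebesgue_integral_def)
    finally show "(\<integral>x\<in>A. indicator S x \<partial>N) = (\<integral>x\<in>A. r x \<partial>N)" .
  qed
  let ?Y = "\<lambda>w. indicator B w * X w"
  have Y: "integrable N ?Y" by (rule bi) (auto simp: X split: split_indicator)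
  have YS: "integrable N (\<lambda>w. ?Y w * indicator S w)"
    using bi[of "indicator S", OF _ _ Y] by (auto simp: mult.commute split: split_indicator)
  have Yr: "integrable N (\<lambda>w. ?Y w * r w)" and Yq: "integrable N (\<lambda>w. ?Y w * q w)"
    using bi[of r, OF _ _ Y] bi[of q, OF _ _ Y] q(2) r(2) by (auto simp: mult.commute)
  have "(\<integral>w. ?Y w * indicator S w \<partial>N) = (\<integral>w. ?Y w * real_cond_exp N F (indicator S) w \<partial>N)"
    by (intro real_cond_exp_intg(2)[symmetric] YS) (use B X in auto)
  also have "\<dots> = (\<integral>w. ?Y w * r w \<partial>N)"
    by (intro integral_cong_AE) (use ce in auto)
  finally have e1: "(\<integral>w. ?Y w * r w \<partial>N) = (\<integral>w. ?Y w * indicator S w \<partial>N)" by simp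
  let ?Z = "\<lambda>w. indicator B w * \<Lambda> w"
  have Z: "integrable N ?Z" by (rule bi) (auto simp: \<Lambda> split: split_indicator)
  have ZS: "integrable N (\<lambda>w. ?Z w * indicator S w)" and Zq: "integrable N (\<lambda>w. ?Z w * q w)"
    using bi[of "indicator S", OF _ _ Z] bi[of q, OF _ _ Z] q(2)
    by (auto simp: mult.commute split: split_indicator)
  have e2: "(\<integral>w. ?Z w * q w \<partial>N) = (\<integral>w. ?Z w * indicator S w \<partial>N)"
    using qS[OF B] by (simp add: indicator_inter_arith mult_ac)
  have "(\<integral>w. indicator B w * (X w * (q w - r w)) \<partial>N) = (\<integral>w. ?Y w * q w - ?Y w * r w \<partial>N)"
    by (simp add: algebra_simps)
  also have "\<dots> = (\<integral>w. ?Y w * q w \<partial>N) - (\<integral>w. ?Y w * indicator S w \<partial>N)"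
    using Yq Yr e1 by simp
  \<comment> \<open>By \<open>e2\<close> the subtracted terms have integral 0. They turn the weight
    \<open>X\<close> into \<open>X - \<Lambda>\<close>, multiplied by
    \<open>q - indicator S\<close>, which has absolute value at most 1.\<close>
  also have "\<dots> = (\<integral>w. (?Y w * q w - ?Y w * indicator S w) - (?Z w * q w - ?Z w * indicator S w) \<partial>N)"
    using Yq YS Zq ZS e2 by simp
  finally have eq: "(\<integral>w. indicator B w * (X w * (q w - r w)) \<partial>N) =
      (\<integral>w. (?Y w * q w - ?Y w * indicator S w) - (?Z w * q w - ?Z w * indicator S w) \<partial>N)" .
  have "\<bar>\<integral>w. indicator B w * (X w * (q w - r w)) \<partial>N\<bar> \<le> (\<integral>w. \<bar>(?Y w * q w - ?Y w * indicator S w) - (?Z w * q w - ?Z w * indicator S w)\<bar> \<partial>N)"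
    unfolding eq by (rule integral_abs_bound)
  also have "\<dots> \<le> (\<integral>w. \<bar>?Z w - ?Y w\<bar> \<partial>N)"
  proof (rule integral_mono)
    show "integrable N (\<lambda>w. \<bar>?Y w * q w - ?Y w * indicator S w - (?Z w * q w - ?Z w * indicator S w)\<bar>)"
      by (intro integrable_abs Bochner_Integration.integrable_diff Yq YS Zq ZS)
    show "integrable N (\<lambda>w. \<bar>?Z w - ?Y w\<bar>)"
      by (intro integrable_abs Bochner_Integration.integrable_diff Y Z)
    fix w
    have eq': "?Y w * q w - ?Y w * indicator S w - (?Z w * q w - ?Z w * indicator S w)
        = (?Y w - ?Z w) * (q w - indicator S w)" by (simp add: algebra_simps)
    have "\<bar>(?Y w - ?Z w) * (q w - indicator S w)\<bar> \<le> \<bar>?Y w - ?Z w\<bar> * 1"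
      unfolding abs_mult using q(2)[of w] by (intro mult_left_mono) (auto split: split_indicator)
    then show "\<bar>?Y w * q w - ?Y w * indicator S w - (?Z w * q w - ?Z w * indicator S w)\<bar> \<le> \<bar>?Z w - ?Y w\<bar>"
      unfolding eq' by (simp add: abs_minus_commute)
  qed
  also have "\<dots> = (\<integral>w. indicator B w * \<bar>\<Lambda> w - X w\<bar> \<partial>N)"
    by (intro Bochner_Integration.integral_cong) (auto split: split_indicator)
  finally show ?thesis .
qed

text \<open>The weight \<open>\<bar>\<Lambda> w\<bar>\<close> remains in the conclusion because the
  argument gives no bound on \<open>q i w - r i w\<close> where the density vanishes. A single null
  set serves all indices and all \<open>e\<close>.\<close>

lemma merging:
  fixes N :: "'w measure" and F :: "real \<Rightarrow> 'w measure" and q r :: "'i \<Rightarrow> 'w \<Rightarrow> real"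
  assumes N: "prob_space N"
    and sub: "\<And>t. 0 \<le> t \<Longrightarrow> subalgebra N (F t)"
    and mono: "\<And>s t. 0 \<le> s \<Longrightarrow> s \<le> t \<Longrightarrow> sets (F s) \<subseteq> sets (F t)"
    and I: "countable I" "\<And>i. i \<in> I \<Longrightarrow> 0 \<le> \<tau> i"
    and \<Lambda>: "integrable N \<Lambda>"
    and dense: "\<And>e. 0 < e \<Longrightarrow> \<exists>s\<ge>0. \<exists>X. X \<in> borel_measurable (F s) \<and> integrable N X \<and>
        (\<integral>w. \<bar>\<Lambda> w - X w\<bar> \<partial>N) < e"
    and q: "\<And>i. i \<in> I \<Longrightarrow> q i \<in> borel_measurable (F (\<tau> i))" "\<And>i w. i \<in> I \<Longrightarrow> 0 \<le> q i w \<and> q i w \<le> 1"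
    and r: "\<And>i. i \<in> I \<Longrightarrow> r i \<in> borel_measurable (F (\<tau> i))" "\<And>i w. i \<in> I \<Longrightarrow> 0 \<le> r i w \<and> r i w \<le> 1"
    and S: "\<And>i. i \<in> I \<Longrightarrow> S i \<in> sets N"
    and qS: "\<And>i B. i \<in> I \<Longrightarrow> B \<in> sets (F (\<tau> i)) \<Longrightarrow>
        (\<integral>w. indicator B w * (q i w * \<Lambda> w) \<partial>N) = (\<integral>w. indicator (B \<inter> S i) w * \<Lambda> w \<partial>N)"
    and rS: "\<And>i B. i \<in> I \<Longrightarrow> B \<in> sets (F (\<tau> i)) \<Longrightarrow>
        (\<integral>w. indicator B w * r i w \<partial>N) = measure N (B \<inter> S i)"
  shows "AE w in N. \<forall>e>0. \<exists>t. \<forall>i\<in>I. t \<le> \<tau> i \<longrightarrow> \<bar>\<Lambda> w\<bar> * \<bar>q i w - r i w\<bar> \<le> e"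
proof -
  interpret prob_space N by fact
  have [measurable]: "\<Lambda> \<in> borel_measurable N" using \<Lambda> by auto
  have qN[measurable]: "q i \<in> borel_measurable N" and rN[measurable]: "r i \<in> borel_measurable N" if "i \<in> I" for i
    using measurable_from_subalg[OF sub[OF I(2)[OF that]]] q(1) r(1) that by blast+
  \<comment> \<open>The event that the level \<open>c\<close> is exceeded at arbitrarily late times;
    integer lower bounds on the time keep it measurable.\<close>
  define E where "E c = {w \<in> space N. \<forall>n::nat. \<exists>i\<in>I. real n \<le> \<tau> i \<and> c < \<bar>\<Lambda> w\<bar> * \<bar>q i w - r i w\<bar>}" for c
  have E_sets: "E c \<in> sets N" for c
  proof -
    have "E c = (\<Inter>n::nat. \<Union>i\<in>{i\<in>I. real n \<le> \<tau> i}. {w \<in> space N. c < \<bar>\<Lambda> w\<bar> * \<bar>q i w - r i w\<bar>})"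
      unfolding E_def by auto
    also have "\<dots> \<in> sets N"
      using I(1) by (intro sets.countable_INT' sets.countable_UN'') (auto, measurable)
    finally show ?thesis .
  qed
  \<comment> \<open>If \<open>\<bar>\<Lambda>\<bar> * \<bar>q i - r i\<bar>\<close> exceeds
    \<open>2 * c\<close>, then \<open>\<bar>X * (q i - r i)\<bar>\<close> or
    \<open>\<bar>\<Lambda> - X\<bar>\<close> exceeds \<open>c\<close>. The maximal inequality bounds
    the first event over all late indices and Markov's inequality the second, each contributing
    \<open>e\<close>.\<close>
  have small: "c * measure N (E (2 * c)) \<le> 2 * e" if c: "c > 0" and e: "e > 0" for c e
  proof -
    obtain s X where s: "0 \<le> s" and X: "X \<in> borel_measurable (F s)" "integrable N X"
      and Xe: "(\<integral>w. \<bar>\<Lambda> w - X w\<bar> \<partial>N) < e" using dense[OF e] by blast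
    have [measurable]: "X \<in> borel_measurable N" using X(2) by auto
    define L where "L = density N (\<lambda>w. ennreal \<bar>\<Lambda> w - X w\<bar>)"
    have sL: "sets L = sets N" "space L = space N" by (auto simp: L_def)
    have int: "integrable N (\<lambda>w. indicator B w * \<bar>\<Lambda> w - X w\<bar>)" if [measurable]: "B \<in> sets N" for B
    proof (rule Bochner_Integration.integrable_bound)
      show "integrable N (\<lambda>w. \<bar>\<Lambda> w - X w\<bar>)"
        by (intro integrable_abs Bochner_Integration.integrable_diff \<Lambda> X(2))
    qed (auto split: split_indicator)
    have emL: "emeasure L B = ennreal (\<integral>w. indicator B w * \<bar>\<Lambda> w - X w\<bar> \<partial>N)" if [measurable]: "B \<in> sets N" for B
    proof -
      have "emeasure L B = (\<integral>\<^sup>+w. ennreal (indicator B w * \<bar>\<Lambda> w - X w\<bar>) \<partial>N)"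
        unfolding L_def by (subst emeasure_density)
          (auto intro!: nn_integral_cong split: split_indicator)
      also have "\<dots> = ennreal (\<integral>w. indicator B w * \<bar>\<Lambda> w - X w\<bar> \<partial>N)"
        by (intro nn_integral_eq_integral int) auto
      finally show ?thesis .
    qed
    have mL: "measure L B = (\<integral>w. indicator B w * \<bar>\<Lambda> w - X w\<bar> \<partial>N)" if "B \<in> sets N" for B
      using emL[OF that] by (simp add: measure_def)
    interpret L: finite_measure L
      by (rule finite_measureI) (use emL[OF sets.top] in \<open>simp add: sL(2)\<close>)
    have Lsp: "measure L (space L) < e"
    proof -
      have "measure L (space L) = (\<integral>w. \<bar>\<Lambda> w - X w\<bar> \<partial>N)"
        unfolding sL(2) mL[OF sets.top] by (intro Bochner_Integration.integral_cong) auto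
      with Xe show ?thesis by simp
    qed
    define J where "J = {i\<in>I. s \<le> \<tau> i}"
    define Bad where "Bad i = {w \<in> space N. c < \<bar>X w * (q i w - r i w)\<bar>}" for i
    have XF: "X \<in> borel_measurable (F (\<tau> i))" if "i \<in> J" for i
    proof -
      have "subalgebra (F (\<tau> i)) (F s)"
        using sub[OF s] sub[OF I(2)[of i]] mono[OF s, of "\<tau> i"] that by (auto simp: J_def subalgebra_def)
      from measurable_from_subalg[OF this X(1)] show ?thesis .
    qed
    \<comment> \<open>A form of Markov's inequality that serves three times: for the two sign parts
      of a bad event and for the event \<open>A\<close> on which \<open>X\<close> is far from
      \<Lambda>.\<close>
    have chargen: "c * measure N B \<le> measure L B"
      if B: "B \<in> sets N" and sgn: "\<bar>\<integral>w. indicator B w * u w \<partial>N\<bar> \<le> measure L B"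
        and u: "integrable N u" "\<And>w. w \<in> B \<Longrightarrow> c \<le> u w" for B u
    proof -
      note [measurable] = B
      have "c * measure N B = (\<integral>w. c * indicator B w \<partial>N)" by simp
      also have "\<dots> \<le> (\<integral>w. indicator B w * u w \<partial>N)"
      proof (rule integral_mono)
        show "integrable N (\<lambda>w. c * indicator B w)" by (simp add: less_top[symmetric])
        show "integrable N (\<lambda>w. indicator B w * u w)"
          by (rule Bochner_Integration.integrable_bound[OF u(1)]) (use u in \<open>auto split: split_indicator\<close>)
      qed (use u(2) in \<open>auto split: split_indicator\<close>)
      finally show ?thesis using sgn by linarith
    qed
    have "c * measure N (\<Union>i\<in>J. Bad i) \<le> measure L (space L)"
    proof (rule maximal_inequality[OF _ _ sL(1), where F=F and \<tau>=\<tau>])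
      show "finite_measure N" "finite_measure L" by unfold_locales
      show "countable J" using I(1) by (auto simp: J_def)
      fix i assume i: "i \<in> J"
      then have iI: "i \<in> I" by (simp add: J_def)
      note subi = sub[OF I(2)[OF iI]]
      show FN: "sets (F (\<tau> i)) \<subseteq> sets N" using subi by (auto simp: subalgebra_def)
      have sp: "space (F (\<tau> i)) = space N" using subi by (auto simp: subalgebra_def)
      note [measurable] = XF[OF i] q(1)[OF iI] r(1)[OF iI]
      have uF: "(\<lambda>w. X w * (q i w - r i w)) \<in> borel_measurable (F (\<tau> i))" by measurable
      show "Bad i \<in> sets (F (\<tau> i))"
        unfolding Bad_def sp[symmetric] by measurable
      show "sets (F (\<tau> i)) \<subseteq> sets (F (\<tau> j))" if "j \<in> J" "\<tau> i \<le> \<tau> j" for j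
        using mono[OF I(2)[OF iI]] that by auto
      fix B assume B: "B \<in> sets (F (\<tau> i))" "B \<subseteq> Bad i"
      let ?u = "\<lambda>w. X w * (q i w - r i w)"
      have iu: "integrable N ?u"
      proof (rule Bochner_Integration.integrable_bound[OF X(2)])
        show "?u \<in> borel_measurable N" using measurable_from_subalg[OF subi uF] .
        have "\<bar>q i w - r i w\<bar> \<le> 1" for w using q(2)[OF iI, of w] r(2)[OF iI, of w] by linarith
        then show "AE w in N. norm (?u w) \<le> norm (X w)"
          by (auto simp: abs_mult intro!: AE_I2 mult_left_le)
      qed
      \<comment> \<open>\<open>merging_bound\<close> controls the absolute value of an integral, not
        the integral of an absolute value. Both sign parts are events of
        \<open>F (\<tau> i)\<close>, so it can be applied to each separately.\<close>
      define B1 where "B1 = B \<inter> {w \<in> space (F (\<tau> i)). 0 \<le> ?u w}"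
      have B1: "B1 \<in> sets (F (\<tau> i))" "B - B1 \<in> sets (F (\<tau> i))"
        using B(1) unfolding B1_def by (auto, measurable)
      have bound: "\<bar>\<integral>w. indicator C w * ?u w \<partial>N\<bar> \<le> measure L C" if C: "C \<in> sets (F (\<tau> i))" for C
      proof -
        have CN: "C \<in> sets N" using C FN by auto
        show ?thesis unfolding mL[OF CN]
          by (rule merging_bound[OF N subi \<Lambda> XF[OF i] X(2) q(1)[OF iI] q(2)[OF iI] r(1)[OF iI] r(2)[OF iI]
            S[OF iI] qS[OF iI] rS[OF iI] C])
      qed
      have "c * measure N B1 \<le> measure L B1"
        by (rule chargen[OF _ bound[OF B1(1)] iu]) (use B1 FN B(2) in \<open>auto simp: B1_def Bad_def\<close>)
      moreover have "c * measure N (B - B1) \<le> measure L (B - B1)"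
      proof (rule chargen[of _ "\<lambda>w. - ?u w"])
        show "B - B1 \<in> sets N" using B1 FN by auto
        show "integrable N (\<lambda>w. - ?u w)" using iu by (rule Bochner_Integration.integrable_minus)
        have "(\<integral>w. indicator (B - B1) w * (- ?u w) \<partial>N) = - (\<integral>w. indicator (B - B1) w * ?u w \<partial>N)"
          by (simp only: mult_minus_right Bochner_Integration.integral_minus)
        then show "\<bar>\<integral>w. indicator (B - B1) w * (- ?u w) \<partial>N\<bar> \<le> measure L (B - B1)"
          using bound[OF B1(2)] by (simp only: abs_minus_cancel)
        fix w assume w: "w \<in> B - B1"
        then have "w \<in> Bad i" using B(2) by auto
        then show "c \<le> - ?u w" using w by (auto simp: B1_def Bad_def sp)
      qed
      moreover have "measure N B = measure N B1 + measure N (B - B1)"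
        "measure L B = measure L B1 + measure L (B - B1)"
      proof -
        have "B = B1 \<union> (B - B1)" by (auto simp: B1_def)
        then show "measure N B = measure N B1 + measure N (B - B1)"
          "measure L B = measure L B1 + measure L (B - B1)"
          using finite_measure_Union[of B1 "B - B1"] L.finite_measure_Union[of B1 "B - B1"] B1 FN sL by auto
      qed
      ultimately show "c * measure N B \<le> measure L B" by (simp add: distrib_left)
    qed
    then have 1: "c * measure N (\<Union>i\<in>J. Bad i) \<le> e" using Lsp by simp
    define A where "A = {w \<in> space N. c < \<bar>\<Lambda> w - X w\<bar>}"
    have A[measurable]: "A \<in> sets N" unfolding A_def by measurable
    have "c * measure N A \<le> measure L A"
    proof (rule chargen[OF A])
      show "\<bar>\<integral>w. indicator A w * \<bar>\<Lambda> w - X w\<bar> \<partial>N\<bar> \<le> measure L A"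
        unfolding mL[OF A, symmetric] by simp
    qed (use \<Lambda> X(2) in \<open>auto simp: A_def\<close>)
    then have 2: "c * measure N A \<le> e" using L.bounded_measure[of A] Lsp by linarith
    have Un: "(\<Union>i\<in>J. Bad i) \<in> sets N"
      unfolding Bad_def using I(1)
      by (intro sets.countable_UN'') (auto simp: J_def)
    have "E (2 * c) \<subseteq> (\<Union>i\<in>J. Bad i) \<union> A"
    proof
      fix w assume w: "w \<in> E (2 * c)"
      obtain n :: nat where n: "s \<le> real n" using real_arch_simple by blast
      obtain i where i: "i \<in> I" "real n \<le> \<tau> i" "2 * c < \<bar>\<Lambda> w\<bar> * \<bar>q i w - r i w\<bar>"
        using w unfolding E_def by blast
      have wN: "w \<in> space N" using w by (simp add: E_def)
      have d: "\<bar>q i w - r i w\<bar> \<le> 1" using q(2)[OF i(1), of w] r(2)[OF i(1), of w] by linarith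
      have "\<bar>\<Lambda> w\<bar> * \<bar>q i w - r i w\<bar> \<le> (\<bar>X w\<bar> + \<bar>\<Lambda> w - X w\<bar>) * \<bar>q i w - r i w\<bar>"
        by (intro mult_right_mono) auto
      also have "\<dots> \<le> \<bar>X w * (q i w - r i w)\<bar> + \<bar>\<Lambda> w - X w\<bar>"
        using mult_left_le[OF d abs_ge_zero[of "\<Lambda> w - X w"]] by (simp add: distrib_right abs_mult)
      finally have "c < \<bar>X w * (q i w - r i w)\<bar> \<or> c < \<bar>\<Lambda> w - X w\<bar>" using i(3) by linarith
      then show "w \<in> (\<Union>i\<in>J. Bad i) \<union> A"
        using i n wN by (auto simp: J_def Bad_def A_def)
    qed
    then have "measure N (E (2 * c)) \<le> measure N ((\<Union>i\<in>J. Bad i) \<union> A)"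
      using Un A by (intro finite_measure_mono) auto
    also have "\<dots> \<le> measure N (\<Union>i\<in>J. Bad i) + measure N A"
      by (intro measure_Un_le Un A)
    finally have "c * measure N (E (2 * c)) \<le> c * measure N (\<Union>i\<in>J. Bad i) + c * measure N A"
      using c by (simp add: distrib_left[symmetric])
    with 1 2 show ?thesis by linarith
  qed
  have null: "AE w in N. w \<notin> E c" if c: "c > 0" for c
  proof -
    have "c / 2 * measure N (E c) \<le> 0"
    proof (rule field_le_epsilon)
      fix e :: real assume "0 < e"
      then show "c / 2 * measure N (E c) \<le> 0 + e"
        using small[of "c / 2" "e / 2"] c by simp
    qed
    then have "measure N (E c) = 0" using c by (simp add: mult_le_0_iff measure_le_0_iff)
    then have "E c \<in> null_sets N" using E_sets by (auto simp: null_sets_def emeasure_eq_measure)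
    then show ?thesis by (rule AE_not_in)
  qed
  have "AE w in N. \<forall>k::nat. w \<notin> E (1 / (real k + 1))"
    unfolding AE_all_countable by (auto intro: null)
  moreover have "AE w in N. w \<in> space N" by (rule AE_space)
  ultimately show ?thesis
  proof eventually_elim
    case (elim w)
    show ?case
    proof (intro allI impI)
      fix e :: real assume "e > 0"
      then obtain k :: nat where k: "1 / (real k + 1) < e"
        using reals_Archimedean[of e] by (auto simp: inverse_eq_divide add.commute)
      have "w \<notin> E (1 / (real k + 1))" using elim by blast
      then obtain n :: nat where "\<And>i. i \<in> I \<Longrightarrow> real n \<le> \<tau> i \<Longrightarrow> \<bar>\<Lambda> w\<bar> * \<bar>q i w - r i w\<bar> \<le> 1 / (real k + 1)"
        unfolding E_def using elim by (auto simp: not_less)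
      with k show "\<exists>t. \<forall>i\<in>I. t \<le> \<tau> i \<longrightarrow> \<bar>\<Lambda> w\<bar> * \<bar>q i w - r i w\<bar> \<le> e"
        by (intro exI[of _ "real n"]) force
    qed
  qed
qed

section \<open>Path space and filtrations\<close>

lemma path_at_tendsto_right: "0 \<le> t \<Longrightarrow> (path_at x \<longlongrightarrow> path_at x t) (at_right t)"
  using path_at[of x] by (auto simp: cadlag_in_def)

lemma path_at_tendsto_left: "0 < t \<Longrightarrow> \<exists>l. (path_at x \<longlongrightarrow> l) (at_left t)"
  using path_at[of x] by (auto simp: cadlag_in_def)

lemma path_eqI: "(\<And>t. 0 \<le> t \<Longrightarrow> path_at x t = path_at y t) \<Longrightarrow> x = y"
proof -
  assume eq: "\<And>t. 0 \<le> t \<Longrightarrow> path_at x t = path_at y t"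
  have "path_at x t = path_at y t" for t
    using path_at[of x] path_at[of y] eq[of t] by (cases "t < 0") auto
  then show ?thesis by (metis path_at_inject ext)
qed

text \<open>Evaluation at a fixed time is not Skorokhod continuous, but a visit to an open set
  during an open time interval survives small changes of time and value. Measurability of
  evaluations is built on such events.\<close>

lemma open_visits:
  fixes U :: "'a::metric_space set"
  assumes U: "open U" and a: "0 \<le> a"
  shows "open {x. \<exists>s\<in>{a<..<b}. path_at x s \<in> U}"
  unfolding open_cadlag_def
proof
  fix x assume "x \<in> {x. \<exists>s\<in>{a<..<b}. path_at x s \<in> U}"
  then obtain s where s: "a < s" "s < b" "path_at x s \<in> U" by auto
  then obtain e where e: "e > 0" "ball (path_at x s) e \<subseteq> U"
    using U by (meson open_contains_ball)
  define d where "d = min e (min (s - a) (b - s))"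
  have d: "d > 0" "d \<le> e" "d \<le> s - a" "d \<le> b - s" using e s by (auto simp: d_def)
  have "skorokhod_nbhd s d x \<subseteq> {x. \<exists>s\<in>{a<..<b}. path_at x s \<in> U}"
  proof
    fix y assume "y \<in> skorokhod_nbhd s d x"
    then obtain \<tau> where \<tau>: "\<forall>u\<ge>0. \<bar>\<tau> u - u\<bar> < d"
      "\<forall>u\<in>{0..s}. dist (path_at y (\<tau> u)) (path_at x u) < d"
      unfolding skorokhod_nbhd_def by blast
    have s0: "0 \<le> s" using a s by linarith
    have "dist (path_at x s) (path_at y (\<tau> s)) < e"
      using \<tau>(2) s0 d by (auto simp: dist_commute intro: less_le_trans)
    then have "path_at y (\<tau> s) \<in> U" using e by auto
    moreover have "\<bar>\<tau> s - s\<bar> < d" using \<tau>(1) s0 by auto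
    then have "\<tau> s \<in> {a<..<b}" using d by auto
    ultimately show "y \<in> {x. \<exists>s\<in>{a<..<b}. path_at x s \<in> U}" by blast
  qed
  then show "\<exists>N. \<exists>e>0. skorokhod_nbhd N e x \<subseteq> {x. \<exists>s\<in>{a<..<b}. path_at x s \<in> U}"
    using d(1) by blast
qed

text \<open>By right continuity, \<open>path_at x t \<in> U\<close> iff immediately after \<open>t\<close> the path stays at distance at
  least \<open>1 / (k + 1)\<close> from the complement of \<open>U\<close>, for some \<open>k\<close>; the latter is a countable union of
  complements of sets as in \<open>open_visits\<close>.\<close>

lemma borel_measurable_path_at:
  assumes t: "0 \<le> t"
  shows "(\<lambda>x. path_at x t) \<in> (borel :: 'a::metric_space cadlag measure) \<rightarrow>\<^sub>M borel"
proof (rule borel_measurableI)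
  fix U :: "'a set" assume U: "open U"
  define F where "F k = {y. \<forall>z. z \<notin> U \<longrightarrow> 1 / (real k + 1) \<le> dist y z}" for k :: nat
  have opF: "open (- F k)" for k
  proof -
    have "- F k = (\<Union>z\<in>- U. ball z (1 / (real k + 1)))"
      by (auto simp: F_def not_le dist_commute)
    then show ?thesis by auto
  qed
  define V where "V k n = {x. \<exists>s\<in>{t<..<t + 1 / (real n + 1)}. path_at x s \<in> - F k}" for k n :: nat
  have V: "open (V k n)" for k n unfolding V_def by (rule open_visits[OF opF t])
  have "(\<lambda>x. path_at x t) -` U = (\<Union>k n. - V k n)"
  proof (intro set_eqI iffI)
    fix x assume "x \<in> (\<lambda>x. path_at x t) -` U"
    then obtain e where e: "e > 0" "ball (path_at x t) e \<subseteq> U"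
      using U by (auto simp: open_contains_ball)
    \<comment> \<open>Just after \<open>t\<close> the path is within \<open>e / 2\<close> of its
      value at \<open>t\<close>, which is at distance at least \<open>e\<close> from the complement
      of \<open>U\<close>; hence it stays farther than \<open>1 / (real k + 1)\<close> from that
      complement.\<close>
    obtain k :: nat where k: "1 / (real k + 1) < e / 2"
      using reals_Archimedean[of "e / 2"] e by (auto simp: inverse_eq_divide add.commute)
    have "\<forall>\<^sub>F s in at_right t. dist (path_at x s) (path_at x t) < e / 2"
      using path_at_tendsto_right[OF t, of x] e by (intro tendstoD) auto
    then obtain b where b: "b > t" "\<And>s. t < s \<Longrightarrow> s < b \<Longrightarrow> dist (path_at x s) (path_at x t) < e / 2"
      unfolding eventually_at_right_field by blast
    obtain n :: nat where n: "1 / (real n + 1) < b - t"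
      using reals_Archimedean[of "b - t"] b by (auto simp: inverse_eq_divide add.commute)
    have "x \<notin> V k n"
    proof
      assume "x \<in> V k n"
      then obtain s z where s: "t < s" "s < t + 1 / (real n + 1)" and z: "z \<notin> U" "dist (path_at x s) z < 1 / (real k + 1)"
        by (auto simp: V_def F_def not_le)
      have "dist (path_at x s) (path_at x t) < e / 2" using b(2)[of s] s n by linarith
      then have "dist (path_at x t) z < e"
        using dist_triangle3[of "path_at x t" z "path_at x s"] z(2) k by linarith
      then show False using e(2) z(1) by auto
    qed
    then show "x \<in> (\<Union>k n. - V k n)" by blast
  next
    fix x assume "x \<in> (\<Union>k n. - V k n)"
    then obtain k n where kn: "x \<notin> V k n" by blast
    have "\<forall>\<^sub>F s in at_right t. path_at x s \<in> F k"
      unfolding eventually_at_right_field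
      using kn by (intro exI[of _ "t + 1 / (real n + 1)"]) (auto simp: V_def)
    moreover have "closed (F k)" using opF by (simp add: closed_def)
    ultimately have "path_at x t \<in> F k"
      using path_at_tendsto_right[OF t, of x] by (intro Lim_in_closed_set[of "F k" _ "at_right t"]) auto
    have "path_at x t \<in> U"
    proof (rule ccontr)
      assume "path_at x t \<notin> U"
      with \<open>path_at x t \<in> F k\<close> have "1 / (real k + 1) \<le> dist (path_at x t) (path_at x t)"
        unfolding F_def by blast
      then show False by simp
    qed
    then show "x \<in> (\<lambda>x. path_at x t) -` U" by simp
  qed
  moreover have "- V k n \<in> sets borel" for k n
    using V[of k n] by auto
  ultimately show "(\<lambda>x. path_at x t) -` U \<inter> space borel \<in> sets borel"
    by auto
qed

lemma borel_measurable_signal [measurable]: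
  "0 \<le> t \<Longrightarrow> (signal t :: ('e::metric_space, 'q::finite) paths \<Rightarrow> 'e) \<in> borel \<rightarrow>\<^sub>M borel"
  unfolding signal_def
  by (rule measurable_compose[OF _ borel_measurable_path_at])
    (auto intro!: borel_measurable_continuous_onI continuous_on_fst continuous_on_id)

lemma borel_measurable_observation [measurable]:
  "0 \<le> t \<Longrightarrow> (observation t :: ('e::metric_space, 'q::finite) paths \<Rightarrow> real ^ 'q) \<in> borel \<rightarrow>\<^sub>M borel"
  unfolding observation_def
  by (rule measurable_compose[OF _ borel_measurable_path_at])
    (auto intro!: borel_measurable_continuous_onI continuous_on_snd continuous_on_id)

text \<open>The value \<open>undefined\<close> at negative times is forced by the type of paths.
  Subtracting \<open>path_at y t\<close> makes the new path start at 0, as the observation does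
  almost surely under every law of the model.\<close>

definition shift_path :: "real \<Rightarrow> (real ^ 'q::finite) cadlag \<Rightarrow> (real ^ 'q) cadlag" where
  "shift_path t y = Abs_cadlag (\<lambda>s. if s < 0 then undefined else path_at y (t + s) - path_at y t)"

lemma path_at_shift_path:
  assumes t: "0 \<le> t" and s: "0 \<le> s"
  shows "path_at (shift_path t y) s = path_at y (t + s) - path_at y t"
proof -
  let ?z = "\<lambda>s. if s < 0 then undefined else path_at y (t + s) - path_at y t"
  have right: "(?z \<longlongrightarrow> ?z s) (at_right s)" if s: "0 \<le> s" for s
  proof (rule Lim_transform_eventually)
    have "filterlim (\<lambda>u. t + u) (at_right (t + s)) (at_right s)"
      unfolding filterlim_def using at_right_to_0[of s] at_right_to_0[of "t + s"]
      by (simp add: filtermap_filtermap add.assoc add.commute add.left_commute)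
    then have "((\<lambda>u. path_at y (t + u)) \<longlongrightarrow> path_at y (t + s)) (at_right s)"
      using path_at_tendsto_right[of "t + s" y] t s by (auto intro: filterlim_compose)
    then show "((\<lambda>u. path_at y (t + u) - path_at y t) \<longlongrightarrow> ?z s) (at_right s)"
      using s by (auto intro: tendsto_diff)
    show "\<forall>\<^sub>F u in at_right s. path_at y (t + u) - path_at y t = ?z u"
      using s by (auto simp: eventually_at_right_field intro: exI[of _ "s + 1"])
  qed
  have left: "\<exists>l. (?z \<longlongrightarrow> l) (at_left s)" if s: "0 < s" for s
  proof -
    obtain l where l: "(path_at y \<longlongrightarrow> l) (at_left (t + s))"
      using path_at_tendsto_left[of "t + s" y] t s by auto
    have "filterlim (\<lambda>u. t + u) (at_left (t + s)) (at_left s)"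
      unfolding filterlim_at by (auto intro!: tendsto_intros simp: eventually_at_left_field intro: exI[of _ "s - 1"])
    then have "((\<lambda>u. path_at y (t + u) - path_at y t) \<longlongrightarrow> l - path_at y t) (at_left s)"
      using l by (auto intro!: tendsto_diff intro: filterlim_compose)
    moreover have "\<forall>\<^sub>F u in at_left s. path_at y (t + u) - path_at y t = ?z u"
      using s by (auto simp: eventually_at_left_field intro: exI[of _ 0])
    ultimately show ?thesis by (blast intro: Lim_transform_eventually)
  qed
  have "?z \<in> {x. cadlag_in euclidean x \<and> (\<forall>t<0. x t = undefined)}"
    using right left unfolding cadlag_in_def limitin_canonical_iff by simp
  then show ?thesis using s unfolding shift_path_def by (subst Abs_cadlag_inverse) auto
qed

text \<open>The signal component plays no role for events of the observation field and is left as it is.\<close>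

definition restart :: "real \<Rightarrow> ('e::topological_space, 'q::finite) paths \<Rightarrow> ('e, 'q) paths" where
  "restart t w = (fst w, shift_path t (snd w))"

lemma observation_restart:
  "0 \<le> t \<Longrightarrow> 0 \<le> s \<Longrightarrow> observation s (restart t w) = observation (t + s) w - observation t w"
  by (simp add: observation_def restart_def path_at_shift_path)

lemma restart_0: "observation 0 w = 0 \<Longrightarrow> restart 0 w = w"
  unfolding restart_def
  by (cases w) (auto intro!: path_eqI simp: path_at_shift_path observation_def)

section \<open>The raw filtrations and measurability of the restart map\<close>

abbreviation raw_obs :: "('e::topological_space, 'q::finite) paths measure" where
  "raw_obs \<equiv> raw_obs_filtration \<infinity>"

lemma space_raw_obs_filtration [simp]: "space (raw_obs_filtration t) = UNIV"
  by (simp add: raw_obs_filtration_def)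

lemma space_raw_filtration [simp]: "space (raw_filtration t) = UNIV"
  by (simp add: raw_filtration_def)

lemma sets_raw_obs_filtration:
  "sets (raw_obs_filtration t) =
     sigma_sets UNIV {observation s -` A | s A. 0 \<le> s \<and> ennreal s \<le> t \<and> A \<in> sets borel}"
  by (simp add: raw_obs_filtration_def)

lemma sets_raw_signal_filtration:
  "sets (raw_signal_filtration t) =
     sigma_sets UNIV {signal s -` A | s A. 0 \<le> s \<and> ennreal s \<le> t \<and> A \<in> sets borel}"
  by (simp add: raw_signal_filtration_def)

lemma sets_raw_filtration:
  "sets (raw_filtration t) =
     sigma_sets UNIV (sets (raw_signal_filtration t) \<union> sets (raw_obs_filtration t))"
  by (simp add: raw_filtration_def)

lemma raw_obs_filtration_mono: "s \<le> t \<Longrightarrow> sets (raw_obs_filtration s) \<subseteq> sets (raw_obs_filtration t)"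
  unfolding sets_raw_obs_filtration by (intro sigma_sets_mono') (blast intro: order_trans)

lemma raw_signal_filtration_mono: "s \<le> t \<Longrightarrow> sets (raw_signal_filtration s) \<subseteq> sets (raw_signal_filtration t)"
  unfolding sets_raw_signal_filtration by (intro sigma_sets_mono') (blast intro: order_trans)

lemma raw_filtration_mono: "s \<le> t \<Longrightarrow> sets (raw_filtration s) \<subseteq> sets (raw_filtration t)"
  unfolding sets_raw_filtration
  using raw_obs_filtration_mono[of s t] raw_signal_filtration_mono[of s t]
  by (intro sigma_sets_mono') blast

lemma raw_obs_le_raw: "sets (raw_obs_filtration t) \<subseteq> sets (raw_filtration t)"
  unfolding sets_raw_filtration by (auto intro: sigma_sets.Basic)

lemma raw_filtration_le_borel:
  "sets (raw_filtration t :: ('e::metric_space, 'q::finite) paths measure) \<subseteq> sets borel"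
proof -
  have vi: "f -` A \<in> sets borel" if "f \<in> borel \<rightarrow>\<^sub>M borel" "A \<in> sets borel"
    for f :: "('e, 'q) paths \<Rightarrow> 'b::topological_space" and A
    using measurable_sets[OF that] by simp
  have "sets (raw_signal_filtration t :: ('e, 'q) paths measure) \<subseteq> sets borel"
    unfolding sets_raw_signal_filtration
    by (rule sets.sigma_sets_subset[where M=borel, unfolded space_borel]) (auto intro!: vi)
  moreover have "sets (raw_obs_filtration t :: ('e, 'q) paths measure) \<subseteq> sets borel"
    unfolding sets_raw_obs_filtration
    by (rule sets.sigma_sets_subset[where M=borel, unfolded space_borel]) (auto intro!: vi)
  ultimately show ?thesis
    unfolding sets_raw_filtration
    using sets.sigma_sets_subset[of "sets (raw_signal_filtration t) \<union> sets (raw_obs_filtration t)"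
        "borel :: ('e, 'q) paths measure"] by simp
qed

lemma observation_raw_obs:
  "0 \<le> s \<Longrightarrow> ennreal s \<le> t \<Longrightarrow> observation s \<in> raw_obs_filtration t \<rightarrow>\<^sub>M borel"
  by (rule measurableI) (auto simp: sets_raw_obs_filtration intro!: sigma_sets.Basic)

lemma signal_raw:
  "0 \<le> s \<Longrightarrow> ennreal s \<le> t \<Longrightarrow> signal s \<in> raw_filtration t \<rightarrow>\<^sub>M borel"
  by (rule measurableI)
    (auto simp: sets_raw_filtration sets_raw_signal_filtration intro!: sigma_sets.Basic)

lemma measurable_restart:
  assumes t: "0 \<le> t"
  shows "restart t \<in> raw_obs \<rightarrow>\<^sub>M
    (raw_obs :: ('e::topological_space, 'q::finite) paths measure)"
proof (rule measurable_sigma_sets[OF sets_raw_obs_filtration])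
  fix B :: "('e, 'q) paths set"
  assume "B \<in> {observation s -` A | s A. 0 \<le> s \<and> ennreal s \<le> \<infinity> \<and> A \<in> sets borel}"
  then obtain s A where s: "0 \<le> s" and A: "A \<in> sets borel" and B: "B = observation s -` A" by blast
  have "(\<lambda>w. observation (t + s) w - observation t w) \<in> raw_obs \<rightarrow>\<^sub>M borel"
    using s t by (intro borel_measurable_diff observation_raw_obs) auto
  from measurable_sets[OF this A]
  show "restart t -` B \<inter> space raw_obs \<in> sets raw_obs"
    unfolding B using s t by (simp add: vimage_def observation_restart)
qed auto

section \<open>Completions and augmentations over the family of laws\<close>

lemma space_full_filtration [simp]: "space (full_filtration P t) = UNIV"
  by (simp add: full_filtration_def augmentation_def)

lemma UNIV_full_filtration: "UNIV \<in> sets (full_filtration P t)"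
  by (metis sets.top space_full_filtration)

lemma space_obs_filtration [simp]: "space (obs_filtration P t) = UNIV"
  by (simp add: obs_filtration_def augmentation_def)

lemma space_obs_field [simp]: "space (obs_field P) = UNIV"
  by (simp add: obs_field_def family_completion_def)

lemma sets_family_completion_subset:
  assumes "\<mu> \<in> prob_measures" "space (P \<mu>) = UNIV"
  shows "sets (family_completion P M) \<subseteq> sets (completion (restr_to_subalg (P \<mu>) M))"
proof -
  have "space (completion (restr_to_subalg (P \<mu>) M)) = UNIV"
    using assms by (simp add: space_restr_to_subalg)
  then show ?thesis
    unfolding family_completion_def
    using assms(1) sets.sigma_sets_subset[of "(\<Inter>\<mu>\<in>prob_measures. sets (completion (restr_to_subalg (P \<mu>) M)))"
        "completion (restr_to_subalg (P \<mu>) M)"]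
    by (auto simp: INT_lower)
qed

lemma sets_augmentation_subset:
  assumes "\<mu> \<in> prob_measures" "t < s \<or> s = \<infinity>"
  shows "sets (augmentation P M F t) \<subseteq>
    sigma_sets UNIV (sets (F s) \<union> null_sets (completion (restr_to_subalg (P \<mu>) M)))"
proof -
  have "(\<Inter>\<mu>\<in>prob_measures. \<Inter>s\<in>{s. t < s \<or> s = \<infinity>}.
        sigma_sets UNIV (sets (F s) \<union> null_sets (completion (restr_to_subalg (P \<mu>) M))))
      \<subseteq> sigma_sets UNIV (sets (F s) \<union> null_sets (completion (restr_to_subalg (P \<mu>) M)))"
    using assms by blast
  from sigma_sets_subseteq[of _ UNIV] sigma_sets_mono[OF this]
  show ?thesis unfolding augmentation_def by simp
qed

lemma sets_augmentationI:
  assumes "\<And>\<mu> s. \<mu> \<in> prob_measures \<Longrightarrow> t < s \<or> s = \<infinity> \<Longrightarrow>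
    A \<in> sigma_sets UNIV (sets (F s) \<union> null_sets (completion (restr_to_subalg (P \<mu>) M)))"
  shows "A \<in> sets (augmentation P M F t)"
  unfolding augmentation_def using assms by (auto intro!: sigma_sets.Basic)

lemma augmentation_mono:
  fixes P :: "'e::topological_space measure \<Rightarrow> 'w measure"
  assumes s: "s \<le> t"
  shows "sets (augmentation P M F s) \<subseteq> sets (augmentation P M F t)"
proof
  fix A assume A: "A \<in> sets (augmentation P M F s)"
  show "A \<in> sets (augmentation P M F t)"
  proof (rule sets_augmentationI)
    fix \<mu> :: "'e measure" and u assume \<mu>: "\<mu> \<in> prob_measures" and u: "t < u \<or> u = \<infinity>"
    have "s < u \<or> u = \<infinity>" using s u by (auto dest: le_less_trans)
    from sets_augmentation_subset[OF \<mu> this] A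
    show "A \<in> sigma_sets UNIV (sets (F u) \<union> null_sets (completion (restr_to_subalg (P \<mu>) M)))"
      by blast
  qed
qed

lemma null_sets_completion_restr:
  assumes sub: "subalgebra K M"
  shows "null_sets (completion (restr_to_subalg K M)) \<subseteq> null_sets (completion K)"
  using null_sets_restr_to_subalg[OF sub] by (auto simp: null_sets_completion_iff2 Bex_def)

lemma sets_completion_restr:
  assumes sub: "subalgebra K M"
  shows "sets (completion (restr_to_subalg K M)) \<subseteq> sets (completion K)"
proof
  fix A assume "A \<in> sets (completion (restr_to_subalg K M))"
  then obtain S N N' where "A = S \<union> N" "N \<subseteq> N'" "N' \<in> null_sets (restr_to_subalg K M)" "S \<in> sets (restr_to_subalg K M)"
    by (rule sets_completionE)
  then show "A \<in> sets (completion K)"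
    using null_sets_restr_to_subalg[OF sub] sets_restr_to_subalg[OF sub] sub
    by (intro sets_completionI[of A S N N']) (auto simp: subalgebra_def)
qed

lemma restr_to_subalg_same: "restr_to_subalg K K = K"
  unfolding restr_to_subalg_def by (rule measure_of_of_measure)

locale path_laws =
  fixes P :: "'e::metric_space measure \<Rightarrow> ('e, 'q::finite) paths measure"
  assumes law: "\<mu> \<in> prob_measures \<Longrightarrow> P \<mu> \<in> prob_measures"
begin

lemma sets_P [simp]: "\<mu> \<in> prob_measures \<Longrightarrow> sets (P \<mu>) = sets borel"
  using law[of \<mu>] by (auto simp: space_prob_algebra)

lemma space_P [simp]: "\<mu> \<in> prob_measures \<Longrightarrow> space (P \<mu>) = UNIV"
  using sets_P[of \<mu>] by (metis sets_eq_imp_space_eq space_borel)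

lemma prob_space_P: "\<mu> \<in> prob_measures \<Longrightarrow> prob_space (P \<mu>)"
  using law[of \<mu>] by (auto simp: space_prob_algebra)

lemma subalgebra_raw_obs: "\<mu> \<in> prob_measures \<Longrightarrow> subalgebra (P \<mu>) (raw_obs_filtration t)"
  using raw_obs_le_raw[of t] raw_filtration_le_borel[of t] by (auto simp: subalgebra_def)

lemma sets_restr_raw_obs:
  "\<mu> \<in> prob_measures \<Longrightarrow> sets (restr_to_subalg (P \<mu>) (raw_obs_filtration t)) = sets (raw_obs_filtration t)"
  by (rule sets_restr_to_subalg[OF subalgebra_raw_obs])

lemma space_restr_raw_obs:
  "\<mu> \<in> prob_measures \<Longrightarrow> space (restr_to_subalg (P \<mu>) (raw_obs_filtration t)) = UNIV"
  by (simp add: space_restr_to_subalg)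

lemma obs_field_subset_completion:
  "\<mu> \<in> prob_measures \<Longrightarrow>
    sets (obs_field P) \<subseteq> sets (completion (restr_to_subalg (P \<mu>) raw_obs))"
  unfolding obs_field_def by (rule sets_family_completion_subset) auto

lemma subalgebra_obs_field: "\<mu> \<in> prob_measures \<Longrightarrow> subalgebra (completion (P \<mu>)) (obs_field P)"
  using obs_field_subset_completion[of \<mu>] sets_completion_restr[OF subalgebra_raw_obs, of \<mu> \<infinity>]
  by (auto simp: subalgebra_def)

lemma raw_obs_le_obs_field: "sets (raw_obs_filtration t) \<subseteq> sets (obs_field P)"
proof -
  have "A \<in> sets (obs_field P)" if "A \<in> sets raw_obs" for A
    unfolding obs_field_def family_completion_def using that
    by (auto intro!: sigma_sets.Basic sets_completionI_sets simp: sets_restr_raw_obs)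
  then show ?thesis using raw_obs_filtration_mono[of t \<infinity>] by auto
qed

lemma raw_obs_le_obs_filtration:
  "sets (raw_obs_filtration t) \<subseteq> sets (obs_filtration P t)"
proof
  fix A :: "('e, 'q) paths set" assume "A \<in> sets (raw_obs_filtration t)"
  then have "A \<in> sets (raw_obs_filtration u)" if "t < u \<or> u = \<infinity>" for u
    using raw_obs_filtration_mono[of t u] that by (auto simp: less_imp_le)
  then show "A \<in> sets (obs_filtration P t)"
    unfolding obs_filtration_def by (intro sets_augmentationI sigma_sets.Basic UnI1)
qed

lemma raw_le_full_filtration:
  "sets (raw_filtration t) \<subseteq> sets (full_filtration P t)"
proof
  fix A :: "('e, 'q) paths set" assume "A \<in> sets (raw_filtration t)"
  then have "A \<in> sets (raw_filtration u)" if "t < u \<or> u = \<infinity>" for u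
    using raw_filtration_mono[of t u] that by (auto simp: less_imp_le)
  then show "A \<in> sets (full_filtration P t)"
    unfolding full_filtration_def by (intro sets_augmentationI sigma_sets.Basic UnI1)
qed

text \<open>The index \<infinity> takes part in the intersection defining
  \<open>augmentation\<close> for every \<open>t\<close>. Its generators, raw observation events and
  null sets, lie in the completion under each single law.\<close>

lemma obs_filtration_le_obs_field: "sets (obs_filtration P t) \<subseteq> sets (obs_field P)"
proof
  fix A assume A: "A \<in> sets (obs_filtration P t)"
  have "A \<in> sets (completion (restr_to_subalg (P \<mu>) raw_obs))"
    if \<mu>: "\<mu> \<in> prob_measures" for \<mu>
  proof -
    let ?R = "restr_to_subalg (P \<mu>) raw_obs"
    have "sigma_sets UNIV (sets raw_obs \<union> null_sets (completion ?R)) \<subseteq> sets (completion ?R)"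
      by (rule sets.sigma_sets_subset[of _ "completion ?R", unfolded space_completion space_restr_raw_obs[OF \<mu>]])
        (rule Un_least, auto simp: sets_restr_raw_obs[OF \<mu>] intro: sets_completionI_sets)
    then show ?thesis
      using A sets_augmentation_subset[OF \<mu>, of t \<infinity> P "raw_obs" raw_obs_filtration]
      unfolding obs_filtration_def by auto
  qed
  then show "A \<in> sets (obs_field P)"
    unfolding obs_field_def family_completion_def by (auto intro!: sigma_sets.Basic)
qed

lemma obs_filtration_mono: "s \<le> t \<Longrightarrow> sets (obs_filtration P s) \<subseteq> sets (obs_filtration P t)"
  unfolding obs_filtration_def by (rule augmentation_mono)

lemma full_filtration_mono: "s \<le> t \<Longrightarrow> sets (full_filtration P s) \<subseteq> sets (full_filtration P t)"
  unfolding full_filtration_def by (rule augmentation_mono)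

lemma obs_filtration_le_full_filtration: "sets (obs_filtration P t) \<subseteq> sets (full_filtration P t)"
proof
  fix A assume A: "A \<in> sets (obs_filtration P t)"
  show "A \<in> sets (full_filtration P t)"
    unfolding full_filtration_def
  proof (rule sets_augmentationI)
    fix \<mu> :: "'e measure" and u assume u: "\<mu> \<in> prob_measures" "t < u \<or> u = \<infinity>"
    have "restr_to_subalg (P \<mu>) borel = P \<mu>"
      using restr_to_subalg_same[of "P \<mu>"] u by (simp add: restr_to_subalg_def)
    then have "null_sets (completion (restr_to_subalg (P \<mu>) raw_obs))
        \<subseteq> null_sets (completion (restr_to_subalg (P \<mu>) borel))"
      using null_sets_completion_restr[OF subalgebra_raw_obs[OF u(1)], of \<infinity>] by simp
    then have "sigma_sets UNIV (sets (raw_obs_filtration u) \<union>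
          null_sets (completion (restr_to_subalg (P \<mu>) raw_obs)))
        \<subseteq> sigma_sets UNIV (sets (raw_filtration u) \<union> null_sets (completion (restr_to_subalg (P \<mu>) borel)))"
      using raw_obs_le_raw[of u] by (intro sigma_sets_mono') blast
    then show "A \<in> sigma_sets UNIV (sets (raw_filtration u) \<union>
        null_sets (completion (restr_to_subalg (P \<mu>) borel)))"
      using A sets_augmentation_subset[OF u, of P "raw_obs" raw_obs_filtration]
      unfolding obs_filtration_def by auto
  qed
qed

lemma subalgebra_full_filtration:
  assumes \<mu>: "\<mu> \<in> prob_measures"
  shows "subalgebra (completion (P \<mu>)) (full_filtration P t)"
proof -
  have eq: "restr_to_subalg (P \<mu>) borel = P \<mu>"
    using restr_to_subalg_same[of "P \<mu>"] \<mu> by (simp add: restr_to_subalg_def)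
  have "sigma_sets UNIV (sets (raw_filtration \<infinity>) \<union> null_sets (completion (P \<mu>))) \<subseteq> sets (completion (P \<mu>))"
    by (rule sets.sigma_sets_subset[of _ "completion (P \<mu>)", unfolded space_completion space_P[OF \<mu>]])
      (rule Un_least, use \<mu> raw_filtration_le_borel[of \<infinity>] in \<open>auto intro: sets_completionI_sets\<close>)
  then have "sets (full_filtration P t) \<subseteq> sets (completion (P \<mu>))"
    using sets_augmentation_subset[OF \<mu>, of t \<infinity> P borel raw_filtration]
    unfolding full_filtration_def by (auto simp: eq)
  then show ?thesis using \<mu> by (auto simp: subalgebra_def)
qed

lemma sets_obs_law: "\<mu> \<in> prob_measures \<Longrightarrow> sets (obs_law P \<mu>) = sets (obs_field P)"
  unfolding obs_law_def by (rule sets_restr_to_subalg[OF subalgebra_obs_field])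

lemma space_obs_law: "\<mu> \<in> prob_measures \<Longrightarrow> space (obs_law P \<mu>) = UNIV"
  by (simp add: obs_law_def space_restr_to_subalg)

lemma prob_space_completion: "\<mu> \<in> prob_measures \<Longrightarrow> prob_space (completion (P \<mu>))"
  using prob_space.emeasure_space_1[OF prob_space_P, of \<mu>] by (intro prob_spaceI) simp

lemma prob_space_obs_law: "\<mu> \<in> prob_measures \<Longrightarrow> prob_space (obs_law P \<mu>)"
  unfolding obs_law_def
  by (intro prob_space_restr_to_subalg subalgebra_obs_field prob_space_completion)

lemma measure_obs_law:
  "\<mu> \<in> prob_measures \<Longrightarrow> A \<in> sets (obs_field P) \<Longrightarrow> measure (obs_law P \<mu>) A = measure (completion (P \<mu>)) A"
  unfolding obs_law_def measure_def by (simp add: emeasure_restr_to_subalg[OF subalgebra_obs_field])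

lemma integral_obs_law:
  fixes f :: "_ \<Rightarrow> real"
  shows "\<mu> \<in> prob_measures \<Longrightarrow> f \<in> borel_measurable (obs_field P) \<Longrightarrow>
    (\<integral>w. f w \<partial>obs_law P \<mu>) = (\<integral>w. f w \<partial>completion (P \<mu>))"
  unfolding obs_law_def by (rule integral_subalgebra2[OF subalgebra_obs_field])

lemma subalgebra_obs_filtration:
  "\<mu> \<in> prob_measures \<Longrightarrow> subalgebra (obs_law P \<mu>) (obs_filtration P t)"
  using obs_filtration_le_obs_field[of t] by (auto simp: subalgebra_def sets_obs_law space_obs_law)

text \<open>The completion over the family lies in the completion under the one law
  \<open>P \<mu>\<close>. Both the raw version \<open>g\<close> and the exceptional set depend on
  this law, so two laws cannot be treated by two separate applications.\<close>

lemma obs_field_ex_raw_obs: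
  fixes f :: "('e, 'q) paths \<Rightarrow> real"
  assumes \<mu>: "\<mu> \<in> prob_measures" and f: "f \<in> borel_measurable (obs_field P)"
  shows "\<exists>g\<in>borel_measurable raw_obs. \<exists>N\<in>sets raw_obs.
    measure (P \<mu>) N = 0 \<and> (\<forall>w. w \<notin> N \<longrightarrow> f w = g w)"
proof -
  let ?R = "restr_to_subalg (P \<mu>) raw_obs"
  have "subalgebra (completion ?R) (obs_field P)"
    using obs_field_subset_completion[OF \<mu>] \<mu> by (auto simp: subalgebra_def space_restr_raw_obs)
  from measurable_from_subalg[OF this f] have "f \<in> borel_measurable (completion ?R)" .
  from completion_ex_borel_measurable_real[OF this]
  obtain g where g: "g \<in> borel_measurable ?R" "AE x in ?R. f x = g x" by blast
  from AE_E3[OF g(2)] obtain N where N: "N \<in> null_sets ?R" "\<And>x. x \<in> space ?R - N \<Longrightarrow> f x = g x" by blast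
  have "g \<in> borel_measurable raw_obs"
    using g(1) measurable_cong_sets[OF sets_restr_raw_obs[OF \<mu>] refl] by blast
  moreover have "N \<in> sets raw_obs" "measure (P \<mu>) N = 0"
    using N(1) null_sets_restr_to_subalg[OF subalgebra_raw_obs[OF \<mu>]] by (auto simp: measure_def)
  ultimately show ?thesis using N(2) \<mu> by (auto simp: space_restr_raw_obs)
qed

end

section \<open>The restarted observation process\<close>

context markov_semigroup
begin

lemma semigroup_const: "0 \<le> t \<Longrightarrow> T t (\<lambda>_. c) = (\<lambda>_. c)"
  using linear[OF _ bounded_measurable_const bounded_measurable_const, of t c 1 0 1] unit by simp

lemma semigroup_cmult: "0 \<le> t \<Longrightarrow> f \<in> bounded_measurable \<Longrightarrow> T t (\<lambda>z. c * f z) = (\<lambda>z. c * T t f z)"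
  using linear[of t f f c 0] by simp

text \<open>Positivity is applied to \<open>C + f\<close> and to \<open>C - f\<close>; the sign is
  the variable \<open>b\<close>.\<close>

lemma semigroup_bound:
  assumes t: "0 \<le> t" and f: "f \<in> bounded_measurable" and C: "\<And>z. \<bar>f z\<bar> \<le> C"
  shows "\<bar>T t f z\<bar> \<le> C"
proof -
  have c: "(\<lambda>_. C) \<in> bounded_measurable" by (rule bounded_measurable_const)
  have bm: "(\<lambda>z. 1 * C + b * f z) \<in> bounded_measurable" for b by (rule bounded_measurable_lin[OF c f])
  have nn: "0 \<le> C + b * f z" if "b = 1 \<or> b = -1" for b z
    using C[of z] that by auto
  have pos: "0 \<le> T t (\<lambda>z. 1 * C + b * f z) z" if "b = 1 \<or> b = -1" for b
    using positive[OF t bm[of b], of z] nn[OF that] by simp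
  have "0 \<le> C + b * T t f z" if "b = 1 \<or> b = -1" for b
    using pos[OF that] linear[OF t c f, of 1 b] by (simp add: semigroup_const[OF t])
  from this[of 1] this[of "-1"] show ?thesis by auto
qed

lemma daniell_semigroup: "0 \<le> t \<Longrightarrow> daniell borel (\<lambda>f. T t f z)"
  unfolding daniell_def bounded_measurable_on_borel
  by (intro conjI ballI allI impI) (simp_all add: linear semigroup_bound monotone_continuous)

end

lemma sets_borel_prod_generator:
  "sets (borel :: ('a::second_countable_topology \<times> 'b::second_countable_topology) measure) =
    sigma_sets UNIV {a \<times> b | a b. a \<in> sets borel \<and> b \<in> sets borel}"
  unfolding borel_prod[symmetric] sets_pair_measure by simp

lemma sets_mono_measurable:
  "f \<in> M \<rightarrow>\<^sub>M K \<Longrightarrow> space N = space M \<Longrightarrow> sets M \<subseteq> sets N \<Longrightarrow> f \<in> N \<rightarrow>\<^sub>M K"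
  by (rule measurable_from_subalg) (auto simp: subalgebra_def)

text \<open>Freezing one coordinate turns a functional on the other factor into one on the product,
  so a Markov property with a parameter can be checked on rectangles.\<close>

lemma daniell_section:
  fixes y :: "'a::second_countable_topology"
  assumes L: "daniell borel L"
  shows "daniell borel (\<lambda>f. L (\<lambda>w :: 'b::second_countable_topology. f (y, w)))"
proof -
  have "(\<lambda>w :: 'b. (y, id w)) \<in> borel \<rightarrow>\<^sub>M borel" by (rule borel_measurable_Pair) auto
  then have sec: "(\<lambda>w. f (y, w)) \<in> bounded_measurable_on borel"
    if "f \<in> bounded_measurable_on borel" for f :: "'a \<times> 'b \<Rightarrow> real"
    using bounded_measurable_compose[of f "\<lambda>w. (y, id w)"] that by (simp add: bounded_measurable_on_borel)
  show ?thesis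
    unfolding daniell_def
    by (intro conjI ballI allI impI)
      (auto intro!: daniell_lin[OF L] daniell_bound[OF L] daniell_mono[OF L] sec)
qed

context hidden_markov_model
begin

sublocale path_laws P
  by unfold_locales (rule law)

lemma signal_full: "0 \<le> s \<Longrightarrow> s \<le> t \<Longrightarrow> signal s \<in> full_filtration P (ennreal t) \<rightarrow>\<^sub>M borel"
  by (rule sets_mono_measurable[OF signal_raw _ raw_le_full_filtration]) (auto intro: ennreal_leI)

lemma observation_full: "0 \<le> s \<Longrightarrow> s \<le> t \<Longrightarrow> observation s \<in> full_filtration P (ennreal t) \<rightarrow>\<^sub>M borel"
  by (rule sets_mono_measurable[OF observation_raw_obs[of s "ennreal t"] _
        order_trans[OF raw_obs_le_raw raw_le_full_filtration]]) (auto intro: ennreal_leI)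

lemma full_measurable_mono:
  "f \<in> full_filtration P (ennreal s) \<rightarrow>\<^sub>M K \<Longrightarrow> s \<le> t \<Longrightarrow> f \<in> full_filtration P (ennreal t) \<rightarrow>\<^sub>M K"
  by (rule sets_mono_measurable[OF _ _ full_filtration_mono]) (auto intro: ennreal_leI)

lemma full_measurable_completion:
  "\<mu> \<in> prob_measures \<Longrightarrow> f \<in> full_filtration P t \<rightarrow>\<^sub>M K \<Longrightarrow> f \<in> completion (P \<mu>) \<rightarrow>\<^sub>M K"
  by (rule measurable_from_subalg[OF subalgebra_full_filtration])

lemma pair_measurable:
  assumes \<mu>: "\<mu> \<in> prob_measures" and u: "0 \<le> u"
  shows "(\<lambda>w. (signal u w, observation u w)) \<in> completion (P \<mu>) \<rightarrow>\<^sub>M borel"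
  by (intro borel_measurable_Pair full_measurable_completion[OF \<mu> signal_full[OF u order_refl]]
      full_measurable_completion[OF \<mu> observation_full[OF u order_refl]])

section \<open>The Markov property for increments of the observation\<close>

lemma markov_integral:
  assumes \<mu>: "\<mu> \<in> prob_measures" and f: "f \<in> bounded_measurable" and st: "0 \<le> s" "s \<le> t"
    and B: "B \<in> sets (full_filtration P (ennreal s))"
  shows "(\<integral>w. indicator B w * f (signal t w, observation t w) \<partial>completion (P \<mu>)) =
    (\<integral>w. indicator B w * T (t - s) f (signal s w, observation s w) \<partial>completion (P \<mu>))"
proof -
  let ?M = "completion (P \<mu>)" and ?F = "full_filtration P (ennreal s)"
  interpret prob_space ?M by (rule prob_space_completion[OF \<mu>])
  interpret finite_measure_subalgebra ?M ?F
    by unfold_locales (rule subalgebra_full_filtration[OF \<mu>])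
  note meas = pair_measurable[OF \<mu>]
  obtain C where C: "\<And>z. \<bar>f z\<bar> \<le> C" using bounded_measurableD(2)[OF f] by blast
  have int: "integrable ?M (\<lambda>w. f (signal t w, observation t w))"
    using measurable_compose[OF meas[of t] bounded_measurableD(1)[OF f]] st
    by (intro integrable_const_bound[where B=C]) (auto simp: C)
  have BM[measurable]: "B \<in> sets ?M" using B subalg by (auto simp: subalgebra_def)
  have [measurable]: "(\<lambda>w. T (t - s) f (signal s w, observation s w)) \<in> borel_measurable ?M"
    using measurable_compose[OF meas[OF st(1)] bounded_measurableD(1)[OF bounded_measurable[OF _ f]]] st by simp
  have "(\<integral>w\<in>B. f (signal t w, observation t w) \<partial>?M) =
      (\<integral>w\<in>B. real_cond_exp ?M ?F (\<lambda>w. f (signal t w, observation t w)) w \<partial>?M)"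
    by (rule real_cond_exp_intA[OF int B])
  also have "\<dots> = (\<integral>w\<in>B. T (t - s) f (signal s w, observation s w) \<partial>?M)"
    unfolding set_lebesgue_integral_def
    by (intro integral_cong_AE) (use markov[OF \<mu> f st] in auto)
  finally show ?thesis by (simp add: set_lebesgue_integral_def)
qed

text \<open>The Markov property with an additional parameter for which a random variable \<open>V\<close> known at time
  \<open>t\<close> is substituted. With \<open>V\<close> the observation at time \<open>t\<close> and Markov additivity, it yields the Markov
  property for increments of the observation.\<close>

lemma markov_parameter:
  assumes \<mu>: "\<mu> \<in> prob_measures" and H: "H \<in> bounded_measurable" and t: "0 \<le> t" and d: "0 \<le> d"
    and B: "B \<in> sets (full_filtration P (ennreal t))"
    and V: "V \<in> full_filtration P (ennreal t) \<rightarrow>\<^sub>M (borel :: (real ^ 'q) measure)"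
  shows "(\<integral>\<omega>. indicator B \<omega> * H (V \<omega>, signal (t + d) \<omega>, observation (t + d) \<omega>) \<partial>completion (P \<mu>)) =
    (\<integral>\<omega>. indicator B \<omega> * T d (\<lambda>w. H (V \<omega>, w)) (signal t \<omega>, observation t \<omega>) \<partial>completion (P \<mu>))"
proof -
  let ?M = "completion (P \<mu>)"
  let ?G = "{a \<times> b | a b. a \<in> sets (borel :: (real ^ 'q) measure) \<and> b \<in> sets (borel :: ('e \<times> (real ^ 'q)) measure)}"
  have td: "0 \<le> t + d" using t d by simp
  have ind: "indicator (a \<times> b) (v, w) = indicator a v * (indicator b w :: real)"
    for a b and v :: "real ^ 'q" and w :: "'e \<times> (real ^ 'q)" by (auto split: split_indicator)
  have T_ind: "T d (\<lambda>w. indicator (a \<times> b) (v, w)) z = indicator a v * T d (indicator b) z"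
    if "b \<in> sets borel" for a b z and v :: "real ^ 'q"
    unfolding ind by (simp add: semigroup_cmult[OF d bounded_measurable_indicator[OF that]])
  have BM: "B \<in> sets ?M"
    using B subalgebra_full_filtration[OF \<mu>, of "ennreal t"] by (auto simp: subalgebra_def)
  show ?thesis
  proof (rule integral_daniell_eq[where K=borel and G="?G" and f=H
        and L="\<lambda>\<omega> f. f (V \<omega>, signal (t + d) \<omega>, observation (t + d) \<omega>)"
        and L'="\<lambda>\<omega> f. T d (\<lambda>w. f (V \<omega>, w)) (signal t \<omega>, observation t \<omega>)"])
    show "prob_space ?M" by (rule prob_space_completion[OF \<mu>])
    show "sets borel = sigma_sets UNIV ?G" by (rule sets_borel_prod_generator)
    show "Int_stable ?G" by (auto simp: Int_stable_def) (metis sets.Int Times_Int_Times)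
    show "UNIV \<in> ?G" by (intro CollectI exI[of _ UNIV]) auto
    show "daniell borel (\<lambda>f. f (V \<omega>, signal (t + d) \<omega>, observation (t + d) \<omega>))" for \<omega>
      by (rule daniell_eval)
    show "daniell borel (\<lambda>f. T d (\<lambda>w. f (V \<omega>, w)) (signal t \<omega>, observation t \<omega>))" for \<omega>
      by (rule daniell_section[OF daniell_semigroup[OF d]])
    show "B \<in> sets ?M" by (rule BM)
    show "H \<in> bounded_measurable_on borel" using H by (simp add: bounded_measurable_on_borel)
  next
    fix A assume "A \<in> ?G"
    then obtain a b where A: "A = a \<times> b" and a: "a \<in> sets borel" and b: "b \<in> sets borel" by blast
    have ib: "indicator b \<in> bounded_measurable" using b by (rule bounded_measurable_indicator)
    \<comment> \<open>On a rectangle the parameter contributes only the factor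
      \<open>indicator a (V \<omega>)\<close>. As \<open>V\<close> is known at time
      \<open>t\<close>, this factor is absorbed into the conditioning event.\<close>
    have Va: "V -` a \<in> sets (full_filtration P (ennreal t))" using measurable_sets[OF V a] by simp
    then have B': "B \<inter> V -` a \<in> sets (full_filtration P (ennreal t))" using B by auto
    have [measurable]: "(\<lambda>\<omega>. indicator a (V \<omega>) :: real) \<in> borel_measurable ?M"
      using measurable_compose[OF full_measurable_completion[OF \<mu> V] borel_measurable_indicator[OF a]] .
    have [measurable]: "(\<lambda>\<omega>. f (signal u \<omega>, observation u \<omega>)) \<in> borel_measurable ?M"
      if "f \<in> bounded_measurable" "0 \<le> u" for f u
      using measurable_compose[OF pair_measurable[OF \<mu> that(2)] bounded_measurableD(1)[OF that(1)]] .
    show "(\<lambda>\<omega>. indicator A (V \<omega>, signal (t + d) \<omega>, observation (t + d) \<omega>) :: real) \<in> borel_measurable ?M"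
      unfolding A ind using ib td by measurable
    show "(\<lambda>\<omega>. T d (\<lambda>w. indicator A (V \<omega>, w)) (signal t \<omega>, observation t \<omega>)) \<in> borel_measurable ?M"
      unfolding A T_ind[OF b] using bounded_measurable[OF d ib] t by measurable
    have eq: "indicator B \<omega> * (indicator a (V \<omega>) * x) = indicator (B \<inter> V -` a) \<omega> * (x::real)" for \<omega> x
      by (auto split: split_indicator)
    show "(\<integral>\<omega>. indicator B \<omega> * indicator A (V \<omega>, signal (t + d) \<omega>, observation (t + d) \<omega>) \<partial>?M) =
      (\<integral>\<omega>. indicator B \<omega> * T d (\<lambda>w. indicator A (V \<omega>, w)) (signal t \<omega>, observation t \<omega>) \<partial>?M)"
      unfolding A T_ind[OF b] unfolding ind eq using markov_integral[OF \<mu> ib t _ B', of "t + d"] d by simp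
  qed
qed

text \<open>Additivity is applied to \<open>g\<close> shifted by \<open>y - z\<close>, at the two
  levels \<open>z\<close> and \<open>z - y\<close>: the composed shifts are then by \<open>y\<close>
  and by 0.\<close>

lemma semigroup_obs_shift:
  assumes d: "0 \<le> d" and g: "g \<in> bounded_measurable"
  shows "T d (obs_shift y g) (x, z) = T d g (x, z - y)"
proof -
  have comp: "obs_shift a (obs_shift b g) = obs_shift (a + b) g" for a b
    by (auto simp: obs_shift_def fun_eq_iff algebra_simps)
  have "obs_shift (y - z) g \<in> bounded_measurable"
  proof -
    have "obs_shift (y - z) g = (\<lambda>p. g (fst p, snd p - (y - z)))"
      by (auto simp: obs_shift_def fun_eq_iff)
    moreover have "(\<lambda>p :: 'e \<times> (real ^ 'q). (fst p, snd p - (y - z))) \<in> borel \<rightarrow>\<^sub>M borel"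
      by (intro borel_measurable_continuous_onI continuous_intros)
    ultimately show ?thesis using bounded_measurable_compose[OF g] by simp
  qed
  from additive[OF this d, of z x "z - y"] show ?thesis
    unfolding comp by (simp add: obs_shift_def)
qed

lemma markov_shifted:
  assumes \<mu>: "\<mu> \<in> prob_measures" and g: "g \<in> bounded_measurable" and t: "0 \<le> t" and d: "0 \<le> d"
    and B: "B \<in> sets (full_filtration P (ennreal t))"
    and V: "V \<in> full_filtration P (ennreal t) \<rightarrow>\<^sub>M borel"
  shows "(\<integral>\<omega>. indicator B \<omega> * g (signal (t + d) \<omega>, observation (t + d) \<omega> - V \<omega>) \<partial>completion (P \<mu>)) =
    (\<integral>\<omega>. indicator B \<omega> * T d g (signal t \<omega>, observation t \<omega> - V \<omega>) \<partial>completion (P \<mu>))"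
proof -
  let ?H = "\<lambda>p :: (real ^ 'q) \<times> ('e \<times> (real ^ 'q)). g (fst (snd p), snd (snd p) - fst p)"
  have H: "?H \<in> bounded_measurable"
    by (rule bounded_measurable_compose[OF g])
      (intro borel_measurable_continuous_onI continuous_intros)
  have "T d (\<lambda>w. g (fst w, snd w - y)) (x, z) = T d g (x, z - y)" for x y z
    using semigroup_obs_shift[OF d g, of y x z] by (simp add: obs_shift_def case_prod_unfold)
  then show ?thesis
    using markov_parameter[OF \<mu> H t d B V] by simp
qed

text \<open>\<Phi> is the conditional probability, given everything up to time \<open>t + u\<close>,
  that the observation relative to the level \<open>V\<close> satisfies the constraints at the times
  \<open>t + s\<close>. One \<Phi> has to serve all laws and all \<open>t\<close>, since evaluating
  it at time 0 under point masses later identifies it. \<open>V\<close> is any level known at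
  \<open>t + u\<close>, so that a level fixed once can be carried through the recursion over later
  times.\<close>

definition cylinder_kernel :: "(real \<Rightarrow> (real ^ 'q) set) \<Rightarrow> real set \<Rightarrow> real \<Rightarrow> ('e \<times> (real ^ 'q) \<Rightarrow> real) \<Rightarrow> bool" where
  "cylinder_kernel A J u \<Phi> \<longleftrightarrow> \<Phi> \<in> bounded_measurable \<and> (\<forall>\<mu>\<in>prob_measures. \<forall>t\<ge>0.
    \<forall>B\<in>sets (full_filtration P (ennreal (t + u))). \<forall>V\<in>full_filtration P (ennreal (t + u)) \<rightarrow>\<^sub>M borel.
      (\<integral>w. indicator B w * (\<Prod>s\<in>J. indicator (A s) (observation (t + s) w - V w)) \<partial>completion (P \<mu>)) =
      (\<integral>w. indicator B w * \<Phi> (signal (t + u) w, observation (t + u) w - V w) \<partial>completion (P \<mu>)))"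

text \<open>Backward recursion in time: the kernel of the later constraints, seen from the earliest
  time \<open>b\<close>, is multiplied by the constraint at \<open>b\<close>, and the semigroup
  moves the product back from \<open>b\<close> to \<open>u\<close>.\<close>

lemma ex_cylinder_kernel:
  fixes A :: "real \<Rightarrow> (real ^ 'q) set"
  assumes A: "\<And>s. A s \<in> sets borel" and J: "finite J" and u: "0 \<le> u" "\<And>s. s \<in> J \<Longrightarrow> u \<le> s"
  shows "\<exists>\<Phi>. cylinder_kernel A J u \<Phi>"
  using J u
proof (induction J arbitrary: u rule: finite_linorder_min_induct)
  case empty
  show ?case
    unfolding cylinder_kernel_def by (intro exI[of _ "\<lambda>_. 1"] conjI bounded_measurable_const) simp
next
  case (insert b J u)
  note u = insert.prems
  then have ub: "u \<le> b" by simp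
  have "b \<notin> J" using insert.hyps(2) by auto
  have "b \<le> s" if "s \<in> J" for s using insert.hyps(2) that by (auto simp: less_imp_le)
  from insert.IH[OF order_trans[OF u(1) ub] this] obtain \<Phi> where ck: "cylinder_kernel A J b \<Phi>" by blast
  then have \<Phi>: "\<Phi> \<in> bounded_measurable" by (simp add: cylinder_kernel_def)
  have IH: "(\<integral>w. indicator B w * (\<Prod>s\<in>J. indicator (A s) (observation (t + s) w - V w)) \<partial>completion (P \<mu>)) =
      (\<integral>w. indicator B w * \<Phi> (signal (t + b) w, observation (t + b) w - V w) \<partial>completion (P \<mu>))"
    if "\<mu> \<in> prob_measures" "0 \<le> t" "B \<in> sets (full_filtration P (ennreal (t + b)))"
      "V \<in> full_filtration P (ennreal (t + b)) \<rightarrow>\<^sub>M borel" for \<mu> t B V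
    using ck that by (simp add: cylinder_kernel_def)
  define g where "g p = indicator (A b) (snd p) * \<Phi> p" for p
  have g: "g \<in> bounded_measurable"
    unfolding g_def
  proof (rule bounded_measurable_mult[OF _ \<Phi>])
    have "(snd :: 'e \<times> (real ^ 'q) \<Rightarrow> _) \<in> borel \<rightarrow>\<^sub>M borel"
      by (intro borel_measurable_continuous_onI continuous_intros)
    from bounded_measurable_compose[OF bounded_measurable_indicator[OF A] this]
    show "(\<lambda>p :: 'e \<times> (real ^ 'q). indicator (A b) (snd p)) \<in> bounded_measurable" .
  qed
  have d: "0 \<le> b - u" using ub by simp
  show ?case
    unfolding cylinder_kernel_def
  proof (intro exI[of _ "T (b - u) g"] conjI ballI allI impI)
    show "T (b - u) g \<in> bounded_measurable" by (rule bounded_measurable[OF d g])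
    fix \<mu> :: "'e measure" and t B and V :: "_ \<Rightarrow> real ^ 'q"
    assume \<mu>: "\<mu> \<in> prob_measures" and t: "0 \<le> t" and B: "B \<in> sets (full_filtration P (ennreal (t + u)))"
      and V: "V \<in> full_filtration P (ennreal (t + u)) \<rightarrow>\<^sub>M borel"
    have le: "t + u \<le> t + b" using ub by simp
    have Bb: "B \<in> sets (full_filtration P (ennreal (t + b)))"
      using B full_filtration_mono[OF ennreal_leI[OF le]] by auto
    have Vb: "V \<in> full_filtration P (ennreal (t + b)) \<rightarrow>\<^sub>M borel" by (rule full_measurable_mono[OF V le])
    have tb: "0 \<le> t + b" using t order_trans[OF u(1) ub] by simp
    \<comment> \<open>The constraint at \<open>b\<close> is an event known at time
      \<open>t + b\<close>, so it joins the conditioning event before the induction hypothesis is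
      applied.\<close>
    have "(\<lambda>w. observation (t + b) w - V w) \<in> full_filtration P (ennreal (t + b)) \<rightarrow>\<^sub>M borel"
      by (rule borel_measurable_diff[OF observation_full[OF tb order_refl] Vb])
    from measurable_sets[OF this A[of b]]
    have "(\<lambda>w. observation (t + b) w - V w) -` A b \<in> sets (full_filtration P (ennreal (t + b)))" by simp
    then have B': "B \<inter> (\<lambda>w. observation (t + b) w - V w) -` A b \<in> sets (full_filtration P (ennreal (t + b)))"
      (is "?B' \<in> _") using Bb by auto
    have "(\<integral>w. (indicator B w :: real) * (\<Prod>s\<in>insert b J. indicator (A s) (observation (t + s) w - V w)) \<partial>completion (P \<mu>)) =
      (\<integral>w. indicator ?B' w * (\<Prod>s\<in>J. indicator (A s) (observation (t + s) w - V w)) \<partial>completion (P \<mu>))"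
      using \<open>b \<notin> J\<close> insert.hyps(1)
      by (intro Bochner_Integration.integral_cong) (auto split: split_indicator)
    also have "\<dots> = (\<integral>w. indicator ?B' w * \<Phi> (signal (t + b) w, observation (t + b) w - V w) \<partial>completion (P \<mu>))"
      by (rule IH[OF \<mu> t B' Vb])
    also have "\<dots> = (\<integral>w. indicator B w * g (signal (t + u + (b - u)) w, observation (t + u + (b - u)) w - V w) \<partial>completion (P \<mu>))"
      by (intro Bochner_Integration.integral_cong) (auto simp: g_def split: split_indicator)
    also have "\<dots> = (\<integral>w. indicator B w * T (b - u) g (signal (t + u) w, observation (t + u) w - V w) \<partial>completion (P \<mu>))"
      using t u by (intro markov_shifted[OF \<mu> g _ d B V]) simp
    finally show "(\<integral>w. indicator B w * (\<Prod>s\<in>insert b J. indicator (A s) (observation (t + s) w - V w)) \<partial>completion (P \<mu>)) =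
      (\<integral>w. indicator B w * T (b - u) g (signal (t + u) w, observation (t + u) w - V w) \<partial>completion (P \<mu>))" .
  qed
qed

section \<open>Observation laws started from a point and their mixtures\<close>

lemma AE_observation_0:
  assumes \<mu>: "\<mu> \<in> prob_measures"
  shows "AE w in P \<mu>. observation 0 w = 0"
proof -
  interpret prob_space "P \<mu>" by (rule prob_space_P[OF \<mu>])
  let ?f = "\<lambda>p :: 'e \<times> (real ^ 'q). indicator (- {0}) (snd p) :: real"
  have "(snd :: 'e \<times> (real ^ 'q) \<Rightarrow> _) \<in> borel \<rightarrow>\<^sub>M borel"
    by (intro borel_measurable_continuous_onI continuous_intros)
  from bounded_measurable_compose[OF bounded_measurable_indicator this, of "- {0}"]
  have f: "?f \<in> bounded_measurable" by simp
  have S: "observation 0 -` (- {0}) \<in> sets (P \<mu>)"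
    using measurable_sets[OF borel_measurable_observation[of 0], of "- {0}"] \<mu> by simp
  have "measure (P \<mu>) (observation 0 -` (- {0})) = (\<integral>w. ?f (signal 0 w, observation 0 w) \<partial>P \<mu>)"
    using S by (simp add: indicator_vimage[symmetric])
  also have "\<dots> = 0" using initial[OF \<mu> f, of 0] zero[OF f] by simp
  finally have "observation 0 -` (- {0}) \<in> null_sets (P \<mu>)"
    using S by (auto simp: null_sets_def emeasure_eq_measure)
  from AE_not_in[OF this] show ?thesis by eventually_elim auto
qed

lemma return_prob_measures: "return borel x \<in> (prob_measures :: 'e measure set)"
  by (auto simp: space_prob_algebra intro!: prob_space_return)

lemma integral_signal_0:
  assumes \<mu>: "\<mu> \<in> prob_measures" and h: "h \<in> bounded_measurable"
  shows "(\<integral>w. h (signal 0 w) \<partial>completion (P \<mu>)) = (\<integral>x. h x \<partial>\<mu>)"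
proof -
  have f: "(\<lambda>p :: 'e \<times> (real ^ 'q). h (fst p)) \<in> bounded_measurable"
    by (rule bounded_measurable_compose[OF h]) (intro borel_measurable_continuous_onI continuous_intros)
  have m: "(\<lambda>w. h (signal 0 w)) \<in> borel_measurable (P \<mu>)"
    using measurable_compose[OF borel_measurable_signal[of 0] bounded_measurableD(1)[OF h]]
      measurable_cong_sets[OF sets_P[OF \<mu>] refl] by auto
  have "(\<integral>w. h (signal 0 w) \<partial>completion (P \<mu>)) = (\<integral>w. h (signal 0 w) \<partial>P \<mu>)"
    by (rule integral_completion[OF m])
  also have "\<dots> = (\<integral>x. h x \<partial>\<mu>)"
    using initial[OF \<mu> f, of 0] zero[OF f] by simp
  finally show ?thesis .
qed

text \<open>Measurability in \<open>x\<close> is not built into the family \<open>P\<close>. It is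
  derived from the kernels of cylinders, and with it the representation of \<open>P \<mu>\<close> on
  observation events as a mixture of these probabilities.\<close>

definition start_prob :: "('e, 'q) paths set \<Rightarrow> 'e \<Rightarrow> real" where
  "start_prob A x = measure (P (return borel x)) A"

lemma start_prob_nonneg: "0 \<le> start_prob A x"
  by (simp add: start_prob_def)

lemma start_prob_le_1: "start_prob A x \<le> 1"
  unfolding start_prob_def by (rule prob_space.prob_le_1[OF prob_space_P[OF return_prob_measures]])

lemma raw_obs_in_P: "\<mu> \<in> prob_measures \<Longrightarrow> A \<in> sets (raw_obs_filtration t) \<Longrightarrow> A \<in> sets (P \<mu>)"
  using subalgebra_raw_obs[of \<mu> t] by (auto simp: subalgebra_def)

lemma raw_obs_in_completion:
  "\<mu> \<in> prob_measures \<Longrightarrow> A \<in> sets (raw_obs_filtration t) \<Longrightarrow> A \<in> sets (completion (P \<mu>))"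
  using raw_obs_in_P by (intro sets_completionI_sets)

lemma restart_vimage_raw_obs:
  "0 \<le> t \<Longrightarrow> A \<in> sets raw_obs \<Longrightarrow> restart t -` A \<in> sets raw_obs"
  using measurable_sets[OF measurable_restart[of t]] by simp

text \<open>Under the law started at \<open>x\<close>, restarting at time 0 changes nothing almost
  surely and the signal at time 0 has the point mass at \<open>x\<close> as its law. The hypothesis
  \<open>eq\<close> with \<open>t = 0\<close> and the whole space as \<open>B\<close> therefore
  evaluates \<open>h\<close> at \<open>x\<close>.\<close>

lemma start_prob_eq_kernel:
  assumes A: "A \<in> sets raw_obs" and h: "h \<in> bounded_measurable"
    and eq: "\<And>\<mu> t B. \<mu> \<in> prob_measures \<Longrightarrow> 0 \<le> t \<Longrightarrow> B \<in> sets (full_filtration P (ennreal t)) \<Longrightarrow>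
      (\<integral>w. indicator B w * indicator A (restart t w) \<partial>completion (P \<mu>)) =
      (\<integral>w. indicator B w * h (signal t w) \<partial>completion (P \<mu>))"
  shows "start_prob A = h"
proof
  fix x :: 'e
  let ?\<delta> = "return borel x"
  note \<delta> = return_prob_measures[of x]
  have AE: "AE w in completion (P ?\<delta>). observation 0 w = 0"
    using AE_observation_0[OF \<delta>] by (rule AE_completion)
  have "start_prob A x = measure (completion (P ?\<delta>)) A"
    using raw_obs_in_P[OF \<delta> A] by (simp add: start_prob_def)
  also have "\<dots> = (\<integral>w. indicator A w \<partial>completion (P ?\<delta>))"
    using raw_obs_in_completion[OF \<delta> A] by (simp add: \<delta>)
  also have "\<dots> = (\<integral>w. indicator UNIV w * indicator A (restart 0 w) \<partial>completion (P ?\<delta>))"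
  proof (rule integral_cong_AE)
    show "(\<lambda>w. indicator UNIV w * indicator A (restart 0 w) :: real) \<in> borel_measurable (completion (P ?\<delta>))"
      using raw_obs_in_completion[OF \<delta> restart_vimage_raw_obs[OF order_refl A]]
      by (simp add: indicator_vimage[symmetric])
    show "AE w in completion (P ?\<delta>). (indicator A w :: real) = indicator UNIV w * indicator A (restart 0 w)"
      using AE by eventually_elim (simp add: restart_0)
  qed (use raw_obs_in_completion[OF \<delta> A] in simp)
  also have "\<dots> = (\<integral>w. h (signal 0 w) \<partial>completion (P ?\<delta>))"
    using eq[OF \<delta> order_refl UNIV_full_filtration] by simp
  also have "\<dots> = (\<integral>y. h y \<partial>?\<delta>)" by (rule integral_signal_0[OF \<delta> h])
  also have "\<dots> = h x" using bounded_measurableD(1)[OF h] by (simp add: integral_return)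
  finally show "start_prob A x = h x" .
qed

definition cylinders :: "('e, 'q) paths set set" where
  "cylinders = {{w. \<forall>s\<in>J. observation s w \<in> A s} | J A.
     finite J \<and> J \<subseteq> {0..} \<and> (\<forall>s. A s \<in> sets borel)}"

lemma raw_obs_cylinder_generator:
  "sets (raw_obs :: ('e, 'q) paths measure) = sigma_sets UNIV cylinders"
  proof
  show "sets raw_obs \<subseteq> sigma_sets UNIV cylinders"
    unfolding sets_raw_obs_filtration
  proof (intro sigma_sets_mono' subsetI)
    fix S :: "('e, 'q) paths set"
    assume "S \<in> {observation s -` A |s A. 0 \<le> s \<and> ennreal s \<le> \<infinity> \<and> A \<in> sets borel}"
    then obtain s A where "S = observation s -` A" "0 \<le> s" "A \<in> sets borel" by blast
    then show "S \<in> cylinders" unfolding cylinders_def by (intro CollectI exI[of _ "{s}"] exI[of _ "\<lambda>_. A"]) auto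
  qed
  have "cylinders \<subseteq> sets raw_obs"
  proof
    fix S :: "('e, 'q) paths set" assume "S \<in> cylinders"
    then obtain J A where S: "S = {w. \<forall>s\<in>J. observation s w \<in> A s}" and J: "finite J" "J \<subseteq> {0..}"
      and A: "\<And>s. A s \<in> sets borel" unfolding cylinders_def by blast
    have obs: "observation s -` A s \<in> sets raw_obs" if "s \<in> J" for s
      using J(2) that measurable_sets[OF observation_raw_obs[of s \<infinity>] A[of s]] by auto
    have "S = UNIV - (\<Union>s\<in>J. UNIV - observation s -` A s)" unfolding S by auto
    also have "\<dots> \<in> sets raw_obs"
      using obs J(1) sets.compl_sets[of _ "raw_obs"]
        sets.top[of "raw_obs"] by (intro sets.Diff sets.finite_UN) auto
    finally show "S \<in> sets raw_obs" .
  qed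
  then show "sigma_sets UNIV cylinders \<subseteq> sets raw_obs"
    using sets.sigma_sets_subset[of cylinders "raw_obs"] by simp
qed

lemma UNIV_in_cylinders: "UNIV \<in> cylinders"
  unfolding cylinders_def by (intro CollectI exI[of _ "{}"] exI[of _ "\<lambda>_. UNIV"]) auto

lemma Int_stable_cylinders:
  "Int_stable cylinders"
proof (rule Int_stableI)
  fix a b assume "a \<in> cylinders" "b \<in> cylinders"
  then obtain J A J' A' where a: "a = {w. \<forall>s\<in>J. observation s w \<in> A s}"
    "finite J" "J \<subseteq> {0..}" "\<And>s. A s \<in> sets borel"
    and b: "b = {w. \<forall>s\<in>J'. observation s w \<in> A' s}"
    "finite J'" "J' \<subseteq> {0..}" "\<And>s. A' s \<in> sets borel" unfolding cylinders_def by blast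
  let ?A = "\<lambda>s. (if s \<in> J then A s else UNIV) \<inter> (if s \<in> J' then A' s else UNIV)"
  have "a \<inter> b = {w. \<forall>s\<in>J \<union> J'. observation s w \<in> ?A s}" unfolding a(1) b(1) by auto
  moreover have "?A s \<in> sets borel" for s using a(4) b(4) by auto
  ultimately show "a \<inter> b \<in> cylinders"
    unfolding cylinders_def mem_Collect_eq
    by (intro exI[of _ "J \<union> J'"] exI[of _ ?A]) (use a(2,3) b(2,3) in simp)
qed

lemma start_prob_cylinder:
  assumes A: "\<And>s. A s \<in> sets borel" and J: "finite J" "J \<subseteq> {0..}"
  defines "S \<equiv> {w. \<forall>s\<in>J. observation s w \<in> A s}"
  shows "start_prob S \<in> bounded_measurable"
    and "\<lbrakk>\<mu> \<in> prob_measures; 0 \<le> t; B \<in> sets (full_filtration P (ennreal t))\<rbrakk> \<Longrightarrow>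
      (\<integral>w. indicator B w * indicator S (restart t w) \<partial>completion (P \<mu>)) =
      (\<integral>w. indicator B w * start_prob S (signal t w) \<partial>completion (P \<mu>))"
proof -
  obtain \<Phi> where ck: "cylinder_kernel A J 0 \<Phi>"
    using ex_cylinder_kernel[of A J 0] A J by auto
  then have \<Phi>: "\<Phi> \<in> bounded_measurable" by (simp add: cylinder_kernel_def)
  have eq: "(\<integral>w. indicator B w * (\<Prod>s\<in>J. indicator (A s) (observation (t + s) w - V w)) \<partial>completion (P \<mu>)) =
      (\<integral>w. indicator B w * \<Phi> (signal t w, observation t w - V w) \<partial>completion (P \<mu>))"
    if "\<mu> \<in> prob_measures" "0 \<le> t" "B \<in> sets (full_filtration P (ennreal t))"
      "V \<in> full_filtration P (ennreal t) \<rightarrow>\<^sub>M borel" for \<mu> t B V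
    using ck that by (simp add: cylinder_kernel_def)
  have Pair_m: "(\<lambda>x. (x, 0 :: real ^ 'q)) \<in> (borel :: 'e measure) \<rightarrow>\<^sub>M borel"
    by (intro borel_measurable_continuous_onI continuous_intros)
  have h: "(\<lambda>x. \<Phi> (x, 0)) \<in> bounded_measurable"
    by (rule bounded_measurable_compose[OF \<Phi> Pair_m])
  have S: "S \<in> sets raw_obs"
    unfolding raw_obs_cylinder_generator S_def cylinders_def using A J by (intro sigma_sets.Basic) blast
  have ind: "indicator S (restart t w) =
      (\<Prod>s\<in>J. indicator (A s) (observation (t + s) w - observation t w) :: real)" if t: "0 \<le> t" for t w
  proof -
    have "restart t w \<in> S \<longleftrightarrow> (\<forall>s\<in>J. observation (t + s) w - observation t w \<in> A s)"
      using J(2) t by (auto simp: S_def observation_restart subset_iff)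
    then show ?thesis using J(1) by (auto simp: indicator_def prod_zero_iff)
  qed
  \<comment> \<open>With \<open>V\<close> the observation at time \<open>t\<close> itself, the
    constraints concern the restarted path and the second argument of \<Phi> becomes 0.\<close>
  have restart: "(\<integral>w. indicator B w * indicator S (restart t w) \<partial>completion (P \<mu>)) =
      (\<integral>w. indicator B w * \<Phi> (signal t w, 0) \<partial>completion (P \<mu>))"
    if "\<mu> \<in> prob_measures" and t: "0 \<le> t" and "B \<in> sets (full_filtration P (ennreal t))" for \<mu> t B
    unfolding ind[OF t] using eq[OF that observation_full[OF t order_refl]] by simp
  have sp: "start_prob S = (\<lambda>x. \<Phi> (x, 0))" by (rule start_prob_eq_kernel[OF S h restart])
  show "start_prob S \<in> bounded_measurable" unfolding sp by (rule h)
  show "\<lbrakk>\<mu> \<in> prob_measures; 0 \<le> t; B \<in> sets (full_filtration P (ennreal t))\<rbrakk> \<Longrightarrow>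
      (\<integral>w. indicator B w * indicator S (restart t w) \<partial>completion (P \<mu>)) =
      (\<integral>w. indicator B w * start_prob S (signal t w) \<partial>completion (P \<mu>))"
    unfolding sp by (rule restart)
qed

lemma integral_start_prob:
  "A \<in> sets raw_obs \<Longrightarrow> (\<integral>w. indicator A w \<partial>P (return borel x)) = start_prob A x"
  using raw_obs_in_P[OF return_prob_measures] by (simp add: start_prob_def return_prob_measures)

lemmas raw_obs_generator = raw_obs_cylinder_generator Int_stable_cylinders UNIV_in_cylinders

lemma daniell_start: "daniell raw_obs (\<lambda>f. \<integral>w. f w \<partial>P (return borel x))"
  using subalgebra_raw_obs[OF return_prob_measures]
  by (intro daniell_integral prob_space_P return_prob_measures) (auto simp: subalgebra_def)

lemma cylinder_raw_obs: "A \<in> cylinders \<Longrightarrow> A \<in> sets raw_obs"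
  unfolding raw_obs_cylinder_generator by (rule sigma_sets.Basic)

lemma start_prob_bounded_measurable:
  assumes A: "A \<in> sets raw_obs"
  shows "start_prob A \<in> bounded_measurable"
proof (rule bounded_measurableI[where C=1])
  have "(\<lambda>x. \<integral>w. (indicator A w :: real) \<partial>P (return borel x)) \<in> borel_measurable borel"
  proof (rule daniell_measurable[OF raw_obs_generator daniell_start _ bounded_measurable_on_indicator[OF A]])
    fix C :: "('e, 'q) paths set" assume C: "C \<in> cylinders"
    then obtain J A where "C = {w. \<forall>s\<in>J. observation s w \<in> A s}" "finite J" "J \<subseteq> {0..}" "\<And>s. A s \<in> sets borel"
      unfolding cylinders_def by blast
    then have "start_prob C \<in> bounded_measurable" using start_prob_cylinder(1)[of A J] by simp
    then show "(\<lambda>x. \<integral>w. (indicator C w :: real) \<partial>P (return borel x)) \<in> borel_measurable borel"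
      unfolding integral_start_prob[OF cylinder_raw_obs[OF C]] by (rule bounded_measurableD(1))
  qed
  then show "start_prob A \<in> borel_measurable borel" by (simp only: integral_start_prob[OF A])
  show "\<bar>start_prob A x\<bar> \<le> 1" for x using start_prob_nonneg start_prob_le_1 by simp
qed

text \<open>Given the whole past at time \<open>t\<close>, the future increments depend on the
  signal at \<open>t\<close> alone. Both sides come from Daniell functionals of the event
  \<open>A\<close>, so it suffices that \<open>start_prob_cylinder\<close> settles
  cylinders.\<close>

lemma restart_integral:
  assumes \<mu>: "\<mu> \<in> prob_measures" and t: "0 \<le> t" and B: "B \<in> sets (full_filtration P (ennreal t))"
    and A: "A \<in> sets raw_obs"
  shows "(\<integral>w. indicator B w * indicator A (restart t w) \<partial>completion (P \<mu>)) =
    (\<integral>w. indicator B w * start_prob A (signal t w) \<partial>completion (P \<mu>))"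
proof -
  let ?M = "completion (P \<mu>)"
  have "(\<integral>w. (indicator B w :: real) * indicator A (restart t w) \<partial>?M) =
      (\<integral>w. indicator B w * (\<integral>w'. indicator A w' \<partial>P (return borel (signal t w))) \<partial>?M)"
  proof (rule integral_daniell_eq[OF prob_space_completion[OF \<mu>] raw_obs_generator daniell_eval daniell_start,
        where f="indicator A"])
    show "B \<in> sets ?M"
      using B subalgebra_full_filtration[OF \<mu>, of "ennreal t"] by (auto simp: subalgebra_def)
    show "indicator A \<in> bounded_measurable_on raw_obs"
      by (rule bounded_measurable_on_indicator[OF A])
    fix C :: "('e, 'q) paths set" assume C: "C \<in> cylinders"
    note CR = cylinder_raw_obs[OF C]
    obtain J D where D: "C = {w. \<forall>s\<in>J. observation s w \<in> D s}" "finite J" "J \<subseteq> {0..}"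
      "\<And>s. D s \<in> sets borel" using C unfolding cylinders_def by blast
    have "restart t -` C \<in> sets ?M"
      by (rule raw_obs_in_completion[OF \<mu> restart_vimage_raw_obs[OF t CR]])
    then show "(\<lambda>w. indicator C (restart t w) :: real) \<in> borel_measurable ?M"
      by (simp add: indicator_vimage[symmetric])
    show "(\<lambda>w. \<integral>w'. (indicator C w' :: real) \<partial>P (return borel (signal t w))) \<in> borel_measurable ?M"
      unfolding integral_start_prob[OF CR]
      by (rule measurable_compose[OF full_measurable_completion[OF \<mu> signal_full[OF t order_refl]]
            bounded_measurableD(1)[OF start_prob_bounded_measurable[OF CR]]])
    show "(\<integral>w. (indicator B w :: real) * indicator C (restart t w) \<partial>?M) =
        (\<integral>w. indicator B w * (\<integral>w'. indicator C w' \<partial>P (return borel (signal t w))) \<partial>?M)"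
      unfolding integral_start_prob[OF CR] unfolding D(1) by (rule start_prob_cylinder(2)[OF D(4,2,3) \<mu> t B])
  qed
  then show ?thesis by (simp only: integral_start_prob[OF A])
qed

text \<open>The case \<open>t = 0\<close> of \<open>restart_integral\<close>. It makes the
  observation law affine in the initial law, and with a filter in place of \<mu> it turns the
  filter's mean of \<open>start_prob A\<close> into a probability under \<open>P\<close>.\<close>

lemma measure_P_raw_obs:
  assumes \<mu>: "\<mu> \<in> prob_measures" and A: "A \<in> sets raw_obs"
  shows "measure (P \<mu>) A = (\<integral>x. start_prob A x \<partial>\<mu>)"
proof -
  have AE: "AE w in completion (P \<mu>). observation 0 w = 0"
    using AE_observation_0[OF \<mu>] by (rule AE_completion)
  have "measure (P \<mu>) A = (\<integral>w. indicator A w \<partial>completion (P \<mu>))"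
    using raw_obs_in_completion[OF \<mu> A] raw_obs_in_P[OF \<mu> A] by simp
  also have "\<dots> = (\<integral>w. indicator UNIV w * indicator A (restart 0 w) \<partial>completion (P \<mu>))"
  proof (rule integral_cong_AE)
    show "(\<lambda>w. indicator UNIV w * indicator A (restart 0 w) :: real) \<in> borel_measurable (completion (P \<mu>))"
      using raw_obs_in_completion[OF \<mu> restart_vimage_raw_obs[OF order_refl A]]
      by (simp add: indicator_vimage[symmetric])
    show "AE w in completion (P \<mu>). (indicator A w :: real) = indicator UNIV w * indicator A (restart 0 w)"
      using AE by eventually_elim (simp add: restart_0)
  qed (use raw_obs_in_completion[OF \<mu> A] in simp)
  also have "\<dots> = (\<integral>w. start_prob A (signal 0 w) \<partial>completion (P \<mu>))"
    using restart_integral[OF \<mu> order_refl UNIV_full_filtration A] by simp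
  also have "\<dots> = (\<integral>x. start_prob A x \<partial>\<mu>)"
    by (rule integral_signal_0[OF \<mu> start_prob_bounded_measurable[OF A]])
  finally show ?thesis .
qed

end

section \<open>Total variation distance of observation laws\<close>

text \<open>Boolean terms name the elements of the algebra generated by a sequence of sets, which is
  therefore countable.\<close>

datatype bterm = Gen nat | Comp bterm | Join bterm bterm

instance bterm :: countable
  by countable_datatype

primrec bterm_set :: "(nat \<Rightarrow> 'a set) \<Rightarrow> bterm \<Rightarrow> 'a set" where
  "bterm_set C (Gen n) = C n"
| "bterm_set C (Comp a) = - bterm_set C a"
| "bterm_set C (Join a b) = bterm_set C a \<union> bterm_set C b"

lemma algebra_bterm_set: "algebra UNIV (range (bterm_set C))"
  unfolding algebra_iff_Un
proof (intro conjI ballI)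
  have "- (bterm_set C (Gen 0) \<union> - bterm_set C (Gen 0)) = {}" by auto
  then have "bterm_set C (Comp (Join (Gen 0) (Comp (Gen 0)))) = {}" by simp
  then show "{} \<in> range (bterm_set C)" by (metis rangeI)
next
  fix a assume "a \<in> range (bterm_set C)"
  then obtain x where "a = bterm_set C x" by auto
  then show "UNIV - a \<in> range (bterm_set C)"
    by (intro range_eqI[of _ _ "Comp x"]) (simp add: Compl_eq_Diff_UNIV)
next
  fix a b assume "a \<in> range (bterm_set C)" "b \<in> range (bterm_set C)"
  then obtain x y where "a = bterm_set C x" "b = bterm_set C y" by auto
  then show "a \<union> b \<in> range (bterm_set C)"
    by (intro range_eqI[of _ _ "Join x y"]) simp
qed auto

lemma bterm_set_in_sigma: "bterm_set C a \<in> sigma_sets UNIV (range C)"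
  by (induction a) (auto simp: Compl_eq_Diff_UNIV intro: sigma_sets.intros sigma_sets_Un)

section \<open>Countable generation of the observation field\<close>

lemma observation_tendsto_right:
  assumes s: "0 \<le> s" and r: "filterlim r (at_right s) sequentially"
  shows "(\<lambda>n. observation (r n) w) \<longlonglongrightarrow> observation s w"
  unfolding observation_def using filterlim_compose[OF path_at_tendsto_right[OF s] r] .

lemma ex_rational_sequence_right:
  fixes s :: real
  shows "\<exists>r. (\<forall>n::nat. r n \<in> \<rat> \<and> s < r n) \<and> filterlim r (at_right s) sequentially"
proof -
  have "\<exists>q. q \<in> \<rat> \<and> s < q \<and> q < s + 1 / (real n + 1)" for n :: nat
    using Rats_dense_in_real[of s "s + 1 / (real n + 1)"] by auto
  then obtain r where r: "\<And>n::nat. r n \<in> \<rat> \<and> s < r n \<and> r n < s + 1 / (real n + 1)" by metis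
  have "(\<lambda>n. s + 1 / (real n + 1)) \<longlonglongrightarrow> s + 0"
    using LIMSEQ_inverse_real_of_nat by (intro tendsto_add tendsto_const) (simp add: inverse_eq_divide add.commute)
  then have "r \<longlonglongrightarrow> s"
    using r by (intro tendsto_sandwich[of "\<lambda>_. s" r sequentially "\<lambda>n. s + 1 / (real n + 1)" s])
      (auto intro!: always_eventually less_imp_le)
  then have "filterlim r (at_right s) sequentially"
    unfolding filterlim_at using r by (auto intro!: always_eventually)
  with r show ?thesis by blast
qed

text \<open>Rational times and a countable basis of the observation space suffice, because right
  continuity recovers the observation at a real time as a limit along rational times.\<close>

lemma raw_obs_countably_generated:
  "\<exists>C. sets (raw_obs :: ('e::topological_space, 'q::finite) paths measure) = sigma_sets UNIV (range (C :: nat \<Rightarrow> _ set))"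
proof -
  obtain \<B> :: "(real ^ 'q) set set" where B: "countable \<B>" "topological_basis \<B>"
    using ex_countable_basis by blast
  define G :: "('e, 'q) paths set set" where
    "G = (\<lambda>(s, U). observation s -` U) ` ((\<rat> \<inter> {0..}) \<times> \<B>)"
  have "countable G" unfolding G_def using B(1) countable_rat by auto
  moreover have "G \<noteq> {}"
  proof -
    have "\<B> \<noteq> {}"
    proof
      assume "\<B> = {}"
      then have "UNIV = ({} :: (real ^ 'q) set)"
        using B(2) unfolding topological_basis_def by (metis Union_empty open_UNIV subset_empty)
      then show False by simp
    qed
    moreover have "(0::real) \<in> \<rat> \<inter> {0..}" by simp
    ultimately show ?thesis unfolding G_def by blast
  qed
  ultimately have rG: "range (from_nat_into G) = G" by (intro range_from_nat_into) auto
  have borel_B: "borel = sigma UNIV \<B>" by (rule borel_eq_countable_basis[OF B])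
  let ?M = "sigma UNIV G"
  have rat: "observation s \<in> ?M \<rightarrow>\<^sub>M borel" if s: "s \<in> \<rat>" "0 \<le> s" for s
    unfolding borel_B
  proof (rule measurable_measure_of)
    fix U assume "U \<in> \<B>"
    then have "observation s -` U \<in> G" unfolding G_def using s by (intro image_eqI[of _ _ "(s, U)"]) auto
    then show "observation s -` U \<inter> space ?M \<in> sets ?M" by (auto intro: sigma_sets.Basic)
  qed auto
  have all: "observation s \<in> ?M \<rightarrow>\<^sub>M borel" if s: "0 \<le> s" for s
  proof -
    obtain r where r: "\<And>n::nat. r n \<in> \<rat> \<and> s < r n" "filterlim r (at_right s) sequentially"
      using ex_rational_sequence_right[of s] by blast
    show ?thesis
    proof (rule borel_measurable_LIMSEQ_metric[of "\<lambda>n. observation (r n)"])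
      show "observation (r n) \<in> ?M \<rightarrow>\<^sub>M borel" for n using r(1)[of n] s by (intro rat) auto
      show "(\<lambda>n. observation (r n) w) \<longlonglongrightarrow> observation s w" for w
        by (rule observation_tendsto_right[OF s r(2)])
    qed
  qed
  have "sets raw_obs = sigma_sets UNIV G"
  proof
    show "sets raw_obs \<subseteq> sigma_sets UNIV G"
      unfolding sets_raw_obs_filtration
    proof (rule sigma_sets_mono, rule subsetI)
      fix S :: "('e, 'q) paths set"
      assume "S \<in> {observation s -` A |s A. 0 \<le> s \<and> ennreal s \<le> \<infinity> \<and> A \<in> sets borel}"
      then obtain s A where "S = observation s -` A" "0 \<le> s" "A \<in> sets borel" by blast
      then show "S \<in> sigma_sets UNIV G"
        using measurable_sets[OF all[of s], of A] by simp
    qed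
    have "G \<subseteq> sets raw_obs"
    proof
      fix S assume "S \<in> G"
      then obtain s U where S: "S = observation s -` U" "0 \<le> s" "U \<in> \<B>" unfolding G_def by auto
      have "U \<in> sets borel" using S(3) B(2) by (auto dest: topological_basis_open)
      then show "S \<in> sets raw_obs"
        using measurable_sets[OF observation_raw_obs[of s \<infinity>], of U] S by simp
    qed
    then show "sigma_sets UNIV G \<subseteq> sets raw_obs"
      using sets.sigma_sets_subset[of G "raw_obs"] by simp
  qed
  then show ?thesis using rG by (intro exI[of _ "from_nat_into G"]) simp
qed

lemma raw_obs_countable_algebra:
  obtains \<A> :: "('e::topological_space, 'q::finite) paths set set" where "countable \<A>" "algebra UNIV \<A>"
    "sets raw_obs = sigma_sets UNIV \<A>"
proof -
  obtain C :: "nat \<Rightarrow> ('e, 'q) paths set" where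
    C: "sets raw_obs = sigma_sets UNIV (range C)"
    using raw_obs_countably_generated by blast
  have "C n \<in> range (bterm_set C)" for n by (metis bterm_set.simps(1) rangeI)
  then have "sigma_sets UNIV (range C) \<subseteq> sigma_sets UNIV (range (bterm_set C))"
    by (intro sigma_sets_mono') auto
  moreover have "sigma_sets UNIV (range (bterm_set C)) \<subseteq> sigma_sets UNIV (range C)"
    using bterm_set_in_sigma[of C] by (intro sigma_sets_mono) auto
  ultimately show ?thesis
    using that[of "range (bterm_set C)"] algebra_bterm_set C by auto
qed

text \<open>The measure needed to dominate \<open>P \<mu>\<close> and \<open>P \<nu>\<close> must
  itself be a member of the family, since \<open>obs_field\<close> is completed with respect to
  members only. As observation laws are affine in the initial law, averaging the initial laws
  achieves this.\<close>

definition average :: "'a measure \<Rightarrow> 'a measure \<Rightarrow> 'a measure" where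
  "average M N = measure_of (space M) (sets M) (\<lambda>A. (emeasure M A + emeasure N A) / 2)"

lemma sets_average [simp]: "sets (average M N) = sets M"
  and space_average [simp]: "space (average M N) = space M"
  by (auto simp: average_def)

lemma emeasure_average:
  assumes "sets N = sets M" "A \<in> sets M"
  shows "emeasure (average M N) A = (emeasure M A + emeasure N A) / 2"
  unfolding average_def
proof (rule emeasure_measure_of_sigma)
  show "sigma_algebra (space M) (sets M)" by unfold_locales
  show "positive (sets M) (\<lambda>A. (emeasure M A + emeasure N A) / 2)" by (auto simp: positive_def)
  show "countably_additive (sets M) (\<lambda>A. (emeasure M A + emeasure N A) / 2)"
    unfolding countably_additive_def
  proof (intro allI impI)
    fix F :: "nat \<Rightarrow> 'a set" assume F: "range F \<subseteq> sets M" "disjoint_family F"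
    have "(\<Sum>i. (emeasure M (F i) + emeasure N (F i)) / 2) = ((\<Sum>i. emeasure M (F i)) + (\<Sum>i. emeasure N (F i))) / 2"
      by (simp add: divide_ennreal_def suminf_add[symmetric])
    then show "(\<Sum>i. (emeasure M (F i) + emeasure N (F i)) / 2) = (emeasure M (\<Union>(range F)) + emeasure N (\<Union>(range F))) / 2"
      using F assms(1) by (simp add: suminf_emeasure)
  qed
qed fact

lemma prob_measuresD:
  assumes "\<mu> \<in> prob_measures"
  shows "prob_space \<mu>" "sets \<mu> = sets borel" "space \<mu> = UNIV"
proof -
  show "prob_space \<mu>" and s: "sets \<mu> = sets borel" using assms by (auto simp: space_prob_algebra)
  show "space \<mu> = UNIV" using sets_eq_imp_space_eq[OF s] by simp
qed

lemma average_prob_measures: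
  assumes "\<mu> \<in> prob_measures" "\<nu> \<in> prob_measures"
  shows "average \<mu> \<nu> \<in> prob_measures"
proof -
  have s: "prob_space \<mu>" "prob_space \<nu>" "sets \<mu> = sets borel" "sets \<nu> = sets borel"
    using assms by (auto simp: space_prob_algebra)
  have sp: "space \<mu> = UNIV" "space \<nu> = UNIV" using assms by (auto simp: prob_measuresD)
  have "emeasure (average \<mu> \<nu>) (space (average \<mu> \<nu>)) = (1 + 1) / 2"
    using s sp prob_space.emeasure_space_1[OF s(1)] prob_space.emeasure_space_1[OF s(2)]
    by (subst emeasure_average) auto
  also have "\<dots> = (1::ennreal)" by (simp add: divide_eq_1_ennreal)
  finally have "prob_space (average \<mu> \<nu>)" by (rule prob_spaceI)
  then show ?thesis using s by (auto simp: space_prob_algebra)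
qed

lemma measure_average:
  assumes "\<mu> \<in> prob_measures" "\<nu> \<in> prob_measures" "A \<in> sets borel"
  shows "measure (average \<mu> \<nu>) A = (measure \<mu> A + measure \<nu> A) / 2"
proof -
  have s: "prob_space \<mu>" "prob_space \<nu>" "prob_space (average \<mu> \<nu>)" "sets \<mu> = sets borel" "sets \<nu> = sets borel"
    using assms(1,2) average_prob_measures[OF assms(1,2)] by (auto simp: space_prob_algebra)
  interpret m: prob_space \<mu> by fact
  interpret n: prob_space \<nu> by fact
  interpret a: prob_space "average \<mu> \<nu>" by fact
  have "ennreal (measure (average \<mu> \<nu>) A) = (emeasure \<mu> A + emeasure \<nu> A) / 2"
    using emeasure_average[of \<nu> \<mu> A] s assms(3) by (simp add: a.emeasure_eq_measure)
  also have "\<dots> = ennreal ((measure \<mu> A + measure \<nu> A) / 2)"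
    by (simp add: m.emeasure_eq_measure n.emeasure_eq_measure ennreal_plus[symmetric] divide_ennreal[symmetric] del: ennreal_plus)
  finally show ?thesis by (simp add: zero_le_divide_iff del: ennreal_plus)
qed

lemma daniell_prob_measure: "\<mu> \<in> prob_measures \<Longrightarrow> daniell borel (\<lambda>f. \<integral>x. f x \<partial>\<mu>)"
  using prob_measuresD[of \<mu>] by (intro daniell_integral) auto

lemma borel_generator: "sets borel = sigma_sets UNIV (sets borel)" "Int_stable (sets borel)" "UNIV \<in> sets borel"
  using sets.sigma_sets_eq[of borel] by (auto simp: Int_stable_def)

lemma integral_average:
  fixes f :: "'a::topological_space \<Rightarrow> real"
  assumes \<mu>: "\<mu> \<in> prob_measures" and \<nu>: "\<nu> \<in> prob_measures" and f: "f \<in> bounded_measurable"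
  shows "(\<integral>x. f x \<partial>average \<mu> \<nu>) = ((\<integral>x. f x \<partial>\<mu>) + (\<integral>x. f x \<partial>\<nu>)) / 2"
  using borel_generator f[folded bounded_measurable_on_borel]
proof (induction rule: bounded_measurable_on_induct)
  case (generator A)
  then show ?case
    using measure_average[OF \<mu> \<nu>] prob_measuresD(3)[OF \<mu>] prob_measuresD(3)[OF \<nu>] by simp
next
  case (lin f g a b)
  note daniell_lin[OF daniell_prob_measure lin.hyps]
  then show ?case using lin.IH \<mu> \<nu> average_prob_measures[OF \<mu> \<nu>] by (simp add: field_simps)
next
  case (mono f h)
  note l = daniell_mono[OF daniell_prob_measure mono.hyps]
  have "(\<lambda>n. ((\<integral>x. h n x \<partial>\<mu>) + (\<integral>x. h n x \<partial>\<nu>)) / 2) \<longlonglongrightarrow> ((\<integral>x. f x \<partial>\<mu>) + (\<integral>x. f x \<partial>\<nu>)) / 2"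
    by (intro tendsto_intros l \<mu> \<nu>) auto
  with l[OF average_prob_measures[OF \<mu> \<nu>]] show ?case unfolding mono.IH by (rule LIMSEQ_unique)
qed

text \<open>The section at time \<open>t\<close> of a generating set is the preimage of a Borel set
  under \<open>Z t\<close>, which is known at time \<open>t\<close>.\<close>

lemma measurable_optional_section:
  fixes f :: "real \<times> 'w \<Rightarrow> 'b"
  assumes f: "f \<in> optional_field F \<rightarrow>\<^sub>M K" and t: "0 \<le> t" and sp: "space (F (ennreal t)) = UNIV"
  shows "(\<lambda>w. f (t, w)) \<in> F (ennreal t) \<rightarrow>\<^sub>M K"
proof (rule measurable_compose[OF _ f])
  show "(\<lambda>w. (t, w)) \<in> F (ennreal t) \<rightarrow>\<^sub>M optional_field F"
    unfolding optional_field_def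
  proof (rule measurable_measure_of)
    fix S assume "S \<in> {{(t, w). 0 \<le> t \<and> Z t w \<in> B} |Z B.
        (\<forall>t\<ge>0. Z t \<in> borel_measurable (F (ennreal t))) \<and>
        (\<forall>w. cadlag_in euclidean (\<lambda>t. Z t w)) \<and> B \<in> sets (borel :: real measure)}"
    then obtain Z B where S: "S = {(t, w). 0 \<le> t \<and> Z t w \<in> B}"
      and Z: "\<And>t. 0 \<le> t \<Longrightarrow> Z t \<in> borel_measurable (F (ennreal t))" and B: "B \<in> sets (borel :: real measure)"
      by blast
    have "(\<lambda>w. (t, w)) -` S = Z t -` B" using t unfolding S by auto
    then show "(\<lambda>w. (t, w)) -` S \<inter> space (F (ennreal t)) \<in> sets (F (ennreal t))"
      using measurable_sets[OF Z[OF t] B] by simp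
  qed (use t in auto)
qed

section \<open>Weak limits and the distance over a class of functions\<close>

lemma weak_tendsto_integral:
  fixes g :: "'a::topological_space \<Rightarrow> real"
  assumes lim: "limitin weak_topology \<pi> \<mu> F" and g: "g \<in> bcontfun" and \<mu>: "\<mu> \<in> prob_measures"
  shows "((\<lambda>t. \<integral>x. g x \<partial>\<pi> t) \<longlongrightarrow> (\<integral>x. g x \<partial>\<mu>)) F"
proof (rule topological_tendstoI)
  fix U :: "real set" assume U: "open U" "(\<integral>x. g x \<partial>\<mu>) \<in> U"
  have "openin weak_topology {\<mu> \<in> prob_measures. (\<integral>x. g x \<partial>\<mu>) \<in> U}"
    unfolding weak_topology_def using g U(1) by (intro topology_generated_by_Basis) blast
  moreover have "\<mu> \<in> {\<mu> \<in> prob_measures. (\<integral>x. g x \<partial>\<mu>) \<in> U}" using \<mu> U by simp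
  ultimately have "\<forall>\<^sub>F t in F. \<pi> t \<in> {\<mu> \<in> prob_measures. (\<integral>x. g x \<partial>\<mu>) \<in> U}"
    using lim unfolding limitin_def by blast
  then show "\<forall>\<^sub>F t in F. (\<integral>x. g x \<partial>\<pi> t) \<in> U" by eventually_elim simp
qed

text \<open>A real supremum is informative only for a set bounded above; uniform boundedness of
  \<open>G\<close> provides this.\<close>

lemma dist_on_bounds:
  fixes G :: "('a::topological_space \<Rightarrow> real) set"
  assumes G: "uniformly_bounded G" and \<mu>: "\<mu> \<in> prob_measures" and \<nu>: "\<nu> \<in> prob_measures"
  shows "0 \<le> dist_on G \<mu> \<nu>" "g \<in> G \<Longrightarrow> \<bar>(\<integral>x. g x \<partial>\<mu>) - (\<integral>x. g x \<partial>\<nu>)\<bar> \<le> dist_on G \<mu> \<nu>"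
proof -
  obtain C where C: "\<And>g x. g \<in> G \<Longrightarrow> \<bar>g x\<bar> \<le> C" using G unfolding uniformly_bounded_def by blast
  have int: "\<bar>\<integral>x. g x \<partial>\<rho>\<bar> \<le> \<bar>C\<bar>" if g: "g \<in> G" and \<rho>: "\<rho> \<in> prob_measures" for g and \<rho> :: "'a measure"
  proof -
    interpret prob_space \<rho> using \<rho> by (auto simp: space_prob_algebra)
    have "\<bar>\<integral>x. g x \<partial>\<rho>\<bar> \<le> (\<integral>x. \<bar>g x\<bar> \<partial>\<rho>)" by (rule integral_abs_bound)
    also have "\<dots> \<le> \<bar>C\<bar>"
    proof (cases "integrable \<rho> (\<lambda>x. \<bar>g x\<bar>)")
      case True
      then show ?thesis
        using order_trans[OF C[OF g] abs_ge_self] by (intro integral_le_const) (auto intro!: AE_I2)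
    next
      \<comment> \<open>Members of \<open>G\<close> may fail to be measurable here; the integral is
        then 0 by convention and obeys the same bound.\<close>
      case False
      then show ?thesis by (simp add: not_integrable_integral_eq)
    qed
    finally show ?thesis .
  qed
  have bdd: "bdd_above (insert 0 ((\<lambda>g. \<bar>(\<integral>x. g x \<partial>\<mu>) - (\<integral>x. g x \<partial>\<nu>)\<bar>) ` G))"
  proof (rule bdd_aboveI)
    fix v assume "v \<in> insert 0 ((\<lambda>g. \<bar>(\<integral>x. g x \<partial>\<mu>) - (\<integral>x. g x \<partial>\<nu>)\<bar>) ` G)"
    then show "v \<le> 2 * \<bar>C\<bar>" using int[OF _ \<mu>] int[OF _ \<nu>] by fastforce
  qed
  show "0 \<le> dist_on G \<mu> \<nu>" unfolding dist_on_def by (rule cSup_upper[OF _ bdd]) simp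
  show "\<bar>(\<integral>x. g x \<partial>\<mu>) - (\<integral>x. g x \<partial>\<nu>)\<bar> \<le> dist_on G \<mu> \<nu>" if "g \<in> G"
    unfolding dist_on_def by (rule cSup_upper[OF _ bdd]) (use that in auto)
qed

lemma dist_on_leI:
  assumes "0 \<le> e" "\<And>g. g \<in> G \<Longrightarrow> \<bar>(\<integral>x. g x \<partial>\<mu>) - (\<integral>x. g x \<partial>\<nu>)\<bar> \<le> e"
  shows "dist_on G \<mu> \<nu> \<le> e"
  unfolding dist_on_def by (rule cSup_least) (use assms in auto)

text \<open>The optional projection is stated through stopping times; this is what reduces it to an
  ordinary conditional expectation at a fixed time.\<close>

lemma (in filtration) sets_pre_sigma_const: "sets (pre_sigma (\<lambda>_. t)) = sets (F t)"
proof (rule set_eqI)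
  fix A
  have "(\<forall>u. {w \<in> A. t \<le> u} \<in> sets (F u)) \<longleftrightarrow> A \<in> sets (F t)"
  proof
    assume "\<forall>u. {w \<in> A. t \<le> u} \<in> sets (F u)"
    from this[rule_format, of t] show "A \<in> sets (F t)" by simp
  next
    assume A: "A \<in> sets (F t)"
    show "\<forall>u. {w \<in> A. t \<le> u} \<in> sets (F u)"
    proof
      fix u show "{w \<in> A. t \<le> u} \<in> sets (F u)"
        using A sets_F_mono[of t u] by (cases "t \<le> u") auto
    qed
  qed
  then show "A \<in> sets (pre_sigma (\<lambda>_. t)) \<longleftrightarrow> A \<in> sets (F t)"
    by (simp only: sets_pre_sigma[OF stopping_time_const] mem_Collect_eq)
qed

section \<open>Approximation by observations up to a finite time\<close>

context path_laws
begin

text \<open>Events observed up to some integer time form an algebra that generates the raw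
  observation field, and an event of the completed field differs from a raw one only inside a null
  set.\<close>

lemma approximate_obs_field_set:
  assumes \<mu>: "\<mu> \<in> prob_measures" and A: "A \<in> sets (obs_field P)" and e: "e > 0"
  shows "\<exists>s\<ge>0. \<exists>B\<in>sets (obs_filtration P (ennreal s)). measure (obs_law P \<mu>) (sym_diff A B) < e"
proof -
  let ?N = "obs_law P \<mu>" and ?R = "restr_to_subalg (P \<mu>) raw_obs"
  interpret prob_space ?N by (rule prob_space_obs_law[OF \<mu>])
  let ?\<A> = "\<Union>n::nat. sets (raw_obs_filtration (ennreal (real n))) :: ('e, 'q) paths set set"
  have mono: "sets (raw_obs_filtration (ennreal (real m))) \<subseteq> sets (raw_obs_filtration (ennreal (real n)) :: ('e, 'q) paths measure)"
    if "m \<le> n" for m n using that by (intro raw_obs_filtration_mono ennreal_leI) simp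
  have alg: "algebra UNIV ?\<A>"
    unfolding algebra_iff_Un
  proof (intro conjI ballI)
    fix a b assume "a \<in> ?\<A>" "b \<in> ?\<A>"
    then obtain m n where "a \<in> sets (raw_obs_filtration (ennreal (real m)))" "b \<in> sets (raw_obs_filtration (ennreal (real n)))" by blast
    then have "a \<in> sets (raw_obs_filtration (ennreal (real (max m n))))" "b \<in> sets (raw_obs_filtration (ennreal (real (max m n))))"
      using mono[of m "max m n"] mono[of n "max m n"] by auto
    then show "a \<union> b \<in> ?\<A>" by blast
  next
    fix a assume "a \<in> ?\<A>"
    then obtain m where "a \<in> sets (raw_obs_filtration (ennreal (real m)))" by blast
    from sets.compl_sets[OF this] show "UNIV - a \<in> ?\<A>" by auto
  qed auto
  have gen: "sets raw_obs \<subseteq> sigma_sets UNIV ?\<A>"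
    unfolding sets_raw_obs_filtration[of \<infinity>]
  proof (intro sigma_sets_mono' subsetI)
    fix S :: "('e, 'q) paths set"
    assume "S \<in> {observation s -` A |s A. 0 \<le> s \<and> ennreal s \<le> \<infinity> \<and> A \<in> sets borel}"
    then obtain s B where S: "S = observation s -` B" "0 \<le> s" "B \<in> sets borel" by blast
    obtain n :: nat where "s \<le> real n" using real_arch_simple by blast
    then have "S \<in> sets (raw_obs_filtration (ennreal (real n)))"
      using measurable_sets[OF observation_raw_obs[OF S(2) ennreal_leI, of "real n"] S(3)] S(1) by simp
    then show "S \<in> ?\<A>" by blast
  qed
  have sub: "?\<A> \<subseteq> sets ?N"
    using raw_obs_le_obs_field by (auto simp: sets_obs_law[OF \<mu>])
  have "A \<in> sets (completion ?R)" using A obs_field_subset_completion[OF \<mu>] by auto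
  then obtain S N N' where SN: "A = S \<union> N" "N \<subseteq> N'" "N' \<in> null_sets ?R" "S \<in> sets ?R"
    by (rule sets_completionE)
  have S: "S \<in> sets raw_obs" and N': "N' \<in> sets raw_obs" "N' \<in> null_sets (P \<mu>)"
    using SN sets_restr_raw_obs[OF \<mu>] null_sets_restr_to_subalg[OF subalgebra_raw_obs[OF \<mu>]] by auto
  have SO: "S \<in> sets (obs_field P)" and N'O: "N' \<in> sets (obs_field P)" using S N'(1) raw_obs_le_obs_field by auto
  have N'0: "measure ?N N' = 0"
    using measure_obs_law[OF \<mu> N'O] measure_completion[of N' "P \<mu>"] N'(2)
    by (metis null_setsD1 null_setsD2 measure_eq_0_null_sets)
  have "S \<in> sigma_sets (space ?N) ?\<A>" using S gen by (auto simp: space_obs_law[OF \<mu>])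
  then obtain B where B: "B \<in> ?\<A>" "measure ?N (sym_diff S B) < e"
    using algebra_approximation[of ?N ?\<A> S e] alg sub e by (auto simp: space_obs_law[OF \<mu>] finite_measure_axioms)
  then obtain n where n: "B \<in> sets (raw_obs_filtration (ennreal (real n)))" by blast
  have m: "sym_diff S B \<in> sets ?N" "N' \<in> sets ?N" "sym_diff A B \<in> sets ?N"
    using SO N'O A B(1) sub by (auto simp: sets_obs_law[OF \<mu>])
  have "measure ?N (sym_diff A B) \<le> measure ?N (sym_diff S B \<union> N')"
    using SN(1,2) m by (intro finite_measure_mono) auto
  also have "\<dots> \<le> measure ?N (sym_diff S B) + measure ?N N'" by (rule measure_Un_le[OF m(1,2)])
  finally have "measure ?N (sym_diff A B) < e" using B(2) N'0 by simp
  moreover have "B \<in> sets (obs_filtration P (ennreal (real n)))" using n raw_obs_le_obs_filtration by auto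
  ultimately show ?thesis by (intro exI[of _ "real n"]) auto
qed

lemma obs_filtration_measurable_mono:
  "f \<in> obs_filtration P (ennreal s) \<rightarrow>\<^sub>M K \<Longrightarrow> s \<le> t \<Longrightarrow> f \<in> obs_filtration P (ennreal t) \<rightarrow>\<^sub>M K"
  by (rule sets_mono_measurable[OF _ _ obs_filtration_mono]) (auto intro: ennreal_leI)

text \<open>This takes the place of Levy's upward theorem: indicators are approximated by events
  known at a finite time, and approximability in the mean passes to sums and to dominated limits. It
  supplies the variables \<open>X\<close> for \<open>merging\<close>.\<close>

lemma approximate_obs_law_integrable:
  fixes f :: "_ \<Rightarrow> real"
  assumes \<mu>: "\<mu> \<in> prob_measures" and f: "integrable (obs_law P \<mu>) f"
  shows "\<forall>e>0. \<exists>s\<ge>0. \<exists>X. X \<in> borel_measurable (obs_filtration P (ennreal s)) \<and>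
    integrable (obs_law P \<mu>) X \<and> (\<integral>w. \<bar>f w - X w\<bar> \<partial>obs_law P \<mu>) < e"
proof -
  let ?N = "obs_law P \<mu>"
  let ?A = "\<lambda>f e. \<exists>s\<ge>0. \<exists>X. X \<in> borel_measurable (obs_filtration P (ennreal s)) \<and>
    integrable ?N X \<and> (\<integral>w. \<bar>f w - X w\<bar> \<partial>?N) < (e::real)"
  interpret prob_space ?N by (rule prob_space_obs_law[OF \<mu>])
  have FN: "sets (obs_filtration P t) \<subseteq> sets ?N" for t
    using subalgebra_obs_filtration[OF \<mu>] by (auto simp: subalgebra_def)
  show ?thesis
    using f
  proof (induction rule: integrable_induct)
    case (base A c)
    show ?case
    proof (intro allI impI)
      fix e :: real assume e: "e > 0"
      \<comment> \<open>The summand 1 covers the case \<open>c = 0\<close>.\<close>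
      then have "e / (\<bar>c\<bar> + 1) > 0" by simp
      moreover have "A \<in> sets (obs_field P)" using base by (simp add: sets_obs_law[OF \<mu>])
      ultimately obtain s B where s: "0 \<le> s" and B: "B \<in> sets (obs_filtration P (ennreal s))"
        and le: "measure ?N (sym_diff A B) < e / (\<bar>c\<bar> + 1)"
        using approximate_obs_field_set[OF \<mu>] by blast
      have BN: "B \<in> sets ?N" using B FN by auto
      have "(\<integral>w. \<bar>indicator A w *\<^sub>R c - indicator B w * c\<bar> \<partial>?N) = (\<integral>w. indicator (sym_diff A B) w * \<bar>c\<bar> \<partial>?N)"
        by (intro Bochner_Integration.integral_cong) (auto split: split_indicator)
      also have "\<dots> = measure ?N (sym_diff A B) * \<bar>c\<bar>"
        using base BN by simp
      also have "\<dots> \<le> measure ?N (sym_diff A B) * (\<bar>c\<bar> + 1)" by (intro mult_left_mono) auto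
      also have "\<dots> < e" using le by (simp add: pos_less_divide_eq)
      finally have lt: "(\<integral>w. \<bar>indicator A w *\<^sub>R c - indicator B w * c\<bar> \<partial>?N) < e" .
      have "integrable ?N (\<lambda>w. indicator B w * c)"
        using BN by (intro integrable_mult_left integrable_real_indicator) (auto simp: less_top[symmetric])
      with lt s B show "?A (\<lambda>w. indicator A w *\<^sub>R c) e"
        by (intro exI[of _ s] conjI exI[of _ "\<lambda>w. indicator B w * c"]) auto
    qed
  next
    case (add f g)
    show ?case
    proof (intro allI impI)
      fix e :: real assume e: "e > 0"
      then have e2: "e / 2 > 0" by simp
      obtain s X where X: "0 \<le> s" "X \<in> borel_measurable (obs_filtration P (ennreal s))" "integrable ?N X"
        "(\<integral>w. \<bar>f w - X w\<bar> \<partial>?N) < e / 2" using add.IH(1) e2 by blast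
      obtain t Y where Y: "0 \<le> t" "Y \<in> borel_measurable (obs_filtration P (ennreal t))" "integrable ?N Y"
        "(\<integral>w. \<bar>g w - Y w\<bar> \<partial>?N) < e / 2" using add.IH(2) e2 by blast
      have "(\<integral>w. \<bar>(f w + g w) - (X w + Y w)\<bar> \<partial>?N) \<le> (\<integral>w. \<bar>f w - X w\<bar> + \<bar>g w - Y w\<bar> \<partial>?N)"
        by (rule integral_mono) (use add.hyps X(3) Y(3) in auto)
      also have "\<dots> = (\<integral>w. \<bar>f w - X w\<bar> \<partial>?N) + (\<integral>w. \<bar>g w - Y w\<bar> \<partial>?N)"
        using add.hyps X(3) Y(3) by simp
      finally have "(\<integral>w. \<bar>(f w + g w) - (X w + Y w)\<bar> \<partial>?N) < e" using X(4) Y(4) by linarith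
      moreover have "(\<lambda>w. X w + Y w) \<in> borel_measurable (obs_filtration P (ennreal (max s t)))"
        using obs_filtration_measurable_mono[OF X(2), of "max s t"] obs_filtration_measurable_mono[OF Y(2), of "max s t"] by auto
      ultimately show "?A (\<lambda>w. f w + g w) e"
        using X(1,3) Y(3) by (intro exI[of _ "max s t"] conjI exI[of _ "\<lambda>w. X w + Y w"]) auto
    qed
  next
    case (lim f u)
    show ?case
    proof (intro allI impI)
      fix e :: real assume e: "e > 0"
      then have e2: "e / 2 > 0" by simp
      have "(\<lambda>i. \<integral>w. \<bar>f w - u i w\<bar> \<partial>?N) \<longlonglongrightarrow> (\<integral>w. 0 \<partial>?N)"
      proof (rule integral_dominated_convergence[where w="\<lambda>w. 3 * \<bar>f w\<bar>"])
        \<comment> \<open>The induction rule supplies approximants with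
          \<open>\<bar>u i w\<bar> \<le> 2 * \<bar>f w\<bar>\<close>; adding
          \<open>\<bar>f w\<bar>\<close> gives the factor 3.\<close>
        show "integrable ?N (\<lambda>w. 3 * \<bar>f w\<bar>)" using lim.hyps by auto
        show "AE w in ?N. (\<lambda>i. \<bar>f w - u i w\<bar>) \<longlonglongrightarrow> 0"
        proof (rule AE_I2)
          fix w assume "w \<in> space ?N"
          then have "(\<lambda>i. \<bar>f w - u i w\<bar>) \<longlonglongrightarrow> \<bar>f w - f w\<bar>" using lim.hyps by (intro tendsto_intros) auto
          then show "(\<lambda>i. \<bar>f w - u i w\<bar>) \<longlonglongrightarrow> 0" by simp
        qed
        show "AE w in ?N. norm \<bar>f w - u i w\<bar> \<le> 3 * \<bar>f w\<bar>" for i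
        proof (rule AE_I2)
          fix w assume "w \<in> space ?N"
          then have "\<bar>u i w\<bar> \<le> 2 * \<bar>f w\<bar>" using lim.hyps by auto
          then show "norm \<bar>f w - u i w\<bar> \<le> 3 * \<bar>f w\<bar>" by simp
        qed
      qed (use lim.hyps in auto)
      then have "(\<lambda>i. \<integral>w. \<bar>f w - u i w\<bar> \<partial>?N) \<longlonglongrightarrow> 0" by simp
      from order_tendstoD(2)[OF this e2] obtain i where i: "(\<integral>w. \<bar>f w - u i w\<bar> \<partial>?N) < e / 2"
        by (auto simp: eventually_sequentially)
      obtain s X where X: "0 \<le> s" "X \<in> borel_measurable (obs_filtration P (ennreal s))" "integrable ?N X"
        "(\<integral>w. \<bar>u i w - X w\<bar> \<partial>?N) < e / 2" using lim.IH[of i] e2 by blast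
      have int: "integrable ?N f" "integrable ?N (u i)" using lim.hyps by auto
      have "(\<integral>w. \<bar>f w - X w\<bar> \<partial>?N) \<le> (\<integral>w. \<bar>f w - u i w\<bar> + \<bar>u i w - X w\<bar> \<partial>?N)"
        by (rule integral_mono) (use int X(3) in auto)
      also have "\<dots> = (\<integral>w. \<bar>f w - u i w\<bar> \<partial>?N) + (\<integral>w. \<bar>u i w - X w\<bar> \<partial>?N)"
        using int X(3) by simp
      finally have "(\<integral>w. \<bar>f w - X w\<bar> \<partial>?N) < e" using X(4) i by linarith
      then show "?A f e"
        using X by blast
    qed
  qed
qed

end

section \<open>Total variation from an algebra of events, and the filter at a fixed time\<close>

context hidden_markov_model
begin

lemma measure_P_average:
  assumes \<mu>: "\<mu> \<in> prob_measures" and \<nu>: "\<nu> \<in> prob_measures" and A: "A \<in> sets raw_obs"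
  shows "measure (P (average \<mu> \<nu>)) A = (measure (P \<mu>) A + measure (P \<nu>) A) / 2"
  using integral_average[OF \<mu> \<nu> start_prob_bounded_measurable[OF A]]
    measure_P_raw_obs[OF \<mu> A] measure_P_raw_obs[OF \<nu> A] measure_P_raw_obs[OF average_prob_measures[OF \<mu> \<nu>] A]
  by simp

text \<open>Sets and functions measurable in the completed field \<open>obs_field P\<close> can be replaced by raw ones
  under two laws simultaneously because the law with the average initial distribution dominates
  both.\<close>

lemma tv_dist_obs_law_le:
  assumes \<mu>: "\<mu> \<in> prob_measures" and \<nu>: "\<nu> \<in> prob_measures"
    and alg: "algebra UNIV \<A>" and gen: "sets raw_obs = sigma_sets UNIV \<A>"
    and c: "\<And>A. A \<in> \<A> \<Longrightarrow> \<bar>measure (P \<mu>) A - measure (P \<nu>) A\<bar> \<le> c"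
  shows "\<bar>tv_dist (obs_law P \<mu>) (obs_law P \<nu>)\<bar> \<le> 2 * c"
proof -
  let ?\<rho> = "average \<mu> \<nu>"
  let ?R = "\<lambda>\<mu>. restr_to_subalg (P \<mu>) raw_obs"
  note \<rho> = average_prob_measures[OF \<mu> \<nu>]
  have mR: "measure (?R \<mu>) A = measure (P \<mu>) A" if "\<mu> \<in> prob_measures" "A \<in> sets raw_obs" for \<mu> A
    using that by (simp add: measure_def emeasure_restr_to_subalg[OF subalgebra_raw_obs])
  have pR: "prob_space (?R \<mu>)" if "\<mu> \<in> prob_measures" for \<mu>
    by (rule prob_space_restr_to_subalg[OF subalgebra_raw_obs prob_space_P]) fact+
  have ARaw: "A \<in> sets raw_obs" if "A \<in> \<A>" for A
    unfolding gen using that by (rule sigma_sets.Basic)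
  have all: "\<bar>measure (P \<mu>) A - measure (P \<nu>) A\<bar> \<le> c" if A: "A \<in> sets raw_obs" for A
  proof (rule field_le_epsilon)
    fix e :: real assume e: "e > 0"
    interpret R: prob_space "?R ?\<rho>" by (rule pR[OF \<rho>])
    \<comment> \<open>Approximation under the average law is approximation under both laws at once:
      a measure below \<open>e / 4\<close> there means that the two measures sum to less than
      \<open>e / 2\<close>.\<close>
    have "\<exists>A0\<in>\<A>. measure (?R ?\<rho>) (sym_diff A A0) < e / 4"
      using e A alg ARaw R.finite_measure_axioms
      by (intro algebra_approximation)
        (auto simp: space_restr_raw_obs[OF \<rho>] sets_restr_raw_obs[OF \<rho>] gen[symmetric])
    then obtain A0 where A0: "A0 \<in> \<A>" "measure (?R ?\<rho>) (sym_diff A A0) < e / 4" by blast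
    have sd: "sym_diff A A0 \<in> sets raw_obs" using A ARaw[OF A0(1)] by auto
    have sum: "measure (P \<mu>) (sym_diff A A0) + measure (P \<nu>) (sym_diff A A0) < e / 2"
      using A0(2) mR[OF \<rho> sd] measure_P_average[OF \<mu> \<nu> sd] by simp
    have diff: "\<bar>measure (P \<mu>) A - measure (P \<mu>) A0\<bar> \<le> measure (P \<mu>) (sym_diff A A0)" if \<mu>: "\<mu> \<in> prob_measures" for \<mu>
    proof -
      interpret prob_space "P \<mu>" by (rule prob_space_P[OF \<mu>])
      have m: "A \<in> sets (P \<mu>)" "A0 \<in> sets (P \<mu>)" "sym_diff A A0 \<in> sets (P \<mu>)"
        using raw_obs_in_P[OF \<mu>] A ARaw[OF A0(1)] sd by blast+
      have "measure (P \<mu>) A \<le> measure (P \<mu>) (A0 \<union> sym_diff A A0)" "measure (P \<mu>) A0 \<le> measure (P \<mu>) (A \<union> sym_diff A A0)"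
        using m by (auto intro!: finite_measure_mono)
      then show ?thesis
        using measure_Un_le[OF m(2,3)] measure_Un_le[OF m(1,3)] by linarith
    qed
    have "measure (P \<mu>) (sym_diff A A0) \<ge> 0" "measure (P \<nu>) (sym_diff A A0) \<ge> 0" by auto
    then show "\<bar>measure (P \<mu>) A - measure (P \<nu>) A\<bar> \<le> c + e"
      using diff[OF \<mu>] diff[OF \<nu>] c[OF A0(1)] sum by linarith
  qed
  have main: "\<bar>(\<integral>x. f x \<partial>obs_law P \<mu>) - (\<integral>x. f x \<partial>obs_law P \<nu>)\<bar> \<le> 2 * c"
    if f: "f \<in> borel_measurable (obs_law P \<mu>)" "\<forall>x\<in>space (obs_law P \<mu>). \<bar>f x\<bar> \<le> 1" for f
  proof -
    have fO: "f \<in> borel_measurable (obs_field P)"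
      using f(1) measurable_cong_sets[OF sets_obs_law[OF \<mu>] refl] by blast
    have f1: "\<bar>f x\<bar> \<le> 1" for x using f(2)[rule_format, of x] space_obs_law[OF \<mu>] by blast
    obtain g N where g: "g \<in> borel_measurable raw_obs" and N: "N \<in> sets raw_obs"
      and N0: "measure (P ?\<rho>) N = 0" and fg: "\<And>w. w \<notin> N \<Longrightarrow> f w = g w"
      using obs_field_ex_raw_obs[OF \<rho> fO] by blast
    \<comment> \<open>\<open>g\<close> inherits the bound of \<open>f\<close> only off
      \<open>N\<close>, so it is truncated to the interval from -1 to 1 and then rescaled to the
      unit interval for \<open>integral_diff_le_of_sets\<close>. Undoing the rescaling produces the
      factor 2 in \<open>2 * c\<close>.\<close>
    define k where "k x = (max (-1) (min 1 (g x)) + 1) / 2" for x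
    have k: "k \<in> borel_measurable raw_obs" using g unfolding k_def by measurable
    have k01: "0 \<le> k x \<and> k x \<le> 1" for x by (auto simp: k_def)
    have fk: "f w = 2 * k w - 1" if "w \<notin> N" for w
      using fg[OF that] f1[of w] by (auto simp: k_def abs_le_iff add_divide_distrib)
    have int: "(\<integral>x. f x \<partial>obs_law P \<mu>) = 2 * (\<integral>x. k x \<partial>?R \<mu>) - 1"
      if \<mu>: "\<mu> \<in> prob_measures" and N0: "measure (P \<mu>) N = 0" for \<mu>
    proof -
      interpret C: prob_space "completion (P \<mu>)" by (rule prob_space_completion[OF \<mu>])
      interpret pP: prob_space "P \<mu>" by (rule prob_space_P[OF \<mu>])
      have kO: "k \<in> borel_measurable (P \<mu>)" by (rule measurable_from_subalg[OF subalgebra_raw_obs[OF \<mu>] k])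
      have kC: "k \<in> borel_measurable (completion (P \<mu>))" using kO by (rule measurable_completion)
      have "N \<in> null_sets (P \<mu>)"
        using raw_obs_in_P[OF \<mu> N] N0 by (auto simp: null_sets_def pP.emeasure_eq_measure)
      then have "AE w in completion (P \<mu>). w \<notin> N" by (intro AE_completion AE_not_in)
      then have AE: "AE w in completion (P \<mu>). f w = 2 * k w - 1" by eventually_elim (rule fk)
      have "(\<integral>x. f x \<partial>obs_law P \<mu>) = (\<integral>x. f x \<partial>completion (P \<mu>))" by (rule integral_obs_law[OF \<mu> fO])
      also have "\<dots> = (\<integral>x. 2 * k x - 1 \<partial>completion (P \<mu>))"
        using kC measurable_from_subalg[OF subalgebra_obs_field[OF \<mu>] fO]
        by (intro integral_cong_AE[OF _ _ AE]) auto
      also have "\<dots> = 2 * (\<integral>x. k x \<partial>completion (P \<mu>)) - 1"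
      proof -
        have "integrable (completion (P \<mu>)) k"
          using k01 kC by (intro C.integrable_const_bound[where B=1]) auto
        then show ?thesis by (simp add: C.prob_space[simplified])
      qed
      also have "(\<integral>x. k x \<partial>completion (P \<mu>)) = (\<integral>x. k x \<partial>P \<mu>)" by (rule integral_completion[OF kO])
      also have "\<dots> = (\<integral>x. k x \<partial>?R \<mu>)" by (rule integral_subalgebra2[OF subalgebra_raw_obs[OF \<mu>] k, symmetric])
      finally show ?thesis .
    qed
    have "measure (P \<mu>) N + measure (P \<nu>) N = 0" using N0 measure_P_average[OF \<mu> \<nu> N] by simp
    then have N0': "measure (P \<mu>) N = 0" "measure (P \<nu>) N = 0"
      using measure_nonneg[of "P \<mu>" N] measure_nonneg[of "P \<nu>" N] by linarith+
    have "\<bar>(\<integral>x. k x \<partial>?R \<mu>) - (\<integral>x. k x \<partial>?R \<nu>)\<bar> \<le> c"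
    proof (rule integral_diff_le_of_sets[OF pR[OF \<mu>] pR[OF \<nu>]])
      show "sets (?R \<mu>) = sets (?R \<nu>)" by (simp add: sets_restr_raw_obs \<mu> \<nu>)
      show "k \<in> borel_measurable (?R \<mu>)"
        using k measurable_cong_sets[OF sets_restr_raw_obs[OF \<mu>] refl] by blast
      fix A assume "A \<in> sets (?R \<mu>)"
      then have "A \<in> sets raw_obs" by (simp add: sets_restr_raw_obs[OF \<mu>])
      then show "\<bar>measure (?R \<mu>) A - measure (?R \<nu>) A\<bar> \<le> c" using all mR[OF \<mu>] mR[OF \<nu>] by simp
    qed (use k01 in auto)
    then show ?thesis unfolding int[OF \<mu> N0'(1)] int[OF \<nu> N0'(2)] by linarith
  qed
  let ?S = "(\<lambda>f :: _ \<Rightarrow> real. \<bar>(\<integral>x. f x \<partial>obs_law P \<mu>) - (\<integral>x. f x \<partial>obs_law P \<nu>)\<bar>) `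
    {f \<in> borel_measurable (obs_law P \<mu>). \<forall>x\<in>space (obs_law P \<mu>). \<bar>f x\<bar> \<le> 1}"
  have z: "(\<lambda>_. 0 :: real) \<in> {f \<in> borel_measurable (obs_law P \<mu>). \<forall>x\<in>space (obs_law P \<mu>). \<bar>f x\<bar> \<le> 1}" by auto
  have le: "v \<le> 2 * c" if "v \<in> ?S" for v using that main by auto
  have "?S \<noteq> {}" using z by blast
  then have "Sup ?S \<le> 2 * c" by (rule cSup_least) (rule le)
  moreover have "0 \<le> Sup ?S"
  proof (rule cSup_upper2)
    show "\<bar>(\<integral>x. 0 \<partial>obs_law P \<mu>) - (\<integral>x. 0 \<partial>obs_law P \<nu>)\<bar> \<in> ?S" using z by (rule imageI)
    show "bdd_above ?S" by (rule bdd_aboveI[of _ "2 * c"]) (rule le)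
  qed simp
  ultimately show ?thesis unfolding tv_dist_def by simp
qed

text \<open>A measurable map into \<open>prob_algebra borel\<close> takes values there at every
  point, so this holds for every \<open>w\<close> and not just almost surely. Hence
  \<open>P (\<pi> t w)\<close> is a law of the family for each fixed \<open>w\<close>.\<close>

lemma filter_prob_measures:
  assumes "nonlinear_filter P \<mu> \<pi>" "0 \<le> t"
  shows "\<pi> t w \<in> prob_measures"
proof -
  have m: "(\<lambda>(t, w). \<pi> t w) \<in> restrict_space borel {0..} \<Otimes>\<^sub>M full_field P \<rightarrow>\<^sub>M prob_algebra borel"
    using assms(1) by (simp add: nonlinear_filter_def)
  have "(t, w) \<in> space (restrict_space borel {0..} \<Otimes>\<^sub>M full_field P)"
    using assms(2) by (simp add: space_pair_measure space_restrict_space full_field_def family_completion_def)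
  from measurable_space[OF m this] show ?thesis by simp
qed

lemma filter_measurable:
  assumes \<pi>: "nonlinear_filter P \<mu> \<pi>" and t: "0 \<le> t" and h: "h \<in> bounded_measurable"
  shows "(\<lambda>w. \<integral>x. h x \<partial>\<pi> t w) \<in> borel_measurable (obs_filtration P (ennreal t))"
proof (rule daniell_measurable[OF borel_generator daniell_prob_measure[OF filter_prob_measures[OF \<pi> t]]])
  fix A :: "'e set" assume A: "A \<in> sets borel"
  then have "(\<lambda>(t, w). measure (\<pi> t w) A) \<in> borel_measurable (optional_field (obs_filtration P))"
    using \<pi> by (simp add: nonlinear_filter_def optional_projection_def)
  from measurable_optional_section[OF this t]
  show "(\<lambda>w. \<integral>x. (indicator A x :: real) \<partial>\<pi> t w) \<in> borel_measurable (obs_filtration P (ennreal t))"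
    using prob_measuresD(3)[OF filter_prob_measures[OF \<pi> t]] by simp
qed (use h in \<open>simp add: bounded_measurable_on_borel\<close>)

text \<open>The optional projection at the constant stopping time \<open>t\<close> says that
  \<open>measure (\<pi> t w) A\<close> is the conditional probability of \<open>A\<close> for the
  signal given the observations; Daniell functionals extend this from \<open>A\<close> to
  \<open>h\<close>.\<close>

lemma filter_integral:
  assumes \<pi>: "nonlinear_filter P \<mu> \<pi>" and \<mu>: "\<mu> \<in> prob_measures" and t: "0 \<le> t" and h: "h \<in> bounded_measurable"
    and B: "B \<in> sets (obs_filtration P (ennreal t))"
  shows "(\<integral>w. indicator B w * (\<integral>x. h x \<partial>\<pi> t w) \<partial>completion (P \<mu>)) =
    (\<integral>w. indicator B w * h (signal t w) \<partial>completion (P \<mu>))"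
proof -
  let ?F = "obs_filtration P" and ?M = "completion (P \<mu>)"
  note pm = filter_prob_measures[OF \<pi> t]
  have FM: "subalgebra ?M (?F u)" for u
    using subalgebra_obs_field[OF \<mu>] obs_filtration_le_obs_field[of u] by (auto simp: subalgebra_def)
  have BM: "B \<in> sets ?M" using B FM by (auto simp: subalgebra_def)
  interpret prob_space ?M by (rule prob_space_completion[OF \<mu>])
  show ?thesis
  proof (rule integral_daniell_eq[OF prob_space_axioms borel_generator daniell_prob_measure[OF pm] daniell_eval, where f=h])
    show "h \<in> bounded_measurable_on borel" using h by (simp add: bounded_measurable_on_borel)
    fix A :: "'e set" assume A: "A \<in> sets borel"
    note iA = bounded_measurable_indicator[OF A]
    have ind: "(\<integral>x. indicator A x \<partial>\<pi> t w) = measure (\<pi> t w) A" for w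
      using prob_measuresD(3)[OF pm] by simp
    have meas: "(\<lambda>w. measure (\<pi> t w) A) \<in> borel_measurable ?M"
      using measurable_from_subalg[OF FM filter_measurable[OF \<pi> t iA]] unfolding ind .
    then show "(\<lambda>w. \<integral>x. (indicator A x :: real) \<partial>\<pi> t w) \<in> borel_measurable ?M" unfolding ind .
    show sig: "(\<lambda>w. indicator A (signal t w) :: real) \<in> borel_measurable ?M"
      using measurable_compose[OF full_measurable_completion[OF \<mu> signal_full[OF t order_refl]]
          borel_measurable_indicator[OF A]] .
    interpret F: filtration UNIV ?F
      by unfold_locales (use obs_filtration_mono in auto)
    have st: "stopping_time ?F (\<lambda>_. ennreal t)" by (rule stopping_time_const)
    let ?G = "F.pre_sigma (\<lambda>_. ennreal t)"
    have sG: "sets ?G = sets (?F (ennreal t))" by (rule F.sets_pre_sigma_const)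
    have "space ?G = UNIV" by (rule F.space_pre_sigma)
    then have GM: "subalgebra ?M ?G" using FM[of "ennreal t"] sG by (auto simp: subalgebra_def)
    interpret finite_measure_subalgebra ?M ?G by unfold_locales (rule GM)
    have stop: "stopped H (\<lambda>_. ennreal t) = H t" for H :: "real \<Rightarrow> ('e, 'q) paths \<Rightarrow> real"
      using t by (auto simp: stopped_def fun_eq_iff)
    have "optional_projection ?M ?F (\<lambda>t w. indicator A (signal t w)) (\<lambda>t w. measure (\<pi> t w) A)"
      using \<pi> A by (simp add: nonlinear_filter_def)
    then have AE: "AE w in ?M. real_cond_exp ?M ?G (\<lambda>w. indicator A (signal t w)) w = measure (\<pi> t w) A"
      using st unfolding optional_projection_def by (auto simp: stop)
    have int: "integrable ?M (\<lambda>w. indicator A (signal t w) :: real)"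
      using sig by (intro integrable_const_bound[where B=1]) (auto split: split_indicator)
    have "(\<integral>w\<in>B. indicator A (signal t w) \<partial>?M) = (\<integral>w\<in>B. real_cond_exp ?M ?G (\<lambda>w. indicator A (signal t w)) w \<partial>?M)"
      using B sG by (intro real_cond_exp_intA[OF int]) simp
    also have "\<dots> = (\<integral>w\<in>B. measure (\<pi> t w) A \<partial>?M)"
      unfolding set_lebesgue_integral_def
      by (intro integral_cong_AE) (use AE BM meas in auto)
    finally show "(\<integral>w. (indicator B w :: real) * (\<integral>x. indicator A x \<partial>\<pi> t w) \<partial>?M) = (\<integral>w. indicator B w * indicator A (signal t w) \<partial>?M)"
      unfolding ind by (simp add: set_lebesgue_integral_def)
  qed (rule BM)
qed

end

section \<open>Stability of the filter\<close>

context hidden_markov_model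
begin

text \<open>An event known from the observations is also known from the full past. So the filter's
  mean of \<open>start_prob A\<close> may be replaced by its value at the signal, and this in turn
  by the indicator of the restarted event.\<close>

lemma filter_restart:
  assumes \<pi>: "nonlinear_filter P \<mu> \<pi>" and \<mu>: "\<mu> \<in> prob_measures" and t: "0 \<le> t"
    and A: "A \<in> sets raw_obs" and B: "B \<in> sets (obs_filtration P (ennreal t))"
  shows "(\<integral>w. indicator B w * (\<integral>x. start_prob A x \<partial>\<pi> t w) \<partial>obs_law P \<mu>) =
    measure (obs_law P \<mu>) (B \<inter> restart t -` A)"
proof -
  let ?M = "completion (P \<mu>)"
  have BO: "B \<in> sets (obs_field P)" using B obs_filtration_le_obs_field by auto
  have S: "restart t -` A \<in> sets (obs_field P)"
    using restart_vimage_raw_obs[OF t A] raw_obs_le_obs_field by auto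
  have BS: "B \<inter> restart t -` A \<in> sets (obs_field P)" using BO S by auto
  have "(\<lambda>w. \<integral>x. start_prob A x \<partial>\<pi> t w) \<in> borel_measurable (obs_field P)"
    by (rule sets_mono_measurable[OF filter_measurable[OF \<pi> t start_prob_bounded_measurable[OF A]] _
          obs_filtration_le_obs_field]) simp
  then have m: "(\<lambda>w. indicator B w * (\<integral>x. start_prob A x \<partial>\<pi> t w)) \<in> borel_measurable (obs_field P)"
    using BO by auto
  have "(\<integral>w. indicator B w * (\<integral>x. start_prob A x \<partial>\<pi> t w) \<partial>obs_law P \<mu>) =
      (\<integral>w. indicator B w * (\<integral>x. start_prob A x \<partial>\<pi> t w) \<partial>?M)"
    by (rule integral_obs_law[OF \<mu> m])
  also have "\<dots> = (\<integral>w. indicator B w * start_prob A (signal t w) \<partial>?M)"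
    by (rule filter_integral[OF \<pi> \<mu> t start_prob_bounded_measurable[OF A] B])
  also have "\<dots> = (\<integral>w. indicator B w * indicator A (restart t w) \<partial>?M)"
    using B obs_filtration_le_full_filtration by (intro restart_integral[OF \<mu> t _ A, symmetric]) auto
  also have "\<dots> = (\<integral>w. indicator (B \<inter> restart t -` A) w \<partial>?M)"
    by (intro Bochner_Integration.integral_cong) (auto split: split_indicator)
  also have "\<dots> = measure ?M (B \<inter> restart t -` A)"
  proof -
    have "B \<inter> restart t -` A \<subseteq> space ?M" using \<mu> by simp
    then show ?thesis by (simp add: Int_absorb2)
  qed
  also have "\<dots> = measure (obs_law P \<mu>) (B \<inter> restart t -` A)"
    by (rule measure_obs_law[OF \<mu> BS, symmetric])
  finally show ?thesis .
qed

lemma filter_merging: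
  assumes \<mu>: "\<mu> \<in> prob_measures" and \<nu>: "\<nu> \<in> prob_measures"
    and \<pi>: "nonlinear_filter P \<mu> \<pi>" and \<pi>': "nonlinear_filter P \<nu> \<pi>'"
    and ac: "absolutely_continuous (obs_law P \<nu>) (obs_law P \<mu>)"
  shows "AE w in P \<mu>. \<forall>e>0. \<exists>t0. \<forall>t\<in>\<rat>. 0 \<le> t \<longrightarrow> t0 \<le> t \<longrightarrow>
    \<bar>tv_dist (obs_law P (\<pi> t w)) (obs_law P (\<pi>' t w))\<bar> \<le> e"
proof -
  obtain \<A> :: "('e, 'q) paths set set" where \<A>: "countable \<A>" "algebra UNIV \<A>"
    and gen: "sets raw_obs = sigma_sets UNIV \<A>"
    by (rule raw_obs_countable_algebra)
  have ARaw: "A \<in> sets raw_obs" if "A \<in> \<A>" for A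
    unfolding gen using that by (rule sigma_sets.Basic)
  let ?N = "obs_law P \<nu>" and ?M = "obs_law P \<mu>"
  interpret N: prob_space ?N by (rule prob_space_obs_law[OF \<nu>])
  interpret M: prob_space ?M by (rule prob_space_obs_law[OF \<mu>])
  have sMN: "sets ?M = sets ?N" by (simp add: sets_obs_law \<mu> \<nu>)
  obtain \<Lambda> where \<Lambda>: "\<Lambda> \<in> borel_measurable ?N" "AE w in ?N. RN_deriv ?N ?M w = ennreal (\<Lambda> w)"
    "AE w in ?M. 0 < \<Lambda> w" "\<And>w. 0 \<le> \<Lambda> w"
    using N.real_RN_deriv[OF M.finite_measure_axioms ac sMN] by blast
  have dens: "?M = density ?N (\<lambda>w. ennreal (\<Lambda> w))"
  proof -
    have "?M = density ?N (RN_deriv ?N ?M)" using N.density_RN_deriv[OF ac sMN] by simp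
    also have "\<dots> = density ?N (\<lambda>w. ennreal (\<Lambda> w))"
      using \<Lambda>(1,2) by (intro density_cong) auto
    finally show ?thesis .
  qed
  have int_M: "(\<integral>w. f w \<partial>?M) = (\<integral>w. \<Lambda> w * f w \<partial>?N)" if "f \<in> borel_measurable ?N" for f :: "_ \<Rightarrow> real"
    unfolding dens using that \<Lambda>(1,4) by (subst integral_real_density) auto
  have i\<Lambda>: "integrable ?N \<Lambda>"
  proof -
    have "integrable (density ?N (\<lambda>w. ennreal (\<Lambda> w))) (\<lambda>_. 1::real)"
      unfolding dens[symmetric] by simp
    then show ?thesis using \<Lambda>(1,4) by (subst (asm) integrable_real_density) auto
  qed
  \<comment> \<open>Pairing times with events puts the uniformity over events into the index set of
    \<open>merging\<close>; both factors are countable.\<close>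
  define I where "I = (\<rat> \<inter> {0..} :: real set) \<times> \<A>"
  define q where "q i w = (\<integral>x. start_prob (snd i) x \<partial>\<pi> (fst i) w)" for i w
  define r where "r i w = (\<integral>x. start_prob (snd i) x \<partial>\<pi>' (fst i) w)" for i w
  define S where "S i = restart (fst i) -` snd i" for i :: "real \<times> ('e, 'q) paths set"
  have iD: "0 \<le> fst i" "snd i \<in> sets raw_obs" if "i \<in> I" for i
    using that ARaw by (auto simp: I_def)
  have q_eq: "q i w = measure (P (\<pi> (fst i) w)) (snd i)" and r_eq: "r i w = measure (P (\<pi>' (fst i) w)) (snd i)"
    if "i \<in> I" for i w
    using measure_P_raw_obs[OF filter_prob_measures[OF \<pi> iD(1)[OF that]] iD(2)[OF that]]
      measure_P_raw_obs[OF filter_prob_measures[OF \<pi>' iD(1)[OF that]] iD(2)[OF that]]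
    by (simp_all add: q_def r_def)
  have q01: "0 \<le> q i w \<and> q i w \<le> 1" and r01: "0 \<le> r i w \<and> r i w \<le> 1" if "i \<in> I" for i w
    unfolding q_eq[OF that] r_eq[OF that]
    using prob_space.prob_le_1[OF prob_space_P[OF filter_prob_measures[OF \<pi> iD(1)[OF that]]]]
      prob_space.prob_le_1[OF prob_space_P[OF filter_prob_measures[OF \<pi>' iD(1)[OF that]]]] by auto
  have qm: "q i \<in> borel_measurable (obs_filtration P (ennreal (fst i)))"
    and rm: "r i \<in> borel_measurable (obs_filtration P (ennreal (fst i)))" if "i \<in> I" for i
    unfolding q_def r_def
    by (intro filter_measurable[OF \<pi>] filter_measurable[OF \<pi>'] start_prob_bounded_measurable iD[OF that])+
  have SN: "S i \<in> sets ?N" if "i \<in> I" for i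
    using restart_vimage_raw_obs[OF iD[OF that]] raw_obs_le_obs_field by (auto simp: S_def sets_obs_law[OF \<nu>])
  have FN: "sets (obs_filtration P u) \<subseteq> sets ?N" for u
    using subalgebra_obs_filtration[OF \<nu>] by (auto simp: subalgebra_def)
  have "AE w in ?N. \<forall>e>0. \<exists>t. \<forall>i\<in>I. t \<le> fst i \<longrightarrow> \<bar>\<Lambda> w\<bar> * \<bar>q i w - r i w\<bar> \<le> e"
  proof (rule merging[where F="\<lambda>t. obs_filtration P (ennreal t)" and S=S])
    show "prob_space ?N" by unfold_locales
    show "subalgebra ?N (obs_filtration P (ennreal t))" for t by (rule subalgebra_obs_filtration[OF \<nu>])
    show "sets (obs_filtration P (ennreal s)) \<subseteq> sets (obs_filtration P (ennreal t))" if "0 \<le> s" "s \<le> t" for s t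
      using that by (intro obs_filtration_mono ennreal_leI)
    show "countable I" unfolding I_def using \<A>(1) countable_rat by auto
    show "integrable ?N \<Lambda>" by (rule i\<Lambda>)
    show "\<exists>s\<ge>0. \<exists>X. X \<in> borel_measurable (obs_filtration P (ennreal s)) \<and> integrable ?N X \<and> (\<integral>w. \<bar>\<Lambda> w - X w\<bar> \<partial>?N) < e"
      if "0 < e" for e
      using approximate_obs_law_integrable[OF \<nu> i\<Lambda>] that by blast
  next
    fix i B assume i: "i \<in> I" and B: "B \<in> sets (obs_filtration P (ennreal (fst i)))"
    note iD = iD[OF i]
    have BN: "B \<in> sets ?N" using B FN by auto
    have BS: "B \<inter> S i \<in> sets ?N" using BN SN[OF i] by auto
    show "(\<integral>w. indicator B w * r i w \<partial>?N) = measure ?N (B \<inter> S i)"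
      unfolding r_def S_def by (rule filter_restart[OF \<pi>' \<nu> iD B])
    have qN: "q i \<in> borel_measurable ?N"
      by (rule measurable_from_subalg[OF subalgebra_obs_filtration[OF \<nu>] qm[OF i]])
    have "(\<integral>w. indicator B w * (q i w * \<Lambda> w) \<partial>?N) = (\<integral>w. \<Lambda> w * (indicator B w * q i w) \<partial>?N)"
      by (simp add: mult_ac)
    also have "\<dots> = (\<integral>w. indicator B w * q i w \<partial>?M)"
      using BN qN by (intro int_M[symmetric]) auto
    also have "\<dots> = measure ?M (B \<inter> S i)"
      unfolding q_def S_def by (rule filter_restart[OF \<pi> \<mu> iD B])
    also have "\<dots> = (\<integral>w. indicator (B \<inter> S i) w \<partial>?M)" using BS sMN by simp
    also have "\<dots> = (\<integral>w. \<Lambda> w * indicator (B \<inter> S i) w \<partial>?N)" using BS by (intro int_M) auto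
    finally show "(\<integral>w. indicator B w * (q i w * \<Lambda> w) \<partial>?N) = (\<integral>w. indicator (B \<inter> S i) w * \<Lambda> w \<partial>?N)"
      by (simp add: mult.commute)
  qed (use iD q01 r01 qm rm SN in auto)
  \<comment> \<open>Only under \<open>?M\<close> is \<Lambda> almost surely positive, so the
    statement is moved there before the density is divided out.\<close>
  then have "AE w in ?M. \<forall>e>0. \<exists>t. \<forall>i\<in>I. t \<le> fst i \<longrightarrow> \<bar>\<Lambda> w\<bar> * \<bar>q i w - r i w\<bar> \<le> e"
    by (rule absolutely_continuous_AE[OF sMN ac])
  with \<Lambda>(3) have "AE w in ?M. \<forall>e>0. \<exists>t0. \<forall>t\<in>\<rat>. 0 \<le> t \<longrightarrow> t0 \<le> t \<longrightarrow>
    \<bar>tv_dist (obs_law P (\<pi> t w)) (obs_law P (\<pi>' t w))\<bar> \<le> e"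
  proof eventually_elim
    case (elim w)
    show ?case
    proof (intro allI impI)
      fix e :: real assume e: "e > 0"
      \<comment> \<open>The factor \<open>\<Lambda> w\<close> is there to be cancelled for this
        fixed \<open>w\<close>; the half anticipates that \<open>tv_dist_obs_law_le\<close> doubles
        a bound on events.\<close>
      then have "\<Lambda> w * (e / 2) > 0" using elim(1) by simp
      then obtain t0 where t0: "\<And>i. i \<in> I \<Longrightarrow> t0 \<le> fst i \<Longrightarrow> \<bar>\<Lambda> w\<bar> * \<bar>q i w - r i w\<bar> \<le> \<Lambda> w * (e / 2)"
        using elim(2) by blast
      show "\<exists>t0. \<forall>t\<in>\<rat>. 0 \<le> t \<longrightarrow> t0 \<le> t \<longrightarrow> \<bar>tv_dist (obs_law P (\<pi> t w)) (obs_law P (\<pi>' t w))\<bar> \<le> e"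
      proof (intro exI[of _ t0] ballI impI)
        fix t :: real assume t: "t \<in> \<rat>" "0 \<le> t" "t0 \<le> t"
        have "\<bar>measure (P (\<pi> t w)) A - measure (P (\<pi>' t w)) A\<bar> \<le> e / 2" if A: "A \<in> \<A>" for A
        proof -
          have i: "(t, A) \<in> I" using t A by (auto simp: I_def)
          have "\<Lambda> w * \<bar>q (t, A) w - r (t, A) w\<bar> \<le> \<Lambda> w * (e / 2)"
            using t0[OF i] t(3) elim(1) by simp
          then show ?thesis using elim(1) q_eq[OF i, of w] r_eq[OF i, of w] by simp
        qed
        from tv_dist_obs_law_le[OF filter_prob_measures[OF \<pi> t(2)] filter_prob_measures[OF \<pi>' t(2)] \<A>(2) gen this]
        show "\<bar>tv_dist (obs_law P (\<pi> t w)) (obs_law P (\<pi>' t w))\<bar> \<le> e" by simp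
      qed
    qed
  qed
  then have "AE w in completion (P \<mu>). \<forall>e>0. \<exists>t0. \<forall>t\<in>\<rat>. 0 \<le> t \<longrightarrow> t0 \<le> t \<longrightarrow>
    \<bar>tv_dist (obs_law P (\<pi> t w)) (obs_law P (\<pi>' t w))\<bar> \<le> e"
    unfolding obs_law_def[of P \<mu>] by (rule AE_restr_to_subalg[OF subalgebra_obs_field[OF \<mu>]])
  then show ?thesis by (simp only: AE_completion_iff)
qed

text \<open>Only the lower semicontinuity of \<open>dist_on G\<close> is needed to pass from rational to real times,
  and this holds for any supremum of right-continuous functions.\<close>

lemma filter_dist_rational_bound:
  assumes \<pi>: "nonlinear_filter P \<mu> \<pi>" and \<pi>': "nonlinear_filter P \<nu> \<pi>'"
    and G: "G \<subseteq> bcontfun" "uniformly_bounded G" and e: "0 \<le> e" and t: "0 \<le> t"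
    and bound: "\<And>s. s \<in> \<rat> \<Longrightarrow> t < s \<Longrightarrow> dist_on G (\<pi> s w) (\<pi>' s w) \<le> e"
  shows "dist_on G (\<pi> t w) (\<pi>' t w) \<le> e"
proof (rule dist_on_leI[OF e])
  fix g assume g: "g \<in> G"
  then have gb: "g \<in> bcontfun" using G by auto
  obtain s where s: "\<And>n::nat. s n \<in> \<rat> \<and> t < s n" "filterlim s (at_right t) sequentially"
    using ex_rational_sequence_right[of t] by blast
  have lim: "(\<lambda>n. \<integral>x. g x \<partial>p (s n) w) \<longlonglongrightarrow> (\<integral>x. g x \<partial>p t w)"
    if p: "nonlinear_filter P \<rho> p" for \<rho> p
  proof -
    have "cadlag_in weak_topology (\<lambda>t. p t w)" using p unfolding nonlinear_filter_def by blast
    then have "limitin weak_topology (\<lambda>t. p t w) (p t w) (at_right t)"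
      using t unfolding cadlag_in_def by blast
    from filterlim_compose[OF weak_tendsto_integral[OF this gb filter_prob_measures[OF p t]] s(2)]
    show ?thesis .
  qed
  have "(\<lambda>n. \<bar>(\<integral>x. g x \<partial>\<pi> (s n) w) - (\<integral>x. g x \<partial>\<pi>' (s n) w)\<bar>) \<longlonglongrightarrow> \<bar>(\<integral>x. g x \<partial>\<pi> t w) - (\<integral>x. g x \<partial>\<pi>' t w)\<bar>"
    by (intro tendsto_intros lim[OF \<pi>] lim[OF \<pi>'])
  moreover have "\<bar>(\<integral>x. g x \<partial>\<pi> (s n) w) - (\<integral>x. g x \<partial>\<pi>' (s n) w)\<bar> \<le> e" for n
  proof -
    have sn: "0 \<le> s n" using s(1)[of n] t by simp
    have "\<bar>(\<integral>x. g x \<partial>\<pi> (s n) w) - (\<integral>x. g x \<partial>\<pi>' (s n) w)\<bar> \<le> dist_on G (\<pi> (s n) w) (\<pi>' (s n) w)"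
      by (rule dist_on_bounds(2)[OF G(2) filter_prob_measures[OF \<pi> sn] filter_prob_measures[OF \<pi>' sn] g])
    also have "\<dots> \<le> e" using bound s(1) by blast
    finally show ?thesis .
  qed
  ultimately show "\<bar>(\<integral>x. g x \<partial>\<pi> t w) - (\<integral>x. g x \<partial>\<pi>' t w)\<bar> \<le> e"
    by (intro LIMSEQ_le_const2) auto
qed

lemma filter_stability:
  assumes \<mu>: "\<mu> \<in> prob_measures" and \<nu>: "\<nu> \<in> prob_measures"
    and \<pi>: "nonlinear_filter P \<mu> \<pi>" and \<pi>': "nonlinear_filter P \<nu> \<pi>'"
    and G: "G \<subseteq> bcontfun" "uniformly_bounded G" and obs: "uniformly_observable G P"
    and ac: "absolutely_continuous (obs_law P \<nu>) (obs_law P \<mu>)"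
  shows "AE w in P \<mu>. ((\<lambda>t. dist_on G (\<pi> t w) (\<pi>' t w)) \<longlongrightarrow> 0) at_top"
  using filter_merging[OF \<mu> \<nu> \<pi> \<pi>' ac]
proof eventually_elim
  case (elim w)
  note pm = filter_prob_measures[OF \<pi>] filter_prob_measures[OF \<pi>']
  note nn = dist_on_bounds(1)[OF G(2) pm]
  \<comment> \<open>Uniform observability is sequential, hence the contradiction: failure at the
    fixed \<open>w\<close> yields rational times tending to infinity at which the distance over
    \<open>G\<close> exceeds \<open>e\<close> while total variation tends to 0. The times may depend
    on \<open>w\<close> in any manner, since no measurability in \<open>w\<close> is
    involved.\<close>
  have rational: "\<exists>n::nat. \<forall>t\<in>\<rat>. real n \<le> t \<longrightarrow> dist_on G (\<pi> t w) (\<pi>' t w) \<le> e" if e: "e > 0" for e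
  proof (rule ccontr)
    assume "\<not> ?thesis"
    then have "\<forall>n::nat. \<exists>t\<in>\<rat>. real n \<le> t \<and> e < dist_on G (\<pi> t w) (\<pi>' t w)" by (simp add: not_le)
    then obtain s where s: "\<And>n::nat. s n \<in> \<rat>" "\<And>n. real n \<le> s n" "\<And>n. e < dist_on G (\<pi> (s n) w) (\<pi>' (s n) w)"
      by metis
    have s0: "0 \<le> s n" for n using s(2)[of n] by linarith
    have "(\<lambda>n. tv_dist (obs_law P (\<pi> (s n) w)) (obs_law P (\<pi>' (s n) w))) \<longlonglongrightarrow> 0"
    proof (rule LIMSEQ_I)
      fix d :: real assume "d > 0"
      then have "d / 2 > 0" by simp
      then obtain t0 where t0: "\<And>t. t \<in> \<rat> \<Longrightarrow> 0 \<le> t \<Longrightarrow> t0 \<le> t \<Longrightarrow>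
          \<bar>tv_dist (obs_law P (\<pi> t w)) (obs_law P (\<pi>' t w))\<bar> \<le> d / 2" using elim by blast
      obtain m :: nat where m: "t0 \<le> real m" using real_arch_simple by blast
      show "\<exists>m. \<forall>n\<ge>m. norm (tv_dist (obs_law P (\<pi> (s n) w)) (obs_law P (\<pi>' (s n) w)) - 0) < d"
      proof (intro exI[of _ m] allI impI)
        fix n assume "m \<le> n"
        then have "t0 \<le> s n" using m s(2)[of n] by linarith
        from t0[OF s(1) s0 this] \<open>d > 0\<close>
        show "norm (tv_dist (obs_law P (\<pi> (s n) w)) (obs_law P (\<pi>' (s n) w)) - 0) < d" by simp
      qed
    qed
    from obs[unfolded uniformly_observable_def, rule_format,
        of "\<lambda>n. \<pi> (s n) w" "\<lambda>n. \<pi>' (s n) w", OF pm(1)[OF s0] pm(2)[OF s0] this]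
    have "(\<lambda>n. dist_on G (\<pi> (s n) w) (\<pi>' (s n) w)) \<longlonglongrightarrow> 0" .
    from order_tendstoD(2)[OF this e] obtain n where "dist_on G (\<pi> (s n) w) (\<pi>' (s n) w) < e"
      by (auto simp: eventually_sequentially)
    with s(3)[of n] show False by simp
  qed
  show ?case
  proof (rule tendstoI)
    fix e :: real assume e: "e > 0"
    then obtain n :: nat where n: "\<And>t. t \<in> \<rat> \<Longrightarrow> real n \<le> t \<Longrightarrow> dist_on G (\<pi> t w) (\<pi>' t w) \<le> e / 2"
      using rational[of "e / 2"] by auto
    have "dist (dist_on G (\<pi> t w) (\<pi>' t w)) 0 < e" if t: "real n \<le> t" for t
    proof -
      have t0: "0 \<le> t" using t by linarith
      have "dist_on G (\<pi> t w) (\<pi>' t w) \<le> e / 2"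
        using e n t by (intro filter_dist_rational_bound[OF \<pi> \<pi>' G _ t0]) auto
      then show ?thesis using nn[OF t0 t0, of w w] e by (simp add: dist_real_def)
    qed
    then show "\<forall>\<^sub>F t in at_top. dist (dist_on G (\<pi> t w) (\<pi>' t w)) 0 < e"
      unfolding eventually_at_top_linorder by blast
  qed
qed

end

theorem theorem3p3:
  fixes T :: "real \<Rightarrow> ('e::polish_space \<times> (real ^ 'q::finite) \<Rightarrow> real) \<Rightarrow> 'e \<times> (real ^ 'q) \<Rightarrow> real"
    and P :: "'e measure \<Rightarrow> ('e, 'q) paths measure"
    and \<pi> :: "'e measure \<Rightarrow> real \<Rightarrow> ('e, 'q) paths \<Rightarrow> 'e measure"
    and G :: "('e \<Rightarrow> real) set"
    and \<mu> \<nu> :: "'e measure"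
  assumes "hidden_markov_model T P"
    and "\<And>\<rho>. \<rho> \<in> prob_measures \<Longrightarrow> nonlinear_filter P \<rho> (\<pi> \<rho>)"
    and "G \<subseteq> bcontfun" "uniformly_bounded G" "equicontinuous G"
    and "uniformly_observable G P"
    and "\<mu> \<in> prob_measures" "\<nu> \<in> prob_measures"
    and "absolutely_continuous (obs_law P \<nu>) (obs_law P \<mu>)"
  shows "AE \<omega> in P \<mu>. ((\<lambda>t. dist_on G (\<pi> \<mu> t \<omega>) (\<pi> \<nu> t \<omega>)) \<longlongrightarrow> 0) at_top"
proof -
  interpret hidden_markov_model T P by fact
  show ?thesis
    by (rule filter_stability) (use assms in auto)
qed

end
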